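(* Let $H:\mathbb{R}\times\mathbb{R}^d\times\mathbb{R}^d\to\mathbb{R}$ be a $C^2$ Hamiltonian for which there is a constant $A$ with $|d^2H(t,x,p)|\leq A$, $|dH(t,x,p)|\leq A(1+|p|)$ and $|H(t,x,p)|\leq A(1+|p|)^2$ for all $(t,x,p)$. Let $F_0\subset C^2(\mathbb{R}^d,\mathbb{R})$ be an equi-Lipschitz family and $B$ a constant such that $|d^2f_0(x)|\leq B$ for all $f_0\in F_0$, $x\in\mathbb{R}^d$, and such that $u_0:=\inf_{f_0\in F_0}f_0$ is finite valued. Let $F$ be the family of $C^2$ solutions $f:\,]-T(B),T(B)[\times\mathbb{R}^d\to\mathbb{R}$ of $\partial_tf+H(t,x,\partial_xf)=0$ with $f(0,\cdot)=f_0$, $f_0\in F_0$, and assume that $F$ is closed for the $C^1_{loc}$ topology. Put $$\partial_xF(t,x):=\{\partial_x\underline f(t,x)\;:\;\underline f\in F,\ \underline f(t,x)=\min_{f\in F}f(t,x)\}.$$ Let $v(t,x)=V_0^tu_0(x)$ be the viscosity solution and $g(t,x)=G_0^tu_0(x)$ the variational solution (for a fixed variational resolution $G$) with initial condition $u_0$ at time $0$. (i) If $\partial_xF(0,x)$ is convex for each $x\in\mathbb{R}^d$, then $g=\inf_{f\in F}f$ on $[0,T(B)[\times\mathbb{R}^d$. (ii) If $\partial_xF(t,x)$ is convex for each $(t,x)\in[0,T(B)[\times\mathbb{R}^d$, then $v=g=\inf_{f\in F}f$ on $[0,T(B)[\times\mathbb{R}^d$.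
   Context: The Hamilton-Jacobi equation is $\partial_tu(t,x)+H(t,x,\partial_xu(t,x))=0$ (HJ). The Hamiltonian system is $\dot q=\partial_pH(t,q,p)$, $\dot p=-\partial_qH(t,q,p)$ (complete under the assumptions on $H$). No convexity of $H$ is assumed. "$F$ closed for the $C^1_{loc}$ topology" means closed as a subset of $C^1(]-T(B),T(B)[\times\mathbb{R}^d)$ for locally uniform convergence of functions and first derivatives. For a locally Lipschitz function $u:\mathbb{R}^d\to\mathbb{R}$, the Clarke differential $Du(x)$ is the convex hull of the set of limits $\lim du(x_n)$ with $x_n\to x$ points of differentiability of $u$. Classical solutions (recalled facts fixing $T(\cdot)$). A function $Q^t(r)$, $t\geq0$, $r\in[0,\infty]$, with values in $[0,\infty]$, non-decreasing in $t$ and in $r$, satisfying $Q^0(r)=r$ and the semi-group property $Q^{t+s}=Q^t\circ Q^s$, is fixed, such that $T(r):=\sup\{t\geq0: Q^t(r)<\infty\}$ is positive for each $r\in[0,\infty[$ and such that: for each $s$ and each $C^2$ function $f_s$ on $\mathbb{R}^d$ with $\|d^2f_s\|_\infty\leq r$ there is a unique $C^2$ solution $f:\,]s-T(r),s+T(r)[\times\mathbb{R}^d\to\mathbb{R}$ of (HJ) with $f(s,\cdot)=f_s$, and it satisfies $\|d^2f_t\|_\infty\leq Q^{|t-s|}(r)$ (here $f_t=f(t,\cdot)$). If $f_s$ is moreover Lipschitz, then $Lip(f_t)\leq(Lip(f_s)+1)e^{A|t-s|}-1$, $|\partial_tf(t,x)|\leq A\big((Lip(f_s)+1)e^{A|t-s|}\big)^2$,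 and for each $T<T(r)$ one has $|d^2f(t,x)|\leq D$ on $]s-T,s+T[\times\mathbb{R}^d$ with $D$ depending only on $A$, $Lip(f_s)$, $Q^T(r)$. Variational solutions. A function $g:[s,\infty)\times\mathbb{R}^d\to\mathbb{R}$ is a variational solution with Lipschitz initial data $u$ at time $s$ if it is locally Lipschitz, $g(s,\cdot)=u$, it solves (HJ) almost everywhere, and for each $(t,x)$ with $t>s$ there is a trajectory $(q,p)$ of the Hamiltonian system with $q(t)=x$, $p(s)\in Du(q(s))$ and $g(t,x)=u(q(s))+\int_s^tp(\tau)\cdot\dot q(\tau)-H(\tau,q(\tau),p(\tau))\,d\tau$. A variational resolution is a family of operators $G_s^t$, $s\leq t$, from the space of Lipschitz functions on $\mathbb{R}^d$ to itself such that $(t,x)\mapsto G_s^tu(x)$ is a variational solution with initial data $u$ at time $s$ and: (1) $Lip(G_s^tu)\leq(Lip(u)+1)e^{A(t-s)}-1$ and $\|G_s^tu-u\|_\infty\leq A(t-s)\big((Lip(u)+1)e^{A(t-s)}\big)^2$; (2) $u\leq w\Rightarrow G_s^tu\leq G_s^tw$; (3) if $f:\,]T^-,T^+[\times\mathbb{R}^d\to\mathbb{R}$ is a $C^2$ solution of (HJ) then $G_s^tf_s=f_t$ for $s\leq t$ in $]T^-,T^+[$. Variational resolutions exist (not unique); one, $G$, is fixed. Viscosity solutions. A continuous function $w$ on an open subset of $\mathbb{R}\times\mathbb{R}^d$ is a viscosity solution of (HJ) if each smooth $\phi$ having a contact from above (resp. from below) with $w$ at a point $(t_0,x_0)$ satisfies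 $\partial_t\phi(t_0,x_0)+H(t_0,x_0,\partial_x\phi(t_0,x_0))\leq0$ (resp. $\geq0$). For Lipschitz $u$, $(t,x)\mapsto V_s^tu(x)$ is the unique function $v$ on $[s,\infty[\times\mathbb{R}^d$ that is a viscosity solution on $]s,\infty[\times\mathbb{R}^d$, with $v(s,\cdot)=u$ and $v(t,x)-u(x)$ bounded and Lipschitz on $]s,T[\times\mathbb{R}^d$ for each $T>s$. The operators $V_s^t$ also satisfy properties (1)-(3) above with $V$ in place of $G$, and the Markov property $V_s^t\circ V_\tau^s=V_\tau^t$ for $\tau\leq s\leq t$. *)

theory Defs
  imports "HOL-Analysis.Analysis"
begin

section \<open>Differential calculus\<close>

definition fderiv :: "('a::real_normed_vector \<Rightarrow> 'b::real_normed_vector) \<Rightarrow> 'a \<Rightarrow> 'a \<Rightarrow>\<^sub>L 'b"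
  where "fderiv f x = Blinfun (frechet_derivative f (at x))"

text \<open>Second differential; its \<^const>\<open>norm\<close> is the operator norm of the bilinear form.\<close>

definition fderiv2 :: "('a::real_normed_vector \<Rightarrow> 'b::real_normed_vector) \<Rightarrow> 'a \<Rightarrow> 'a \<Rightarrow>\<^sub>L ('a \<Rightarrow>\<^sub>L 'b)"
  where "fderiv2 f = fderiv (fderiv f)"

definition grad :: "('a::euclidean_space \<Rightarrow> real) \<Rightarrow> 'a \<Rightarrow> 'a"
  where "grad f x = (THE D. GDERIV f x :> D)"

text \<open>Class \<open>C\<^sup>k\<close> on an open set. As the dimension is finite, continuity of the differentials
  can be tested on directional derivatives; values of \<open>f\<close> outside \<open>S\<close> play no role.\<close>

fun Ck_on :: "nat \<Rightarrow> 'a::euclidean_space set \<Rightarrow> ('a \<Rightarrow> real) \<Rightarrow> bool" where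
  "Ck_on 0 S f \<longleftrightarrow> continuous_on S f"
| "Ck_on (Suc k) S f \<longleftrightarrow>
     (\<forall>x\<in>S. f differentiable (at x)) \<and> (\<forall>v. Ck_on k S (\<lambda>x. frechet_derivative f (at x) v))"

definition smooth_on :: "'a::euclidean_space set \<Rightarrow> ('a \<Rightarrow> real) \<Rightarrow> bool"
  where "smooth_on S f \<longleftrightarrow> (\<forall>k. Ck_on k S f)"

text \<open>Sequential closedness is closedness, since the \<open>C\<^sup>1\<^sub>l\<^sub>o\<^sub>c\<close> topology is metrizable.\<close>

definition closed_C1_loc :: "'a::euclidean_space set \<Rightarrow> ('a \<Rightarrow> real) set \<Rightarrow> bool"
  where "closed_C1_loc S F \<longleftrightarrow>
    (\<forall>X h. (\<forall>n. X n \<in> F) \<and> Ck_on 1 S h \<and>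
       (\<forall>K. compact K \<and> K \<subseteq> S \<longrightarrow>
          uniform_limit K X h sequentially \<and>
          uniform_limit K (\<lambda>n. fderiv (X n)) (fderiv h) sequentially)
     \<longrightarrow> h \<in> F)"

definition is_lipschitz :: "('a::metric_space \<Rightarrow> real) \<Rightarrow> bool"
  where "is_lipschitz u \<longleftrightarrow> (\<exists>L. L-lipschitz_on UNIV u)"

definition Lip :: "('a::metric_space \<Rightarrow> real) \<Rightarrow> real"
  where "Lip u = Inf {L. L-lipschitz_on UNIV u}"

definition locally_lipschitz_on :: "'a::metric_space set \<Rightarrow> ('a \<Rightarrow> real) \<Rightarrow> bool"
  where "locally_lipschitz_on S g \<longleftrightarrow> (\<forall>z\<in>S. \<exists>e>0. \<exists>L. L-lipschitz_on (ball z e \<inter> S) g)"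

definition clarke :: "('a::euclidean_space \<Rightarrow> real) \<Rightarrow> 'a \<Rightarrow> 'a set"
  where "clarke u x = convex hull
    {\<xi>. \<exists>X. (\<forall>n. u differentiable (at (X n))) \<and> X \<longlonglongrightarrow> x \<and> (\<lambda>n. grad u (X n)) \<longlonglongrightarrow> \<xi>}"


section \<open>The Hamilton-Jacobi equation and its classical solutions\<close>

text \<open>Functions on a time strip are total functions on \<open>real \<times> 'a\<close>, of which only the values
  on the strip matter. The bounds are extended reals because lifespans may be infinite.\<close>

definition strip :: "ereal \<Rightarrow> ereal \<Rightarrow> (real \<times> 'a) set"
  where "strip a b = {z. a < ereal (fst z) \<and> ereal (fst z) < b}"

definition dt :: "(real \<times> 'a \<Rightarrow> real) \<Rightarrow> real \<times> 'a \<Rightarrow> real"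
  where "dt f z = deriv (\<lambda>\<tau>. f (\<tau>, snd z)) (fst z)"

definition dx :: "(real \<times> 'a::euclidean_space \<Rightarrow> real) \<Rightarrow> real \<times> 'a \<Rightarrow> 'a"
  where "dx f z = grad (\<lambda>y. f (fst z, y)) (snd z)"

definition hj_lhs ::
  "(real \<times> 'a \<times> 'a \<Rightarrow> real) \<Rightarrow> (real \<times> 'a::euclidean_space \<Rightarrow> real) \<Rightarrow> real \<times> 'a \<Rightarrow> real"
  where "hj_lhs H f z = dt f z + H (fst z, snd z, dx f z)"

definition hj_classical ::
  "(real \<times> 'a \<times> 'a \<Rightarrow> real) \<Rightarrow> (real \<times> 'a::euclidean_space) set \<Rightarrow> (real \<times> 'a \<Rightarrow> real) \<Rightarrow> bool"
  where "hj_classical H S f \<longleftrightarrow> Ck_on 2 S f \<and> (\<forall>z\<in>S. hj_lhs H f z = 0)"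

definition hamiltonian :: "(real \<times> 'a::euclidean_space \<times> 'a \<Rightarrow> real) \<Rightarrow> real \<Rightarrow> bool"
  where "hamiltonian H A \<longleftrightarrow> Ck_on 2 UNIV H \<and>
    (\<forall>t x p. norm (fderiv2 H (t, x, p)) \<le> A \<and>
             norm (fderiv H (t, x, p)) \<le> A * (1 + norm p) \<and>
             \<bar>H (t, x, p)\<bar> \<le> A * (1 + norm p)\<^sup>2)"

text \<open>Here \<open>Q t r\<close> stands for \<open>Q\<^sup>t(r)\<close>; only \<open>t \<ge> 0\<close> is meaningful.\<close>

definition lifespan :: "(real \<Rightarrow> ennreal \<Rightarrow> ennreal) \<Rightarrow> real \<Rightarrow> ereal"
  where "lifespan Q r = (SUP t \<in> {t. 0 \<le> t \<and> Q t (ennreal r) < \<infinity>}. ereal t)"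

definition growth_semigroup :: "(real \<Rightarrow> ennreal \<Rightarrow> ennreal) \<Rightarrow> bool"
  where "growth_semigroup Q \<longleftrightarrow>
    (\<forall>s t r. 0 \<le> s \<and> s \<le> t \<longrightarrow> Q s r \<le> Q t r) \<and>
    (\<forall>t r r'. 0 \<le> t \<and> r \<le> r' \<longrightarrow> Q t r \<le> Q t r') \<and>
    (\<forall>r. Q 0 r = r) \<and>
    (\<forall>s t r. 0 \<le> s \<and> 0 \<le> t \<longrightarrow> Q (t + s) r = Q t (Q s r)) \<and>
    (\<forall>r\<ge>0. 0 < lifespan Q r)"

definition hj_cauchy ::
  "(real \<times> 'a \<times> 'a \<Rightarrow> real) \<Rightarrow> (real \<Rightarrow> ennreal \<Rightarrow> ennreal) \<Rightarrow> real \<Rightarrow> real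
    \<Rightarrow> ('a::euclidean_space \<Rightarrow> real) \<Rightarrow> (real \<times> 'a \<Rightarrow> real) \<Rightarrow> bool"
  where "hj_cauchy H Q s r fs f \<longleftrightarrow>
    hj_classical H (strip (ereal s - lifespan Q r) (ereal s + lifespan Q r)) f \<and>
    (\<forall>x. f (s, x) = fs x)"

definition classical_solvability ::
  "(real \<times> 'a::euclidean_space \<times> 'a \<Rightarrow> real) \<Rightarrow> real \<Rightarrow> (real \<Rightarrow> ennreal \<Rightarrow> ennreal) \<Rightarrow> bool"
  where "classical_solvability H A Q \<longleftrightarrow> growth_semigroup Q \<and>
    (\<forall>s r fs. 0 \<le> r \<and> Ck_on 2 UNIV fs \<and> (\<forall>x. norm (fderiv2 fs x) \<le> r) \<longrightarrow>
       (\<exists>f. hj_cauchy H Q s r fs f) \<and>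
       (\<forall>f f'. hj_cauchy H Q s r fs f \<and> hj_cauchy H Q s r fs f' \<longrightarrow>
          (\<forall>z \<in> strip (ereal s - lifespan Q r) (ereal s + lifespan Q r). f z = f' z)) \<and>
       (\<forall>f. hj_cauchy H Q s r fs f \<longrightarrow>
          (\<forall>t x. ereal \<bar>t - s\<bar> < lifespan Q r \<longrightarrow>
             ennreal (norm (fderiv2 (\<lambda>y. f (t, y)) x)) \<le> Q \<bar>t - s\<bar> (ennreal r)))) \<and>
    (\<forall>s r fs f. 0 \<le> r \<and> Ck_on 2 UNIV fs \<and> (\<forall>x. norm (fderiv2 fs x) \<le> r) \<and>
       is_lipschitz fs \<and> hj_cauchy H Q s r fs f \<longrightarrow>
         (\<forall>t. ereal \<bar>t - s\<bar> < lifespan Q r \<longrightarrow>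
            is_lipschitz (\<lambda>x. f (t, x)) \<and>
            Lip (\<lambda>x. f (t, x)) \<le> (Lip fs + 1) * exp (A * \<bar>t - s\<bar>) - 1 \<and>
            (\<forall>x. \<bar>dt f (t, x)\<bar> \<le> A * ((Lip fs + 1) * exp (A * \<bar>t - s\<bar>))\<^sup>2))) \<and>
    (\<exists>D :: real \<Rightarrow> ennreal \<Rightarrow> real.
       \<forall>s r fs f T. 0 \<le> r \<and> Ck_on 2 UNIV fs \<and> (\<forall>x. norm (fderiv2 fs x) \<le> r) \<and>
         is_lipschitz fs \<and> hj_cauchy H Q s r fs f \<and> 0 \<le> T \<and> ereal T < lifespan Q r \<longrightarrow>
           (\<forall>t x. \<bar>t - s\<bar> < T \<longrightarrow> norm (fderiv2 f (t, x)) \<le> D (Lip fs) (Q T (ennreal r))))"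


section \<open>Variational solutions\<close>

text \<open>Trajectories are defined for all times: the Hamiltonian flow is complete.\<close>

definition trajectory ::
  "(real \<times> 'a::euclidean_space \<times> 'a \<Rightarrow> real) \<Rightarrow> (real \<Rightarrow> 'a) \<Rightarrow> (real \<Rightarrow> 'a) \<Rightarrow> bool"
  where "trajectory H q p \<longleftrightarrow> (\<forall>\<tau>.
    (q has_vector_derivative grad (\<lambda>\<eta>. H (\<tau>, q \<tau>, \<eta>)) (p \<tau>)) (at \<tau>) \<and>
    (p has_vector_derivative - grad (\<lambda>y. H (\<tau>, y, p \<tau>)) (q \<tau>)) (at \<tau>))"

definition variational_solution ::
  "(real \<times> 'a \<times> 'a \<Rightarrow> real) \<Rightarrow> real \<Rightarrow> ('a::euclidean_space \<Rightarrow> real) \<Rightarrow> (real \<times> 'a \<Rightarrow> real) \<Rightarrow> bool"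
  where "variational_solution H s u g \<longleftrightarrow>
    locally_lipschitz_on ({s..} \<times> UNIV) g \<and>
    (\<forall>x. g (s, x) = u x) \<and>
    (AE z in lborel. s < fst z \<longrightarrow> g differentiable (at z) \<and> hj_lhs H g z = 0) \<and>
    (\<forall>t x. s < t \<longrightarrow> (\<exists>q p. trajectory H q p \<and> q t = x \<and> p s \<in> clarke u (q s) \<and>
       g (t, x) = u (q s) +
         integral {s..t} (\<lambda>\<tau>. p \<tau> \<bullet> vector_derivative q (at \<tau>) - H (\<tau>, q \<tau>, p \<tau>))))"

text \<open>Properties shared by variational resolutions and by the viscosity operators. In the last
  clause the datum \<open>f\<^sub>s\<close> is required to be Lipschitz, the operators being defined only on
  Lipschitz functions.\<close>

definition hj_operators ::
  "(real \<times> 'a \<times> 'a \<Rightarrow> real) \<Rightarrow> real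
    \<Rightarrow> (real \<Rightarrow> real \<Rightarrow> ('a::euclidean_space \<Rightarrow> real) \<Rightarrow> 'a \<Rightarrow> real) \<Rightarrow> bool"
  where "hj_operators H A G \<longleftrightarrow>
    (\<forall>s t u. s \<le> t \<and> is_lipschitz u \<longrightarrow>
       is_lipschitz (G s t u) \<and>
       Lip (G s t u) \<le> (Lip u + 1) * exp (A * (t - s)) - 1 \<and>
       (\<forall>x. \<bar>G s t u x - u x\<bar> \<le> A * (t - s) * ((Lip u + 1) * exp (A * (t - s)))\<^sup>2)) \<and>
    (\<forall>s t u w. s \<le> t \<and> is_lipschitz u \<and> is_lipschitz w \<and> (\<forall>x. u x \<le> w x) \<longrightarrow>
       (\<forall>x. G s t u x \<le> G s t w x)) \<and>
    (\<forall>a b f s t. hj_classical H (strip a b) f \<and> a < ereal s \<and> s \<le> t \<and> ereal t < b \<and>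
       is_lipschitz (\<lambda>x. f (s, x)) \<longrightarrow> (\<forall>x. G s t (\<lambda>y. f (s, y)) x = f (t, x)))"

definition variational_resolution ::
  "(real \<times> 'a \<times> 'a \<Rightarrow> real) \<Rightarrow> real
    \<Rightarrow> (real \<Rightarrow> real \<Rightarrow> ('a::euclidean_space \<Rightarrow> real) \<Rightarrow> 'a \<Rightarrow> real) \<Rightarrow> bool"
  where "variational_resolution H A G \<longleftrightarrow> hj_operators H A G \<and>
    (\<forall>s u. is_lipschitz u \<longrightarrow> variational_solution H s u (\<lambda>(t, x). G s t u x))"


section \<open>Viscosity solutions\<close>

definition viscosity_solution ::
  "(real \<times> 'a \<times> 'a \<Rightarrow> real) \<Rightarrow> (real \<times> 'a::euclidean_space) set \<Rightarrow> (real \<times> 'a \<Rightarrow> real) \<Rightarrow> bool"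
  where "viscosity_solution H U w \<longleftrightarrow> continuous_on U w \<and>
    (\<forall>z\<in>U. \<forall>\<phi>. smooth_on UNIV \<phi> \<and> \<phi> z = w z \<longrightarrow>
       ((\<forall>\<^sub>F y in nhds z. w y \<le> \<phi> y) \<longrightarrow> hj_lhs H \<phi> z \<le> 0) \<and>
       ((\<forall>\<^sub>F y in nhds z. \<phi> y \<le> w y) \<longrightarrow> 0 \<le> hj_lhs H \<phi> z))"

text \<open>Continuity up to the initial time is explicit: without it the condition
  \<open>v (s, x) = u x\<close> would not relate \<open>u\<close> to the values of \<open>v\<close> at later times.\<close>

definition viscosity_cauchy ::
  "(real \<times> 'a \<times> 'a \<Rightarrow> real) \<Rightarrow> real \<Rightarrow> ('a::euclidean_space \<Rightarrow> real) \<Rightarrow> (real \<times> 'a \<Rightarrow> real) \<Rightarrow> bool"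
  where "viscosity_cauchy H s u v \<longleftrightarrow>
    continuous_on ({s..} \<times> UNIV) v \<and>
    viscosity_solution H ({s<..} \<times> UNIV) v \<and>
    (\<forall>x. v (s, x) = u x) \<and>
    (\<forall>T>s. bounded ((\<lambda>(t, x). v (t, x) - u x) ` ({s<..<T} \<times> UNIV)) \<and>
           (\<exists>L. L-lipschitz_on ({s<..<T} \<times> UNIV) (\<lambda>(t, x). v (t, x) - u x)))"

definition viscosity_operators ::
  "(real \<times> 'a \<times> 'a \<Rightarrow> real) \<Rightarrow> real
    \<Rightarrow> (real \<Rightarrow> real \<Rightarrow> ('a::euclidean_space \<Rightarrow> real) \<Rightarrow> 'a \<Rightarrow> real) \<Rightarrow> bool"
  where "viscosity_operators H A V \<longleftrightarrow>
    (\<forall>s u. is_lipschitz u \<longrightarrow>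
       viscosity_cauchy H s u (\<lambda>(t, x). V s t u x) \<and>
       (\<forall>v. viscosity_cauchy H s u v \<longrightarrow> (\<forall>t\<ge>s. \<forall>x. v (t, x) = V s t u x))) \<and>
    hj_operators H A V \<and>
    (\<forall>\<tau> s t u. \<tau> \<le> s \<and> s \<le> t \<and> is_lipschitz u \<longrightarrow> (\<forall>x. V s t (V \<tau> s u) x = V \<tau> t u x))"


section \<open>Active gradients of a family\<close>

definition dx_family :: "(real \<times> 'a::euclidean_space \<Rightarrow> real) set \<Rightarrow> real \<Rightarrow> 'a \<Rightarrow> 'a set"
  where "dx_family F t x = {dx f (t, x) | f. f \<in> F \<and> (\<forall>h\<in>F. f (t, x) \<le> h (t, x))}"

end

(* Write w for the infimum of the family F. The equation, differentiated in x and in t, turns the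
   uniform bound on the spatial Hessians into uniform local C^{1,1} bounds, so that by Arzela-Ascoli
   and closedness F is compact: the infimum is attained, and limits of active gradients are active.
   Hence the Clarke differential of w(s,.) lies in the convex hull of the active gradients. If these
   form convex sets, the trajectory that represents the variational solution at (t,x) starts on the
   graph of d_x f for some active f and therefore carries the value f(t,x) >= w(t,x); the converse
   inequality is monotonicity. So G_s^t w_s = w_t.

   If convexity holds at all times, this is true for all s <= t, and monotonicity and consistency of
   G with classical solutions make w a viscosity subsolution, by comparison with the classical
   solutions that start from a smooth majorant at a slightly earlier time; as an infimum of classical
   solutions w is a supersolution. Beyond a time T, w is continued by V_T^t w_T, so that uniqueness
   for the Cauchy problem on [0,oo[ applies. *)
theory Submission
  imports Defs "HOL-Complex_Analysis.Great_Picard"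
begin

subsection \<open>Second differentials\<close>

text \<open>Compactness needs constants that are uniform over the family: they may involve a common
  Lipschitz bound \<open>L\<close>, but not the exact \<open>Lip fs\<close> of each member. The
  second-order bounds are therefore drawn from the equation itself, with constants fixed before the
  data. In the subsolution test the obstacle is that a test function touches \<open>w\<close> only
  locally, while monotonicity of the operators compares data on all of space, and the comparison
  solution must live on a time span that does not shrink with the step. The majorant is thus an
  affine function plus a multiple of sqrt(1 + |y - x0|^2): quadratic near the contact, linear at
  infinity, with a Hessian bound independent of the starting time. The continuation past
  \<open>T\<close> is not known to agree with \<open>w\<close> there, so both tests must survive the
  seam. The subsolution test looks only at times up to the contact; the supersolution test uses only
  that the glued function lies below every member of \<open>F\<close> on both sides of
  \<open>T\<close>, which monotonicity and consistency of \<open>V\<close> supply.\<close>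

lemma fderiv_eqI: "(f has_derivative blinfun_apply D) (at x) \<Longrightarrow> fderiv f x = D"
  unfolding fderiv_def
  by (metis blinfun_apply_inverse frechet_derivative_at)

lemma fderiv_works:
  assumes "f differentiable (at x)"
  shows "(f has_derivative blinfun_apply (fderiv f x)) (at x)"
  using assms unfolding fderiv_def
  by (metis bounded_linear_Blinfun_apply frechet_derivative_works has_derivative_bounded_linear)

lemma fderiv_apply: "f differentiable (at x) \<Longrightarrow> blinfun_apply (fderiv f x) v = frechet_derivative f (at x) v"
  using fderiv_works frechet_derivative_at by metis

lemma GDERIV_unique:
  fixes D D' :: "'a::real_inner"
  assumes "GDERIV f x :> D" "GDERIV f x :> D'"
  shows "D = D'"
proof -
  have "(\<lambda>h. h \<bullet> D) = (\<lambda>h. h \<bullet> D')"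
    using assms unfolding gderiv_def by (rule has_derivative_unique)
  then have "(D - D') \<bullet> D = (D - D') \<bullet> D'" by meson
  then have "(D - D') \<bullet> (D - D') = 0" by (simp add: inner_diff_right)
  then show ?thesis by simp
qed

lemma grad_eqI: "GDERIV f x :> D \<Longrightarrow> grad f x = D"
  unfolding grad_def using GDERIV_unique by blast

lemma blinfun_euclidean_sum:
  fixes D :: "'a::euclidean_space \<Rightarrow>\<^sub>L real"
  shows "blinfun_apply D h = h \<bullet> (\<Sum>b\<in>Basis. blinfun_apply D b *\<^sub>R b)"
proof -
  have "blinfun_apply D h = blinfun_apply D (\<Sum>b\<in>Basis. (h \<bullet> b) *\<^sub>R b)" by (simp add: euclidean_representation)
  also have "\<dots> = (\<Sum>b\<in>Basis. (h \<bullet> b) * blinfun_apply D b)"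
    by (simp add: blinfun.sum_right blinfun.scaleR_right)
  finally show ?thesis by (simp add: inner_sum_right mult.commute)
qed

lemma has_derivative_imp_GDERIV:
  fixes f :: "'a::euclidean_space \<Rightarrow> real"
  assumes "(f has_derivative blinfun_apply D) (at x)"
  shows "GDERIV f x :> (\<Sum>b\<in>Basis. blinfun_apply D b *\<^sub>R b)"
  using assms unfolding gderiv_def by (subst (asm) blinfun_euclidean_sum[abs_def]) simp

lemma has_derivative_imp_grad_inner:
  fixes f :: "'a::euclidean_space \<Rightarrow> real"
  assumes "(f has_derivative D) (at x)"
  shows "grad f x \<bullet> v = D v"
proof -
  have "(f has_derivative blinfun_apply (Blinfun D)) (at x)"
    using assms by (simp add: bounded_linear_Blinfun_apply has_derivative_bounded_linear)
  from grad_eqI[OF has_derivative_imp_GDERIV[OF this]]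
  have "grad f x \<bullet> v = blinfun_apply (Blinfun D) v"
    by (metis blinfun_euclidean_sum inner_commute)
  then show ?thesis using assms by (simp add: bounded_linear_Blinfun_apply has_derivative_bounded_linear)
qed

lemma Ck_on_2D:
  assumes "Ck_on 2 S f"
  shows "\<And>x. x \<in> S \<Longrightarrow> f differentiable (at x)"
    and "\<And>x v. x \<in> S \<Longrightarrow> (\<lambda>x. frechet_derivative f (at x) v) differentiable (at x)"
    and "\<And>v w. continuous_on S (\<lambda>z. frechet_derivative (\<lambda>x. frechet_derivative f (at x) v) (at z) w)"
  using assms by (simp_all add: numeral_2_eq_2)

lemma has_derivative_fderiv_apply:
  fixes f :: "'a::euclidean_space \<Rightarrow> real"
  assumes "open S" "Ck_on 2 S f" "x \<in> S"
  shows "((\<lambda>x. blinfun_apply (fderiv f x) v) has_derivative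
           frechet_derivative (\<lambda>x. frechet_derivative f (at x) v) (at x)) (at x)"
proof (rule has_derivative_transform_within_open[OF _ assms(1,3)])
  show "((\<lambda>x. frechet_derivative f (at x) v) has_derivative
           frechet_derivative (\<lambda>x. frechet_derivative f (at x) v) (at x)) (at x)"
    using Ck_on_2D(2)[OF assms(2,3)] frechet_derivative_works by blast
qed (simp add: fderiv_apply Ck_on_2D(1)[OF assms(2)])

text \<open>\<open>Ck_on\<close> speaks only of directional derivatives. In finite dimension
  \<open>fderiv f\<close> is a finite sum of these multiplied by constant functionals, so
  differentiability in each direction gives that of the operator-valued map.\<close>

lemma fderiv_differentiable:
  fixes f :: "'a::euclidean_space \<Rightarrow> real"
  assumes "open S" "Ck_on 2 S f" "x \<in> S"
  shows "fderiv f differentiable (at x)"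
proof -
  have rep: "fderiv f = (\<lambda>z. \<Sum>b\<in>Basis. blinfun_apply (fderiv f z) b *\<^sub>R blinfun_inner_left b)"
  proof (rule ext, rule blinfun_eqI)
    fix z h
    show "blinfun_apply (fderiv f z) h = blinfun_apply (\<Sum>b\<in>Basis. blinfun_apply (fderiv f z) b *\<^sub>R blinfun_inner_left b) h"
      by (subst blinfun_euclidean_sum) (simp add: blinfun.sum_left blinfun.scaleR_left inner_sum_right)
  qed
  show ?thesis
    apply (subst rep)
    unfolding differentiable_def
    by (rule exI, rule has_derivative_sum)
       (rule has_derivative_scaleR_left[OF has_derivative_fderiv_apply[OF assms]])
qed

lemma fderiv2_works:
  fixes f :: "'a::euclidean_space \<Rightarrow> real"
  assumes "open S" "Ck_on 2 S f" "x \<in> S"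
  shows "(fderiv f has_derivative blinfun_apply (fderiv2 f x)) (at x)"
  unfolding fderiv2_def by (rule fderiv_works[OF fderiv_differentiable[OF assms]])

lemma fderiv2_apply:
  fixes f :: "'a::euclidean_space \<Rightarrow> real"
  assumes "open S" "Ck_on 2 S f" "x \<in> S"
  shows "blinfun_apply (blinfun_apply (fderiv2 f x) w) v
       = frechet_derivative (\<lambda>x. frechet_derivative f (at x) v) (at x) w"
proof -
  have "((\<lambda>x. blinfun_apply (fderiv f x) v) has_derivative (\<lambda>w. blinfun_apply (blinfun_apply (fderiv2 f x) w) v)) (at x)"
    by (rule bounded_linear.has_derivative[OF _ fderiv2_works[OF assms]]) (rule blinfun.bounded_linear_left)
  from has_derivative_unique[OF this has_derivative_fderiv_apply[OF assms]] show ?thesis by (rule fun_cong)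
qed

lemma continuous_on_fderiv2:
  fixes f :: "'a::euclidean_space \<Rightarrow> real"
  assumes "open S" "Ck_on 2 S f"
  shows "continuous_on S (fderiv2 f)"
  apply (rule continuous_on_blinfun_componentwise)
  apply (rule continuous_on_blinfun_componentwise)
  subgoal for i j
    using Ck_on_2D(3)[OF assms(2), of j i] fderiv2_apply[OF assms]
    by (metis (no_types, lifting) continuous_on_cong)
  done

text \<open>The mean value theorem used twice: along \<open>v\<close> for the increment in direction
  \<open>w\<close>, then along \<open>w\<close> for the derivative so obtained. The bound on
  \<open>h\<close> keeps the whole parallelogram inside the ball.\<close>

lemma mixed_difference_mvt:
  fixes f :: "'a::euclidean_space \<Rightarrow> real"
  assumes S: "open S" "Ck_on 2 S f" and r: "ball x r \<subseteq> S" and h: "0 < h" "h * (norm v + norm w) < r"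
  shows "\<exists>z\<in>ball x r. f (x + h *\<^sub>R v + h *\<^sub>R w) - f (x + h *\<^sub>R v) - f (x + h *\<^sub>R w) + f x
     = h * h * blinfun_apply (blinfun_apply (fderiv2 f z) w) v"
proof -
  have inb: "x + a *\<^sub>R v + b *\<^sub>R w \<in> ball x r" if "0 \<le> a" "a \<le> h" "0 \<le> b" "b \<le> h" for a b
  proof -
    have "norm (a *\<^sub>R v + b *\<^sub>R w) \<le> a * norm v + b * norm w"
      using that norm_triangle_ineq[of "a *\<^sub>R v" "b *\<^sub>R w"] by simp
    also have "\<dots> \<le> h * norm v + h * norm w" using that by (intro add_mono mult_right_mono) auto
    also have "\<dots> < r" using h by (simp add: algebra_simps)
    finally have "norm (- (a *\<^sub>R v + b *\<^sub>R w)) < r" by (simp only: norm_minus_cancel)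
    moreover have "x - (x + a *\<^sub>R v + b *\<^sub>R w) = - (a *\<^sub>R v + b *\<^sub>R w)" by simp
    ultimately show ?thesis by (simp only: mem_ball dist_norm)
  qed
  have d1: "(f has_derivative blinfun_apply (fderiv f z)) (at z)" if "z \<in> ball x r" for z
    using fderiv_works Ck_on_2D(1)[OF S(2)] that r by blast
  have d2: "(fderiv f has_derivative blinfun_apply (fderiv2 f z)) (at z)" if "z \<in> ball x r" for z
    using fderiv2_works[OF S] that r by blast
  define g where "g a = f (x + a *\<^sub>R v + h *\<^sub>R w) - f (x + a *\<^sub>R v + 0 *\<^sub>R w)" for a
  have "(g has_real_derivative (blinfun_apply (fderiv f (x + a *\<^sub>R v + h *\<^sub>R w)) v
      - blinfun_apply (fderiv f (x + a *\<^sub>R v + 0 *\<^sub>R w)) v)) (at a)" if "0 \<le> a" "a \<le> h" for a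
  proof -
    have "((\<lambda>a. f (x + a *\<^sub>R v + b *\<^sub>R w)) has_derivative
      (\<lambda>t. blinfun_apply (fderiv f (x + a *\<^sub>R v + b *\<^sub>R w)) (t *\<^sub>R v))) (at a)" if "0 \<le> b" "b \<le> h" for b
    proof -
      have "((\<lambda>a. x + a *\<^sub>R v + b *\<^sub>R w) has_derivative (\<lambda>t. t *\<^sub>R v)) (at a)"
        by (auto intro!: derivative_eq_intros)
      from has_derivative_compose[OF this d1] inb[of a b] that \<open>0 \<le> a\<close> \<open>a \<le> h\<close> show ?thesis by blast
    qed
    from has_derivative_diff[OF this[of h] this[of 0], OF _ order.refl order.refl] h(1)
    show ?thesis unfolding g_def has_field_derivative_def
      by (simp, elim has_derivative_eq_rhs) (auto simp: fun_eq_iff blinfun.scaleR_right algebra_simps)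
  qed
  from MVT2[OF h(1) this] obtain a where a: "0 < a" "a < h" "g h - g 0 = (h - 0) * (blinfun_apply (fderiv f (x + a *\<^sub>R v + h *\<^sub>R w)) v
      - blinfun_apply (fderiv f (x + a *\<^sub>R v + 0 *\<^sub>R w)) v)" by blast
  define k where "k b = blinfun_apply (fderiv f (x + a *\<^sub>R v + b *\<^sub>R w)) v" for b
  have "(k has_real_derivative blinfun_apply (blinfun_apply (fderiv2 f (x + a *\<^sub>R v + b *\<^sub>R w)) w) v) (at b)"
    if "0 \<le> b" "b \<le> h" for b
  proof -
    have "((\<lambda>b. fderiv f (x + a *\<^sub>R v + b *\<^sub>R w)) has_derivative
      (\<lambda>t. blinfun_apply (fderiv2 f (x + a *\<^sub>R v + b *\<^sub>R w)) (t *\<^sub>R w))) (at b)"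
    proof -
      have "((\<lambda>b. x + a *\<^sub>R v + b *\<^sub>R w) has_derivative (\<lambda>t. t *\<^sub>R w)) (at b)"
        by (auto intro!: derivative_eq_intros)
      from has_derivative_compose[OF this d2] inb[of a b] that a show ?thesis by force
    qed
    from bounded_linear.has_derivative[OF blinfun.bounded_linear_left[of v] this]
    show ?thesis unfolding k_def has_field_derivative_def
      by (simp add: blinfun.scaleR_right blinfun.scaleR_left mult_commute_abs)
  qed
  from MVT2[OF h(1) this] obtain b where b: "0 < b" "b < h"
    "k h - k 0 = (h - 0) * blinfun_apply (blinfun_apply (fderiv2 f (x + a *\<^sub>R v + b *\<^sub>R w)) w) v" by blast
  show ?thesis
    by (rule bexI[OF _ inb[of a b]]) (use a b in \<open>auto simp: g_def k_def algebra_simps\<close>)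
qed

text \<open>Schwarz's theorem: the second difference does not change when \<open>v\<close> and
  \<open>w\<close> are exchanged, and it equals \<open>h * h\<close> times either mixed derivative,
  each taken at some nearby point; both are continuous at \<open>x\<close>.\<close>

lemma fderiv2_sym:
  fixes f :: "'a::euclidean_space \<Rightarrow> real"
  assumes S: "open S" "Ck_on 2 S f" "x \<in> S"
  shows "blinfun_apply (blinfun_apply (fderiv2 f x) v) w = blinfun_apply (blinfun_apply (fderiv2 f x) w) v"
proof (rule ccontr)
  define D where "D z v w = blinfun_apply (blinfun_apply (fderiv2 f z) v) w" for z v w
  assume "\<not> ?thesis"
  then have "D x v w \<noteq> D x w v" by (simp add: D_def)
  \<comment> \<open>Half of the supposed gap: two errors smaller than \<open>e\<close> cannot bridge
    it.\<close>
  define e where "e = \<bar>D x v w - D x w v\<bar> / 2"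
  have e: "e > 0" using \<open>D x v w \<noteq> D x w v\<close> by (simp add: e_def)
  have cont: "isCont (\<lambda>z. D z v w) x" for v w
  proof -
    have "continuous_on S (\<lambda>z. D z v w)" unfolding D_def
      by (intro continuous_intros continuous_on_fderiv2[OF S(1,2)])
    then show ?thesis using S continuous_on_eq_continuous_at by blast
  qed
  have "\<forall>\<^sub>F z in nhds x. dist (D z v w) (D x v w) < e \<and> dist (D z w v) (D x w v) < e \<and> z \<in> S"
    using cont[of v w] cont[of w v] e S eventually_nhds_in_open[OF S(1,3)]
    by (intro eventually_conj tendstoD) (auto simp: isCont_def tendsto_nhds_iff)
  then obtain r where r: "r > 0" "\<And>z. dist z x < r \<Longrightarrow> dist (D z v w) (D x v w) < e \<and> dist (D z w v) (D x w v) < e \<and> z \<in> S"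
    unfolding eventually_nhds_metric by blast
  have rS: "ball x r \<subseteq> S" using r(2) by (auto simp: dist_commute)
  define h where "h = r / (norm v + norm w + 1)"
  have n: "norm v + norm w + 1 > 0" using norm_ge_zero[of v] norm_ge_zero[of w] by linarith
  have h: "0 < h" "h * (norm v + norm w) < r" "h * (norm w + norm v) < r"
    using r(1) n by (auto simp: h_def field_simps)
  obtain z1 where z1: "z1 \<in> ball x r" "f (x + h *\<^sub>R v + h *\<^sub>R w) - f (x + h *\<^sub>R v) - f (x + h *\<^sub>R w) + f x = h * h * D z1 w v"
    using mixed_difference_mvt[OF S(1,2) rS h(1,2)] unfolding D_def by blast
  obtain z2 where z2: "z2 \<in> ball x r" "f (x + h *\<^sub>R w + h *\<^sub>R v) - f (x + h *\<^sub>R w) - f (x + h *\<^sub>R v) + f x = h * h * D z2 v w"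
    using mixed_difference_mvt[OF S(1,2) rS h(1,3)] unfolding D_def by blast
  have "h * h * D z1 w v = h * h * D z2 v w" using z1(2) z2(2) by (simp add: algebra_simps)
  then have "D z1 w v = D z2 v w" using h by simp
  moreover have "\<bar>D z1 w v - D x w v\<bar> < e" "\<bar>D z2 v w - D x v w\<bar> < e"
    using r(2)[of z1] r(2)[of z2] z1(1) z2(1) by (auto simp: dist_commute dist_real_def)
  ultimately show False unfolding e_def by argo
qed

subsection \<open>Partial derivatives\<close>

lemma partial_x_has_derivative:
  fixes f :: "real \<times> 'a::euclidean_space \<Rightarrow> real"
  assumes "(f has_derivative blinfun_apply (fderiv f (t, x))) (at (t, x))"
  shows "((\<lambda>y. f (t, y)) has_derivative (\<lambda>v. blinfun_apply (fderiv f (t, x)) (0, v))) (at x)"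
proof -
  have "((\<lambda>y. (t, y)) has_derivative (\<lambda>v. (0, v))) (at x)"
    by (auto intro!: derivative_eq_intros)
  from has_derivative_compose[OF this assms] show ?thesis .
qed

lemma dx_inner:
  fixes f :: "real \<times> 'a::euclidean_space \<Rightarrow> real"
  assumes "f differentiable (at z)"
  shows "dx f z \<bullet> v = blinfun_apply (fderiv f z) (0, v)"
proof -
  have "((\<lambda>y. f (fst z, y)) has_derivative (\<lambda>v. blinfun_apply (fderiv f z) (0, v))) (at (snd z))"
    using partial_x_has_derivative[of f "fst z" "snd z"] fderiv_works[OF assms] by simp
  from has_derivative_imp_grad_inner[OF this] show ?thesis unfolding dx_def .
qed

lemma dt_has_derivative:
  fixes f :: "real \<times> 'a::euclidean_space \<Rightarrow> real"
  assumes "f differentiable (at (t, x))"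
  shows "((\<lambda>\<tau>. f (\<tau>, x)) has_real_derivative dt f (t, x)) (at t)"
    and "dt f (t, x) = blinfun_apply (fderiv f (t, x)) (1, 0)"
proof -
  have "((\<lambda>\<tau>. (\<tau>, x)) has_derivative (\<lambda>v. (v, 0))) (at t)"
    by (auto intro!: derivative_eq_intros)
  from has_derivative_compose[OF this fderiv_works[OF assms]]
  have "((\<lambda>\<tau>. f (\<tau>, x)) has_derivative (\<lambda>v. blinfun_apply (fderiv f (t, x)) (v *\<^sub>R (1, 0)))) (at t)" by simp
  then have "((\<lambda>\<tau>. f (\<tau>, x)) has_real_derivative blinfun_apply (fderiv f (t, x)) (1, 0)) (at t)"
    unfolding has_field_derivative_def blinfun.scaleR_right by (simp add: mult_commute_abs)
  then show "((\<lambda>\<tau>. f (\<tau>, x)) has_real_derivative dt f (t, x)) (at t)"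
    "dt f (t, x) = blinfun_apply (fderiv f (t, x)) (1, 0)"
    unfolding dt_def by (simp_all add: DERIV_imp_deriv)
qed

lemma fderiv_split:
  fixes f :: "real \<times> 'a::euclidean_space \<Rightarrow> real"
  assumes "f differentiable (at z)"
  shows "blinfun_apply (fderiv f z) h = fst h * dt f z + dx f z \<bullet> snd h"
proof -
  have "h = fst h *\<^sub>R (1, 0) + (0, snd h)" by (simp add: prod_eq_iff)
  then have "blinfun_apply (fderiv f z) h = blinfun_apply (fderiv f z) (fst h *\<^sub>R (1, 0) + (0, snd h))" by simp
  then show ?thesis
    using dt_has_derivative(2)[of f "fst z" "snd z"] dx_inner[OF assms] assms
    by (simp add: blinfun.add_right blinfun.scaleR_right del: scaleR_Pair)
qed

lemma dx_eq_sum: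
  fixes f :: "real \<times> 'a::euclidean_space \<Rightarrow> real"
  assumes "f differentiable (at z)"
  shows "dx f z = (\<Sum>b\<in>Basis. blinfun_apply (fderiv f z) (0, b) *\<^sub>R b)"
  unfolding dx_inner[OF assms, symmetric] by (simp add: euclidean_representation)

text \<open>The Riesz representative of the functional sending \<open>v\<close> to the second
  differential at \<open>h\<close> and \<open>(0, v)\<close>. For \<open>f\<close> of class C^2 it
  is the derivative of \<open>dx f\<close> at \<open>z\<close> in direction
  \<open>h\<close>.\<close>

definition dx_deriv :: "(real \<times> 'a::euclidean_space \<Rightarrow> real) \<Rightarrow> real \<times> 'a \<Rightarrow> real \<times> 'a \<Rightarrow> 'a" where
  "dx_deriv f z h = (\<Sum>b\<in>Basis. blinfun_apply (blinfun_apply (fderiv2 f z) h) (0, b) *\<^sub>R b)"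

lemma dx_deriv_inner:
  fixes f :: "real \<times> 'a::euclidean_space \<Rightarrow> real"
  shows "dx_deriv f z h \<bullet> v = blinfun_apply (blinfun_apply (fderiv2 f z) h) (0, v)"
proof -
  have b: "bounded_linear (\<lambda>v. blinfun_apply (blinfun_apply (fderiv2 f z) h) (0::real, v))"
    by (intro bounded_linear_intros)
  show ?thesis unfolding dx_deriv_def
    using blinfun_euclidean_sum[of "Blinfun (\<lambda>v. blinfun_apply (blinfun_apply (fderiv2 f z) h) (0::real, v))" v]
    by (simp add: bounded_linear_Blinfun_apply[OF b] inner_commute)
qed

lemma dx_has_derivative:
  fixes f :: "real \<times> 'a::euclidean_space \<Rightarrow> real"
  assumes "open S" "Ck_on 2 S f" "z \<in> S"
  shows "(dx f has_derivative dx_deriv f z) (at z)"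
proof (rule has_derivative_transform_within_open[OF _ assms(1,3)])
  show "((\<lambda>z. \<Sum>b\<in>Basis. blinfun_apply (fderiv f z) (0, b) *\<^sub>R b) has_derivative dx_deriv f z) (at z)"
    unfolding dx_deriv_def
    by (intro has_derivative_sum has_derivative_scaleR_left
       bounded_linear.has_derivative[OF blinfun.bounded_linear_left fderiv2_works[OF assms]])
qed (simp add: dx_eq_sum Ck_on_2D(1)[OF assms(2)])

lemma open_strip: "open (strip a b :: (real \<times> 'a::euclidean_space) set)"
proof -
  have "open {t. a < ereal t \<and> ereal t < b}"
  proof -
    have "{t. a < ereal t \<and> ereal t < b} = ereal -` {a<..<b}" by auto
    then show ?thesis using open_vimage[OF open_greaterThanLessThan continuous_on_ereal[OF continuous_on_id]] by auto
  qed
  moreover have "strip a b = {t. a < ereal t \<and> ereal t < b} \<times> (UNIV :: 'a set)"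
    by (auto simp: strip_def)
  ultimately show ?thesis by (simp add: open_Times)
qed

lemma strip_mem [simp]: "(t, x) \<in> strip a b \<longleftrightarrow> a < ereal t \<and> ereal t < b"
  by (simp add: strip_def)

subsection \<open>The Hamiltonian\<close>

lemma hamiltonianD:
  fixes H :: "real \<times> 'a::euclidean_space \<times> 'a \<Rightarrow> real"
  assumes "hamiltonian H A"
  shows "Ck_on 2 UNIV H" "norm (fderiv2 H (t, x, p)) \<le> A"
    "norm (fderiv H (t, x, p)) \<le> A * (1 + norm p)" "\<bar>H (t, x, p)\<bar> \<le> A * (1 + norm p)\<^sup>2" "0 \<le> A"
proof -
  show "norm (fderiv2 H (t, x, p)) \<le> A" "Ck_on 2 UNIV H"
    "norm (fderiv H (t, x, p)) \<le> A * (1 + norm p)" "\<bar>H (t, x, p)\<bar> \<le> A * (1 + norm p)\<^sup>2"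
    using assms unfolding hamiltonian_def by blast+
  then show "0 \<le> A" using norm_ge_zero order_trans by blast
qed

lemma hamiltonian_has_derivative:
  fixes H :: "real \<times> 'a::euclidean_space \<times> 'a \<Rightarrow> real"
  assumes "hamiltonian H A"
  shows "(H has_derivative blinfun_apply (fderiv H z)) (at z)"
  using fderiv_works Ck_on_2D(1)[OF hamiltonianD(1)[OF assms]] by blast

lemma hamiltonian_isCont:
  fixes H :: "real \<times> 'a::euclidean_space \<times> 'a \<Rightarrow> real"
  assumes "hamiltonian H A"
  shows "isCont H z"
  using has_derivative_continuous[OF hamiltonian_has_derivative[OF assms]] .

lemma hamiltonian_fderiv_lipschitz:
  fixes H :: "real \<times> 'a::euclidean_space \<times> 'a \<Rightarrow> real"
  assumes "hamiltonian H A"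
  shows "norm (fderiv H z - fderiv H z') \<le> A * norm (z - z')"
proof (rule differentiable_bound[OF convex_UNIV])
  show "(fderiv H has_derivative blinfun_apply (fderiv2 H z)) (at z within UNIV)" for z
    using fderiv2_works[OF open_UNIV hamiltonianD(1)[OF assms]] by simp
  show "onorm (blinfun_apply (fderiv2 H z)) \<le> A" for z
    using hamiltonianD(2)[OF assms, of "fst z" "fst (snd z)" "snd (snd z)"] by (simp add: norm_blinfun.rep_eq)
qed auto

lemma hamiltonian_gradients:
  fixes H :: "real \<times> 'a::euclidean_space \<times> 'a \<Rightarrow> real"
  assumes "hamiltonian H A"
  shows "grad (\<lambda>\<eta>. H (t, x, \<eta>)) p \<bullet> v = blinfun_apply (fderiv H (t, x, p)) (0, 0, v)"
    and "grad (\<lambda>y. H (t, y, p)) x \<bullet> v = blinfun_apply (fderiv H (t, x, p)) (0, v, 0)"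
proof -
  have "((\<lambda>\<eta>. (t, x, \<eta>)) has_derivative (\<lambda>v. (0, 0, v))) (at p)"
    by (auto intro!: derivative_eq_intros)
  from has_derivative_imp_grad_inner[OF has_derivative_compose[OF this hamiltonian_has_derivative[OF assms]]]
  show "grad (\<lambda>\<eta>. H (t, x, \<eta>)) p \<bullet> v = blinfun_apply (fderiv H (t, x, p)) (0, 0, v)" .
  have "((\<lambda>y. (t, y, p)) has_derivative (\<lambda>v. (0, v, 0))) (at x)"
    by (auto intro!: derivative_eq_intros)
  from has_derivative_imp_grad_inner[OF has_derivative_compose[OF this hamiltonian_has_derivative[OF assms]]]
  show "grad (\<lambda>y. H (t, y, p)) x \<bullet> v = blinfun_apply (fderiv H (t, x, p)) (0, v, 0)" .
qed

subsection \<open>Classical solutions\<close>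

lemma hj_classicalD:
  assumes "hj_classical H S f"
  shows "Ck_on 2 S f" "\<And>z. z \<in> S \<Longrightarrow> dt f z = - H (fst z, snd z, dx f z)"
    "\<And>z. z \<in> S \<Longrightarrow> f differentiable (at z)"
  using assms Ck_on_2D(1) unfolding hj_classical_def hj_lhs_def by (force simp: add_eq_0_iff)+

text \<open>The equation holds on an open set, so its two sides have the same differential. With
  \<open>h = (0, v)\<close> this expresses the mixed derivatives by the spatial Hessian, and with a
  general \<open>h\<close> the remaining ones by the derivative of \<open>dx f\<close>.\<close>

lemma hj_classical_differentiated:
  fixes H :: "real \<times> 'a::euclidean_space \<times> 'a \<Rightarrow> real"
  assumes H: "hamiltonian H A" and S: "open S" "hj_classical H S f" "z \<in> S"
  shows "blinfun_apply (blinfun_apply (fderiv2 f z) h) (1, 0)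
       = - blinfun_apply (fderiv H (fst z, snd z, dx f z)) (fst h, snd h, dx_deriv f z h)"
proof -
  note C2 = hj_classicalD(1)[OF S(2)]
  have "((\<lambda>z. blinfun_apply (fderiv f z) (1, 0)) has_derivative
      (\<lambda>h. blinfun_apply (blinfun_apply (fderiv2 f z) h) (1, 0))) (at z)"
    by (rule bounded_linear.has_derivative[OF blinfun.bounded_linear_left fderiv2_works[OF S(1) C2 S(3)]])
  then have 1: "((\<lambda>z. - H (fst z, snd z, dx f z)) has_derivative
      (\<lambda>h. blinfun_apply (blinfun_apply (fderiv2 f z) h) (1, 0))) (at z)"
    by (rule has_derivative_transform_within_open[OF _ S(1,3)])
      (metis dt_has_derivative(2) hj_classicalD(2,3)[OF S(2)] prod.collapse)
  have "((\<lambda>z. (fst z, snd z, dx f z)) has_derivative (\<lambda>h. (fst h, snd h, dx_deriv f z h))) (at z)"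
    by (intro derivative_intros dx_has_derivative[OF S(1) C2 S(3)])
  from has_derivative_unique[OF 1 has_derivative_minus[OF has_derivative_compose[OF this hamiltonian_has_derivative[OF H]]]]
  show ?thesis by meson
qed

section \<open>Lipschitz constants, and bounds on differentials uniform over the data\<close>

lemma Lip_le: "L-lipschitz_on UNIV u \<Longrightarrow> Lip u \<le> L"
  unfolding Lip_def by (rule cInf_lower) (auto intro!: bdd_belowI lipschitz_on_nonneg)

lemma Lip_lipschitz:
  assumes "is_lipschitz u"
  shows "(Lip u)-lipschitz_on UNIV u"
proof (rule lipschitz_onI)
  obtain L where L: "L-lipschitz_on UNIV u" using assms by (auto simp: is_lipschitz_def)
  then have ne: "{L. L-lipschitz_on UNIV u} \<noteq> {}" by auto
  show "0 \<le> Lip u" unfolding Lip_def by (rule cInf_greatest[OF ne]) (auto intro: lipschitz_on_nonneg)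
  fix x y
  show "dist (u x) (u y) \<le> Lip u * dist x y"
  proof (cases "x = y")
    case False
    have "dist (u x) (u y) / dist x y \<le> Lip u" unfolding Lip_def
      using False lipschitz_onD[of _ UNIV u x y]
      by (intro cInf_greatest[OF ne]) (auto simp: pos_divide_le_eq)
    then show ?thesis using False by (simp add: pos_divide_le_eq)
  qed simp
qed

lemma lipschitz_derivative_le:
  fixes f :: "'a::real_normed_vector \<Rightarrow> real"
  assumes "L-lipschitz_on UNIV f" "(f has_derivative D) (at x)"
  shows "\<bar>D v\<bar> \<le> L * norm v"
proof -
  have "((\<lambda>h. x + h *\<^sub>R v) has_derivative (\<lambda>h. h *\<^sub>R v)) (at 0)"
    by (auto intro!: derivative_eq_intros)
  from has_derivative_compose[OF this, of f D] assms(2)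
  have "((\<lambda>h. f (x + h *\<^sub>R v)) has_derivative (\<lambda>h. D (h *\<^sub>R v))) (at 0)" by simp
  then have "((\<lambda>h. f (x + h *\<^sub>R v)) has_real_derivative D v) (at 0)"
    using linear_scale[OF has_derivative_linear[OF assms(2)]]
    unfolding has_field_derivative_def by (simp add: mult_commute_abs)
  then have lim: "((\<lambda>h. \<bar>(f (x + h *\<^sub>R v) - f x) / h\<bar>) \<longlongrightarrow> \<bar>D v\<bar>) (at 0)"
    unfolding DERIV_def by (intro tendsto_rabs) simp
  have "\<bar>(f (x + h *\<^sub>R v) - f x) / h\<bar> \<le> L * norm v" if "h \<noteq> 0" for h
    using lipschitz_onD[OF assms(1), of "x + h *\<^sub>R v" x] that
    by (simp add: dist_norm abs_divide pos_divide_le_eq mult_ac)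
  then have "\<forall>\<^sub>F h in at 0. \<bar>(f (x + h *\<^sub>R v) - f x) / h\<bar> \<le> L * norm v"
    by (simp add: eventually_at_filter)
  from tendsto_upperbound[OF lim this] show ?thesis by simp
qed

lemma norm_le_of_inner:
  fixes x :: "'a::real_inner"
  assumes "\<And>v. x \<bullet> v \<le> c * norm v" "0 \<le> c"
  shows "norm x \<le> c"
proof (cases "x = 0")
  case False
  have "norm x * norm x \<le> c * norm x" using assms(1)[of x] by (simp add: dot_square_norm power2_eq_square)
  then show ?thesis using False by simp
qed (use assms in simp)

text \<open>The mixed derivatives are bounded first, from the equation differentiated in \<open>x\<close>; only then
  does the equation differentiated in \<open>t\<close> bound the second time derivative.\<close>

lemma hj_classical_fderiv2_bound:
  fixes H :: "real \<times> 'a::euclidean_space \<times> 'a \<Rightarrow> real"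
  assumes H: "hamiltonian H A" and S: "open S" "hj_classical H S f" "z \<in> S"
    and R: "norm (dx f z) \<le> R"
    and M: "0 \<le> M" "\<And>v w. \<bar>blinfun_apply (blinfun_apply (fderiv2 f z) (0, v)) (0, w)\<bar> \<le> M * norm v * norm w"
  defines "C \<equiv> A * (1 + R)"
  defines "P \<equiv> C * (1 + M) + M"
  shows "norm (fderiv2 f z) \<le> C * (1 + P) + P"
proof -
  note sym = fderiv2_sym[OF S(1) hj_classicalD(1)[OF S(2)] S(3)]
  have A: "0 \<le> A" using hamiltonianD(5)[OF H] .
  have R0: "0 \<le> R" using R norm_ge_zero order_trans by blast
  \<comment> \<open>\<open>C\<close> bounds the differential of \<open>H\<close> at momentum
    \<open>dx f z\<close>. \<open>P\<close> will bound the derivative of \<open>dx f\<close>: the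
    summand \<open>M\<close> is its spatial part, \<open>C * (1 + M)\<close> its time part.\<close>
  have C: "0 \<le> C" "norm (fderiv H (fst z, snd z, dx f z)) \<le> C"
  proof -
    show "0 \<le> C" using A R0 by (simp add: C_def)
    show "norm (fderiv H (fst z, snd z, dx f z)) \<le> C" unfolding C_def
      by (rule order_trans[OF hamiltonianD(3)[OF H]]) (use A R in \<open>auto intro!: mult_left_mono\<close>)
  qed
  have P: "0 \<le> P" using C M by (simp add: P_def)
  have time: "\<bar>blinfun_apply (blinfun_apply (fderiv2 f z) h) (1, 0)\<bar> \<le> C * (norm h + norm (dx_deriv f z h))" for h
  proof -
    have "norm (fst h, snd h, dx_deriv f z h) \<le> norm h + norm (dx_deriv f z h)"
    proof -
      have "(fst h, snd h, dx_deriv f z h) = (fst h, snd h, 0) + (0, 0, dx_deriv f z h)" by simp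
      moreover have "norm (fst h, snd h, 0::'a) = norm h" by (simp add: norm_prod_def)
      moreover have "norm (0::real, 0::'a, dx_deriv f z h) = norm (dx_deriv f z h)" by (simp add: norm_prod_def)
      ultimately show ?thesis by (metis norm_triangle_ineq)
    qed
    then have "norm (fderiv H (fst z, snd z, dx f z)) * norm (fst h, snd h, dx_deriv f z h) \<le> C * (norm h + norm (dx_deriv f z h))"
      using C by (intro mult_mono) auto
    then show ?thesis unfolding hj_classical_differentiated[OF H S]
      using norm_blinfun[of "fderiv H (fst z, snd z, dx f z)" "(fst h, snd h, dx_deriv f z h)"] by simp
  qed
  have split: "blinfun_apply (blinfun_apply (fderiv2 f z) h) k
     = fst k * blinfun_apply (blinfun_apply (fderiv2 f z) h) (1, 0) + dx_deriv f z h \<bullet> snd k" for h k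
  proof -
    have "k = fst k *\<^sub>R (1, 0) + (0, snd k)" by (simp add: prod_eq_iff)
    then have "blinfun_apply (blinfun_apply (fderiv2 f z) h) k = blinfun_apply (blinfun_apply (fderiv2 f z) h) (fst k *\<^sub>R (1, 0) + (0, snd k))" by simp
    then show ?thesis by (simp add: dx_deriv_inner blinfun.add_right blinfun.scaleR_right del: scaleR_Pair)
  qed
  have "norm (dx_deriv f z (0, v)) \<le> M * norm v" for v
    using M by (intro norm_le_of_inner) (auto simp: dx_deriv_inner intro: order_trans[OF abs_ge_self])
  then have mixed: "\<bar>blinfun_apply (blinfun_apply (fderiv2 f z) (0, v)) (1, 0)\<bar> \<le> C * (1 + M) * norm v" for v
    using order_trans[OF time[of "(0, v)"] mult_left_mono[OF add_left_mono C(1)]]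
    by (fastforce simp: algebra_simps)
  have dx_deriv: "norm (dx_deriv f z h) \<le> P * norm h" for h
  proof (rule norm_le_of_inner)
    fix w
    \<comment> \<open>Symmetry moves the spatial direction \<open>(0, w)\<close> to the first slot,
      where \<open>mixed\<close> handles the time part of \<open>h\<close> and \<open>M\<close> its
      space part.\<close>
    have "dx_deriv f z h \<bullet> w = blinfun_apply (blinfun_apply (fderiv2 f z) (0, w)) h"
      using sym[of h "(0, w)"] by (simp add: dx_deriv_inner)
    also have "\<dots> = fst h * blinfun_apply (blinfun_apply (fderiv2 f z) (0, w)) (1, 0) + dx_deriv f z (0, w) \<bullet> snd h"
      by (rule split)
    also have "\<dots> \<le> \<bar>fst h\<bar> * \<bar>blinfun_apply (blinfun_apply (fderiv2 f z) (0, w)) (1, 0)\<bar> + M * norm w * norm (snd h)"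
      using M(2)[of w "snd h"] by (intro add_mono) (auto simp: dx_deriv_inner abs_mult[symmetric])
    also have "\<dots> \<le> norm h * (C * (1 + M) * norm w) + M * norm w * norm h"
      using mixed[of w] norm_fst_le[of "fst h" "snd h"] norm_snd_le[of "snd h" "fst h"] M C
      by (intro add_mono mult_mono) auto
    finally show "dx_deriv f z h \<bullet> w \<le> P * norm h * norm w" by (simp add: P_def algebra_simps)
  qed (use P in simp)
  have time': "\<bar>blinfun_apply (blinfun_apply (fderiv2 f z) h) (1, 0)\<bar> \<le> C * (1 + P) * norm h" for h
    using order_trans[OF time[of h] mult_left_mono[OF add_left_mono[OF dx_deriv] C(1)]] by (simp add: algebra_simps)
  have KP: "0 \<le> C * (1 + P) + P" using C(1) P by simp
  show ?thesis
  proof (rule norm_blinfun_bound[OF KP], rule norm_blinfun_bound)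
    show "0 \<le> (C * (1 + P) + P) * norm h" for h :: "real \<times> 'a" using KP by simp
    fix h k
    have "\<bar>blinfun_apply (blinfun_apply (fderiv2 f z) h) k\<bar>
      \<le> \<bar>fst k\<bar> * \<bar>blinfun_apply (blinfun_apply (fderiv2 f z) h) (1, 0)\<bar> + norm (dx_deriv f z h) * norm (snd k)"
      unfolding split[of h k] using Cauchy_Schwarz_ineq2[of "dx_deriv f z h" "snd k"]
      by (intro order_trans[OF abs_triangle_ineq]) (auto simp: abs_mult)
    also have "\<dots> \<le> norm k * (C * (1 + P) * norm h) + (P * norm h) * norm k"
      using time'[of h] dx_deriv[of h] norm_fst_le[of "fst k" "snd k"] norm_snd_le[of "snd k" "fst k"] P C
      by (intro add_mono mult_mono) auto
    also have "\<dots> = (C * (1 + P) + P) * norm h * norm k" by (simp only: algebra_simps)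
    finally show "norm (blinfun_apply (blinfun_apply (fderiv2 f z) h) k) \<le> (C * (1 + P) + P) * norm h * norm k"
      by (simp only: real_norm_def)
  qed
qed

text \<open>Solvability bounds the Hessians of the slices, whereas the estimates concern second
  differentials on space-time. A slice is \<open>f\<close> composed with an affine embedding whose
  linear part is \<open>E\<close>.\<close>

lemma fderiv2_partial_x:
  fixes f :: "real \<times> 'a::euclidean_space \<Rightarrow> real"
  assumes "Ck_on 2 (strip a b) f" "a < ereal t" "ereal t < b"
  shows "blinfun_apply (blinfun_apply (fderiv2 (\<lambda>y. f (t, y)) x) v) w
       = blinfun_apply (blinfun_apply (fderiv2 f (t, x)) (0, v)) (0, w)"
proof -
  define E where "E = Blinfun (\<lambda>v::'a. (0::real, v))"
  have E: "blinfun_apply E v = (0, v)" for v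
    unfolding E_def by (subst bounded_linear_Blinfun_apply) (auto intro!: bounded_linear_intros)
  have "fderiv (\<lambda>y. f (t, y)) = (\<lambda>y. fderiv f (t, y) o\<^sub>L E)"
    using partial_x_has_derivative[OF fderiv_works[OF Ck_on_2D(1)[OF assms(1)]]] assms
    by (intro ext fderiv_eqI) (simp add: E blinfun_compose.rep_eq o_def)
  moreover have "((\<lambda>y. fderiv f (t, y) o\<^sub>L E) has_derivative (\<lambda>v. blinfun_apply (fderiv2 f (t, x)) (0, v) o\<^sub>L E)) (at x)"
  proof -
    have "((\<lambda>y. (t, y)) has_derivative (\<lambda>v. (0, v))) (at x)" by (auto intro!: derivative_eq_intros)
    from has_derivative_compose[OF this fderiv2_works[OF open_strip assms(1)]] assms
    have "((\<lambda>y. fderiv f (t, y)) has_derivative (\<lambda>v. blinfun_apply (fderiv2 f (t, x)) (0, v))) (at x)" by simp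
    from bounded_linear.has_derivative[OF bounded_bilinear.bounded_linear_left[OF bounded_bilinear_blinfun_compose] this]
    show ?thesis .
  qed
  ultimately have "(fderiv (\<lambda>y. f (t, y)) has_derivative (\<lambda>v. blinfun_apply (fderiv2 f (t, x)) (0, v) o\<^sub>L E)) (at x)" by simp
  then have "blinfun_apply (fderiv2 (\<lambda>y. f (t, y)) x) = (\<lambda>v. blinfun_apply (fderiv2 f (t, x)) (0, v) o\<^sub>L E)"
    unfolding fderiv2_def by (metis differentiableI fderiv_works has_derivative_unique)
  then show ?thesis by (simp add: E)
qed

lemma strip_around_iff:
  assumes "0 < l"
  shows "(t, x) \<in> strip (ereal s - l) (ereal s + l) \<longleftrightarrow> ereal \<bar>t - s\<bar> < l"
  using assms by (cases l) (auto simp: abs_less_iff)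

lemma lifespan_pos:
  assumes "classical_solvability H A Q" "0 \<le> r"
  shows "0 < lifespan Q r"
proof -
  have "growth_semigroup Q" using assms(1) by (simp add: classical_solvability_def)
  then show ?thesis using assms(2) by (simp add: growth_semigroup_def)
qed

lemma classical_solvabilityD:
  fixes H :: "real \<times> 'a::euclidean_space \<times> 'a \<Rightarrow> real"
  assumes "classical_solvability H A Q" "0 \<le> r" "Ck_on 2 UNIV fs" "\<forall>x. norm (fderiv2 fs x) \<le> r"
  shows "\<exists>f. hj_cauchy H Q s r fs f"
    and "\<And>f t x. hj_cauchy H Q s r fs f \<Longrightarrow> ereal \<bar>t - s\<bar> < lifespan Q r \<Longrightarrow>
      ennreal (norm (fderiv2 (\<lambda>y. f (t, y)) x)) \<le> Q \<bar>t - s\<bar> (ennreal r)"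
    and "\<And>f t. hj_cauchy H Q s r fs f \<Longrightarrow> is_lipschitz fs \<Longrightarrow> ereal \<bar>t - s\<bar> < lifespan Q r \<Longrightarrow>
      is_lipschitz (\<lambda>x. f (t, x)) \<and> Lip (\<lambda>x. f (t, x)) \<le> (Lip fs + 1) * exp (A * \<bar>t - s\<bar>) - 1"
proof -
  note c = assms(1)[unfolded classical_solvability_def, THEN conjunct2]
  note c1 = c[THEN conjunct1, THEN spec, THEN spec, THEN spec, THEN mp, OF conjI[OF assms(2) conjI[OF assms(3,4)]]]
  show "\<exists>f. hj_cauchy H Q s r fs f" by (rule c1[THEN conjunct1])
  show "ennreal (norm (fderiv2 (\<lambda>y. f (t, y)) x)) \<le> Q \<bar>t - s\<bar> (ennreal r)"
    if "hj_cauchy H Q s r fs f" "ereal \<bar>t - s\<bar> < lifespan Q r" for f t x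
    using c1[THEN conjunct2, THEN conjunct2] that by simp
  show "is_lipschitz (\<lambda>x. f (t, x)) \<and> Lip (\<lambda>x. f (t, x)) \<le> (Lip fs + 1) * exp (A * \<bar>t - s\<bar>) - 1"
    if "hj_cauchy H Q s r fs f" "is_lipschitz fs" "ereal \<bar>t - s\<bar> < lifespan Q r" for f t
    using c[THEN conjunct2, THEN conjunct1, rule_format, of r fs s f t] that assms(2-4) by simp
qed

lemma norm_blinfun2:
  fixes D :: "'a::real_normed_vector \<Rightarrow>\<^sub>L ('a \<Rightarrow>\<^sub>L real)"
  shows "\<bar>blinfun_apply (blinfun_apply D v) w\<bar> \<le> norm D * norm v * norm w"
proof -
  have "\<bar>blinfun_apply (blinfun_apply D v) w\<bar> \<le> norm (blinfun_apply D v) * norm w"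
    using norm_blinfun[of "blinfun_apply D v" w] by simp
  also have "\<dots> \<le> norm D * norm v * norm w" by (intro mult_right_mono norm_blinfun) simp
  finally show ?thesis .
qed

text \<open>The lifespan is a supremum, so \<open>Q\<close> is still finite at some time beyond
  \<open>T\<close>, and it is monotone in time.\<close>

lemma growth_finite:
  assumes "growth_semigroup Q" "0 \<le> T" "ereal T < lifespan Q r"
  shows "Q T (ennreal r) < \<infinity>"
proof -
  obtain t where "0 \<le> t" "Q t (ennreal r) < \<infinity>" "T < t"
    using assms(3) unfolding lifespan_def less_SUP_iff by auto
  then show ?thesis using assms(1,2) unfolding growth_semigroup_def
    by (meson le_less_trans less_imp_le)
qed

text \<open>\<open>K\<close> is chosen before \<open>s\<close>, \<open>fs\<close> and
  \<open>f\<close>, and sees the datum only through the bounds \<open>r\<close> and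
  \<open>L\<close>; this is the uniformity that compactness requires.\<close>

lemma classical_C11_bound:
  fixes H :: "real \<times> 'a::euclidean_space \<times> 'a \<Rightarrow> real"
  assumes H: "hamiltonian H A" and Q: "classical_solvability H A Q"
    and r: "0 \<le> r" and T: "0 \<le> T" "ereal T < lifespan Q r"
  shows "\<exists>K\<ge>0. \<forall>s fs f. Ck_on 2 UNIV fs \<and> (\<forall>x. norm (fderiv2 fs x) \<le> r) \<and> L-lipschitz_on UNIV fs
      \<and> hj_cauchy H Q s r fs f \<longrightarrow>
      (\<forall>t x. \<bar>t - s\<bar> \<le> T \<longrightarrow> norm (fderiv f (t, x)) \<le> K) \<and> K-lipschitz_on ({s - T..s + T} \<times> UNIV) (fderiv f)"
proof -
  \<comment> \<open>Up to time \<open>T\<close>, \<open>R\<close> bounds the Lipschitz constants of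
    the slices and \<open>M\<close> their Hessians; through the equation, the growth of
    \<open>H\<close> then bounds \<open>dt f\<close> by A(1+R)^2. The maximum with 0 keeps
    \<open>K\<close> nonnegative when \<open>L\<close> is negative and no datum exists.\<close>
  define R where "R = (L + 1) * exp (A * T) - 1"
  define M where "M = enn2real (Q T (ennreal r))"
  define C where "C = A * (1 + R)"
  define P where "P = C * (1 + M) + M"
  define K where "K = max 0 (max (A * (1 + R)\<^sup>2 + R) (C * (1 + P) + P))"
  have K0: "0 \<le> K" and K1: "A * (1 + R)\<^sup>2 + R \<le> K" and K2: "C * (1 + P) + P \<le> K"
    unfolding K_def by (rule max.cobounded1, rule max.coboundedI2, rule max.cobounded1,
      rule max.coboundedI2, rule max.cobounded2)
  have sg: "growth_semigroup Q" using Q by (simp add: classical_solvability_def)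
  have M: "0 \<le> M" "Q T (ennreal r) = ennreal M" 
    using growth_finite[OF sg T] by (auto simp: M_def)
  have A: "0 \<le> A" using hamiltonianD(5)[OF H] .
  have main: "(\<forall>t x. \<bar>t - s\<bar> \<le> T \<longrightarrow> norm (fderiv f (t, x)) \<le> K \<and> norm (fderiv2 f (t, x)) \<le> K
        \<and> (fderiv f has_derivative blinfun_apply (fderiv2 f (t, x))) (at (t, x)))
       \<and> 0 \<le> K"
    if fs: "Ck_on 2 UNIV fs" "\<forall>x. norm (fderiv2 fs x) \<le> r" "L-lipschitz_on UNIV fs" and f: "hj_cauchy H Q s r fs f" for s fs f
  proof -
    let ?S = "strip (ereal s - lifespan Q r) (ereal s + lifespan Q r) :: (real \<times> 'a) set"
    have cl: "hj_classical H ?S f" using f unfolding hj_cauchy_def by blast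
    have lip: "is_lipschitz fs" using fs(3) by (auto simp: is_lipschitz_def)
    have L: "0 \<le> L" using lipschitz_on_nonneg[OF fs(3)] .
    have eR: "1 \<le> (L + 1) * exp (A * T)" using L A T mult_mono[of 1 "L+1" 1 "exp (A * T)"] by simp
    then have R: "0 \<le> R" by (simp add: R_def)
    have K: "R \<le> K" using A by (intro order_trans[OF _ K1]) simp
    have lR: "R-lipschitz_on UNIV (\<lambda>x. f (t, x))" if t: "\<bar>t - s\<bar> \<le> T" for t
    proof -
      have "ereal \<bar>t - s\<bar> < lifespan Q r" using t T(2) by (meson ereal_less_eq(3) le_less_trans)
      then have *: "is_lipschitz (\<lambda>x. f (t, x))" "Lip (\<lambda>x. f (t, x)) \<le> (Lip fs + 1) * exp (A * \<bar>t - s\<bar>) - 1"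
        using classical_solvabilityD(3)[OF Q r fs(1,2) f lip] by auto
      have "(Lip fs + 1) * exp (A * \<bar>t - s\<bar>) \<le> (L + 1) * exp (A * T)"
        using Lip_le[OF fs(3)] L A t by (intro mult_mono) (auto intro: mult_left_mono)
      then show ?thesis using lipschitz_on_le[OF Lip_lipschitz[OF *(1)]] *(2) by (simp add: R_def)
    qed
    have "norm (fderiv f (t, x)) \<le> K \<and> norm (fderiv2 f (t, x)) \<le> K
       \<and> (fderiv f has_derivative blinfun_apply (fderiv2 f (t, x))) (at (t, x))" if t: "\<bar>t - s\<bar> \<le> T" for t x
    proof (intro conjI)
      have tl: "ereal \<bar>t - s\<bar> < lifespan Q r" using t T(2) by (meson ereal_less_eq(3) le_less_trans)
      have z: "(t, x) \<in> ?S" by (rule strip_around_iff[OF lifespan_pos[OF Q r], THEN iffD2, OF tl])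
      have df: "f differentiable (at (t, x))" using hj_classicalD(3)[OF cl z] .
      have dxR: "norm (dx f (t, x)) \<le> R"
      proof (rule norm_le_of_inner[OF _ R])
        fix v
        have "\<bar>dx f (t, x) \<bullet> v\<bar> \<le> R * norm v" unfolding dx_inner[OF df]
          using lipschitz_derivative_le[OF lR[OF t] partial_x_has_derivative[OF fderiv_works[OF df]]] .
        then show "dx f (t, x) \<bullet> v \<le> R * norm v" by linarith
      qed
      have dtR: "\<bar>dt f (t, x)\<bar> \<le> A * (1 + R)\<^sup>2"
      proof -
        have "\<bar>dt f (t, x)\<bar> \<le> A * (1 + norm (dx f (t, x)))\<^sup>2"
          using hj_classicalD(2)[OF cl z] hamiltonianD(4)[OF H] by simp
        also have "\<dots> \<le> A * (1 + R)\<^sup>2" using dxR A by (intro mult_left_mono power_mono) auto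
        finally show ?thesis .
      qed
      have "norm (fderiv f (t, x)) \<le> A * (1 + R)\<^sup>2 + R"
      proof (rule norm_blinfun_bound)
        fix h
        have "\<bar>blinfun_apply (fderiv f (t, x)) h\<bar> \<le> \<bar>fst h\<bar> * \<bar>dt f (t, x)\<bar> + norm (dx f (t, x)) * norm (snd h)"
          unfolding fderiv_split[OF df] using Cauchy_Schwarz_ineq2[of "dx f (t, x)" "snd h"]
          by (intro order_trans[OF abs_triangle_ineq]) (auto simp: abs_mult)
        also have "\<dots> \<le> norm h * (A * (1 + R)\<^sup>2) + R * norm h"
          using dtR dxR norm_fst_le[of "fst h" "snd h"] norm_snd_le[of "snd h" "fst h"] R
          by (intro add_mono mult_mono) auto
        finally show "norm (blinfun_apply (fderiv f (t, x)) h) \<le> (A * (1 + R)\<^sup>2 + R) * norm h"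
          by (simp add: algebra_simps)
      qed (use A R in simp)
      then show "norm (fderiv f (t, x)) \<le> K" using K1 by (rule order_trans)
      have "norm (fderiv2 f (t, x)) \<le> A * (1 + R) * (1 + (A * (1 + R) * (1 + M) + M)) + (A * (1 + R) * (1 + M) + M)"
      proof (rule hj_classical_fderiv2_bound[OF H open_strip cl z dxR M(1)])
        fix v w
        have "ennreal (norm (fderiv2 (\<lambda>y. f (t, y)) x)) \<le> Q \<bar>t - s\<bar> (ennreal r)"
          by (rule classical_solvabilityD(2)[OF Q r fs(1,2) f tl])
        also have "\<dots> \<le> Q T (ennreal r)" using sg t unfolding growth_semigroup_def by simp
        finally have "norm (fderiv2 (\<lambda>y. f (t, y)) x) \<le> M" using M by simp
        moreover have "\<bar>blinfun_apply (blinfun_apply (fderiv2 (\<lambda>y. f (t, y)) x) v) w\<bar>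
            \<le> norm (fderiv2 (\<lambda>y. f (t, y)) x) * norm v * norm w"
          by (rule norm_blinfun2)
        ultimately have "\<bar>blinfun_apply (blinfun_apply (fderiv2 (\<lambda>y. f (t, y)) x) v) w\<bar> \<le> M * norm v * norm w"
          by (meson mult_right_mono norm_ge_zero order_trans)
        then show "\<bar>blinfun_apply (blinfun_apply (fderiv2 f (t, x)) (0, v)) (0, w)\<bar> \<le> M * norm v * norm w"
          using fderiv2_partial_x[OF hj_classicalD(1)[OF cl]] z by simp
      qed
      then show "norm (fderiv2 f (t, x)) \<le> K" using K2 unfolding P_def C_def by (rule order_trans)
      show "(fderiv f has_derivative blinfun_apply (fderiv2 f (t, x))) (at (t, x))"
        by (rule fderiv2_works[OF open_strip hj_classicalD(1)[OF cl] z])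
    qed
    then show ?thesis using R K by auto
  qed
  have "K-lipschitz_on ({s - T..s + T} \<times> UNIV) (fderiv f)"
    if fs: "Ck_on 2 UNIV fs" "\<forall>x. norm (fderiv2 fs x) \<le> r" "L-lipschitz_on UNIV fs" "hj_cauchy H Q s r fs f" for s fs f
  proof (rule lipschitz_onI)
    note m = main[OF that]
    show "0 \<le> K" using m by blast
    have cv: "convex ({s - T..s + T} \<times> (UNIV :: 'a set))" by (intro convex_Times) auto
    fix y z assume yz: "y \<in> {s - T..s + T} \<times> (UNIV::'a set)" "z \<in> {s - T..s + T} \<times> (UNIV::'a set)"
    have *: "norm (fderiv2 f z) \<le> K \<and> (fderiv f has_derivative blinfun_apply (fderiv2 f z)) (at z)"
      if "z \<in> {s - T..s + T} \<times> (UNIV::'a set)" for z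
      using m that by (cases z) (auto simp: abs_le_iff)
    show "dist (fderiv f y) (fderiv f z) \<le> K * dist y z" unfolding dist_norm
      by (rule differentiable_bound[OF cv _ _ yz, where f'="\<lambda>z. blinfun_apply (fderiv2 f z)"])
        (use * in \<open>auto simp: norm_blinfun.rep_eq[symmetric] intro: has_derivative_at_withinI\<close>)
  qed
  with main K0 show ?thesis by (intro exI[of _ K]) blast
qed

subsection \<open>Characteristics\<close>

text \<open>Gronwall's argument for the defect \<open>\<delta>\<close> between \<open>dx f\<close>
  and the momentum along the given trajectory. The Hamiltonian system and the differentiated
  equation bound the growth of its square by a multiple of that square, and it vanishes at time
  \<open>s\<close>.\<close>

lemma trajectory_on_graph:
  fixes H :: "real \<times> 'a::euclidean_space \<times> 'a \<Rightarrow> real"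
  assumes H: "hamiltonian H A" and f: "hj_classical H (strip a b) f"
    and traj: "trajectory H q p" and st: "a < ereal s" "s \<le> t" "ereal t < b"
    and init: "p s = dx f (s, q s)"
    and \<tau>: "\<tau> \<in> {s..t}"
  shows "p \<tau> = dx f (\<tau>, q \<tau>)"
proof -
  note C2 = hj_classicalD(1)[OF f]
  define q' where "q' \<tau> = grad (\<lambda>\<eta>. H (\<tau>, q \<tau>, \<eta>)) (p \<tau>)" for \<tau>
  define p' where "p' \<tau> = - grad (\<lambda>y. H (\<tau>, y, p \<tau>)) (q \<tau>)" for \<tau>
  have q: "(q has_vector_derivative q' \<tau>) (at \<tau>)" and p: "(p has_vector_derivative p' \<tau>) (at \<tau>)" for \<tau>
    using traj unfolding trajectory_def q'_def p'_def by blast+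
  have mem: "(\<tau>, q \<tau>) \<in> strip a b" if "\<tau> \<in> {s..t}" for \<tau>
    using that less_le_trans[OF st(1), of "ereal \<tau>"] le_less_trans[OF _ st(3), of "ereal \<tau>"] by simp
  have cont: "continuous_on {s..t} (\<lambda>\<tau>. fderiv2 f (\<tau>, q \<tau>))"
  proof (rule continuous_on_compose2[OF continuous_on_fderiv2[OF open_strip C2]])
    have "continuous_on {s..t} q"
      using q by (meson continuous_at_imp_continuous_on has_vector_derivative_continuous)
    then show "continuous_on {s..t} (\<lambda>\<tau>. (\<tau>, q \<tau>))" by (intro continuous_intros)
  qed (use mem in auto)
  \<comment> \<open>The arc over \<open>[s, t]\<close> is compact, so continuity of the second
    differential suffices for this bound.\<close>
  obtain M where M: "\<And>\<tau>. \<tau> \<in> {s..t} \<Longrightarrow> norm (fderiv2 f (\<tau>, q \<tau>)) \<le> M"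
    using compact_imp_bounded[OF compact_continuous_image[OF cont compact_Icc]] unfolding bounded_iff by blast
  define \<delta> where "\<delta> \<tau> = dx f (\<tau>, q \<tau>) - p \<tau>" for \<tau>
  define k where "k = 2 * (A * (1 + M))"
  define e where "e \<tau> = \<delta> \<tau> \<bullet> \<delta> \<tau>" for \<tau>
  define X where "X \<tau> = dx_deriv f (\<tau>, q \<tau>) (0, \<delta> \<tau>)" for \<tau>
  define \<delta>' where "\<delta>' \<tau> = dx_deriv f (\<tau>, q \<tau>) (1, q' \<tau>) - p' \<tau>" for \<tau>
  have A: "0 \<le> A" using hamiltonianD(5)[OF H] .
  have d\<delta>: "(\<delta> has_vector_derivative \<delta>' \<tau>) (at \<tau>)" if \<tau>: "\<tau> \<in> {s..t}" for \<tau>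
  proof -
    have "((\<lambda>\<tau>. (\<tau>, q \<tau>)) has_derivative (\<lambda>h. h *\<^sub>R (1, q' \<tau>))) (at \<tau>)"
      using q[of \<tau>] unfolding has_vector_derivative_def by (auto intro!: derivative_eq_intros)
    from has_derivative_compose[OF this dx_has_derivative[OF open_strip C2 mem[OF \<tau>]]]
    have "((\<lambda>\<tau>. dx f (\<tau>, q \<tau>)) has_derivative (\<lambda>h. dx_deriv f (\<tau>, q \<tau>) (h *\<^sub>R (1, q' \<tau>)))) (at \<tau>)" .
    moreover have "dx_deriv f (\<tau>, q \<tau>) (h *\<^sub>R (1, q' \<tau>)) = h *\<^sub>R dx_deriv f (\<tau>, q \<tau>) (1, q' \<tau>)" for h
      by (rule linear_scale[OF has_derivative_linear[OF dx_has_derivative[OF open_strip C2 mem[OF \<tau>]]]])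
    ultimately have "((\<lambda>\<tau>. dx f (\<tau>, q \<tau>)) has_vector_derivative dx_deriv f (\<tau>, q \<tau>) (1, q' \<tau>)) (at \<tau>)"
      unfolding has_vector_derivative_def by simp
    from has_vector_derivative_diff[OF this p] show ?thesis unfolding \<delta>_def \<delta>'_def .
  qed
  have \<delta>\<delta>': "\<delta> \<tau> \<bullet> \<delta>' \<tau> \<le> A * (1 + M) * e \<tau>" if \<tau>: "\<tau> \<in> {s..t}" for \<tau>
  proof -
    let ?z = "(\<tau>, q \<tau>)" and ?y = "dx f (\<tau>, q \<tau>)"
    \<comment> \<open>After the symmetry swap all terms assemble into the difference of the
      differentials of \<open>H\<close> at momenta \<open>p \<tau>\<close> and \<open>dx f\<close>,
      applied to \<open>(0, \<delta> \<tau>, X \<tau>)\<close>. That difference and the vector are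
      both of order \<open>\<delta>\<close>, so the estimate is quadratic in
      \<open>\<delta>\<close>.\<close>
    have "dx_deriv f ?z (1, q' \<tau>) \<bullet> \<delta> \<tau> = blinfun_apply (blinfun_apply (fderiv2 f ?z) (0, \<delta> \<tau>)) (1, q' \<tau>)"
      unfolding dx_deriv_inner by (rule fderiv2_sym[OF open_strip C2 mem[OF \<tau>]])
    also have "\<dots> = blinfun_apply (blinfun_apply (fderiv2 f ?z) (0, \<delta> \<tau>)) ((1, 0) + (0, q' \<tau>))" by simp
    also have "\<dots> = - blinfun_apply (fderiv H (\<tau>, q \<tau>, ?y)) (0, \<delta> \<tau>, X \<tau>) + X \<tau> \<bullet> q' \<tau>"
      unfolding blinfun.add_right hj_classical_differentiated[OF H open_strip f mem[OF \<tau>]] X_def dx_deriv_inner by simp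
    also have "X \<tau> \<bullet> q' \<tau> = blinfun_apply (fderiv H (\<tau>, q \<tau>, p \<tau>)) (0, 0, X \<tau>)"
      unfolding q'_def by (metis inner_commute hamiltonian_gradients(1)[OF H])
    finally have 1: "dx_deriv f ?z (1, q' \<tau>) \<bullet> \<delta> \<tau> = - blinfun_apply (fderiv H (\<tau>, q \<tau>, ?y)) (0, \<delta> \<tau>, X \<tau>)
       + blinfun_apply (fderiv H (\<tau>, q \<tau>, p \<tau>)) (0, 0, X \<tau>)" .
    have 2: "- (p' \<tau> \<bullet> \<delta> \<tau>) = blinfun_apply (fderiv H (\<tau>, q \<tau>, p \<tau>)) (0, \<delta> \<tau>, 0)"
      unfolding p'_def by (simp add: hamiltonian_gradients(2)[OF H])
    have "\<delta> \<tau> \<bullet> \<delta>' \<tau> = blinfun_apply (fderiv H (\<tau>, q \<tau>, p \<tau>) - fderiv H (\<tau>, q \<tau>, ?y)) (0, \<delta> \<tau>, X \<tau>)"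
    proof -
      have "blinfun_apply (fderiv H (\<tau>, q \<tau>, p \<tau>)) (0, \<delta> \<tau>, X \<tau>)
        = blinfun_apply (fderiv H (\<tau>, q \<tau>, p \<tau>)) ((0, \<delta> \<tau>, 0) + (0, 0, X \<tau>))" by simp
      also have "\<dots> = blinfun_apply (fderiv H (\<tau>, q \<tau>, p \<tau>)) (0, \<delta> \<tau>, 0) + blinfun_apply (fderiv H (\<tau>, q \<tau>, p \<tau>)) (0, 0, X \<tau>)"
        by (rule blinfun.add_right)
      finally show ?thesis using 1 2 unfolding \<delta>'_def by (simp add: inner_commute inner_diff_left inner_diff_right blinfun.diff_left)
    qed
    also have "\<dots> \<le> norm (fderiv H (\<tau>, q \<tau>, p \<tau>) - fderiv H (\<tau>, q \<tau>, ?y)) * norm (0::real, \<delta> \<tau>, X \<tau>)"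
      using norm_blinfun[of "fderiv H (\<tau>, q \<tau>, p \<tau>) - fderiv H (\<tau>, q \<tau>, ?y)" "(0, \<delta> \<tau>, X \<tau>)"] by simp
    also have "\<dots> \<le> (A * norm (\<delta> \<tau>)) * (norm (\<delta> \<tau>) + M * norm (\<delta> \<tau>))"
    proof (rule mult_mono)
      show "norm (fderiv H (\<tau>, q \<tau>, p \<tau>) - fderiv H (\<tau>, q \<tau>, ?y)) \<le> A * norm (\<delta> \<tau>)"
        using hamiltonian_fderiv_lipschitz[OF H, of "(\<tau>, q \<tau>, p \<tau>)" "(\<tau>, q \<tau>, ?y)"]
        by (simp add: \<delta>_def norm_minus_commute)
      have M0: "0 \<le> M" using M[OF \<tau>] norm_ge_zero order_trans by blast
      have "norm (X \<tau>) \<le> M * norm (\<delta> \<tau>)"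
      proof (rule norm_le_of_inner)
        fix v
        have "X \<tau> \<bullet> v \<le> norm (fderiv2 f ?z) * norm (0::real, \<delta> \<tau>) * norm (0::real, v)"
          unfolding X_def dx_deriv_inner by (rule order_trans[OF abs_ge_self norm_blinfun2])
        also have "\<dots> \<le> M * norm (\<delta> \<tau>) * norm v"
          using M[OF \<tau>] by (auto intro!: mult_right_mono)
        finally show "X \<tau> \<bullet> v \<le> M * norm (\<delta> \<tau>) * norm v" .
      qed (use M0 in simp)
      moreover have "norm (0::real, \<delta> \<tau>, X \<tau>) \<le> norm (\<delta> \<tau>) + norm (X \<tau>)"
        using norm_Pair_le[of "\<delta> \<tau>" "X \<tau>"] by simp
      ultimately show "norm (0::real, \<delta> \<tau>, X \<tau>) \<le> norm (\<delta> \<tau>) + M * norm (\<delta> \<tau>)" by simp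
    qed (use A in auto)
    also have "\<dots> = A * (1 + M) * e \<tau>" unfolding e_def by (simp add: dot_square_norm power2_eq_square algebra_simps)
    finally show ?thesis .
  qed
  \<comment> \<open>Integrating factor: \<open>k\<close> is twice the constant in
    \<open>\<delta>\<delta>'\<close>, since the derivative of \<open>e\<close> is twice the inner
    product estimated there.\<close>
  have "exp (- (k * \<tau>)) * e \<tau> \<le> exp (- (k * s)) * e s"
  proof (rule DERIV_nonpos_imp_nonincreasing[of s \<tau> "\<lambda>x. exp (- (k * x)) * e x"])
    show "s \<le> \<tau>" using \<tau> by simp
    fix x assume x: "s \<le> x" "x \<le> \<tau>"
    then have xI: "x \<in> {s..t}" using \<tau> by auto
    have "(e has_real_derivative 2 * (\<delta> x \<bullet> \<delta>' x)) (at x)"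
      using has_derivative_inner[OF d\<delta>[OF xI, unfolded has_vector_derivative_def] d\<delta>[OF xI, unfolded has_vector_derivative_def]]
      unfolding has_field_derivative_def e_def[abs_def]
      by (rule has_derivative_eq_rhs) (auto simp: fun_eq_iff inner_commute algebra_simps)
    then have "((\<lambda>x. exp (- (k * x)) * e x) has_real_derivative
        exp (- (k * x)) * (2 * (\<delta> x \<bullet> \<delta>' x) - k * e x)) (at x)"
      by (auto intro!: derivative_eq_intros simp: algebra_simps)
    moreover have "exp (- (k * x)) * (2 * (\<delta> x \<bullet> \<delta>' x) - k * e x) \<le> 0"
      using \<delta>\<delta>'[OF xI] by (intro mult_nonneg_nonpos) (auto simp: k_def algebra_simps)
    ultimately show "\<exists>y. ((\<lambda>x. exp (- (k * x)) * e x) has_real_derivative y) (at x) \<and> y \<le> 0" by blast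
  qed
  also have "e s = 0" using init by (simp add: e_def \<delta>_def)
  finally have "e \<tau> \<le> 0" by (simp add: mult_le_0_iff)
  then have "\<delta> \<tau> = 0" unfolding e_def using inner_ge_zero[of "\<delta> \<tau>"] by (metis inner_eq_zero_iff order_antisym)
  then show ?thesis by (simp add: \<delta>_def)
qed

text \<open>On the graph of \<open>dx f\<close> the equation turns the derivative of
  \<open>f\<close> along the trajectory into the integrand of the action; the rest is the
  fundamental theorem of calculus.\<close>

lemma classical_action:
  fixes H :: "real \<times> 'a::euclidean_space \<times> 'a \<Rightarrow> real"
  assumes H: "hamiltonian H A" and f: "hj_classical H (strip a b) f"
    and traj: "trajectory H q p" and st: "a < ereal s" "s \<le> t" "ereal t < b"
    and init: "p s = dx f (s, q s)"
  shows "f (t, q t) = f (s, q s) +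
         integral {s..t} (\<lambda>\<tau>. p \<tau> \<bullet> vector_derivative q (at \<tau>) - H (\<tau>, q \<tau>, p \<tau>))"
proof -
  have mem: "(\<tau>, q \<tau>) \<in> strip a b" if "\<tau> \<in> {s..t}" for \<tau>
    using that less_le_trans[OF st(1), of "ereal \<tau>"] le_less_trans[OF _ st(3), of "ereal \<tau>"] by simp
  have "((\<lambda>\<tau>. p \<tau> \<bullet> vector_derivative q (at \<tau>) - H (\<tau>, q \<tau>, p \<tau>)) has_integral f (t, q t) - f (s, q s)) {s..t}"
  proof (rule fundamental_theorem_of_calculus[OF st(2)])
    fix \<tau> assume \<tau>: "\<tau> \<in> {s..t}"
    let ?q' = "vector_derivative q (at \<tau>)"
    have "(q has_vector_derivative ?q') (at \<tau>)"
      using traj unfolding trajectory_def by (metis vector_derivative_at)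
    then have "((\<lambda>\<tau>. (\<tau>, q \<tau>)) has_derivative (\<lambda>h. h *\<^sub>R (1, ?q'))) (at \<tau>)"
      unfolding has_vector_derivative_def by (auto intro!: derivative_eq_intros)
    note df = hj_classicalD(3)[OF f mem[OF \<tau>]]
    have "((\<lambda>\<tau>. f (\<tau>, q \<tau>)) has_vector_derivative blinfun_apply (fderiv f (\<tau>, q \<tau>)) (1, ?q')) (at \<tau>)"
      using has_derivative_compose[OF \<open>(_ has_derivative _) _\<close> fderiv_works[OF df]]
      unfolding has_vector_derivative_def blinfun.scaleR_right .
    also have "blinfun_apply (fderiv f (\<tau>, q \<tau>)) (1, ?q') = p \<tau> \<bullet> ?q' - H (\<tau>, q \<tau>, p \<tau>)"
      unfolding fderiv_split[OF df] hj_classicalD(2)[OF f mem[OF \<tau>]]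
      using trajectory_on_graph[OF H f traj st init \<tau>] by simp
    finally show "((\<lambda>\<tau>. f (\<tau>, q \<tau>)) has_vector_derivative p \<tau> \<bullet> ?q' - H (\<tau>, q \<tau>, p \<tau>)) (at \<tau> within {s..t})"
      by (rule has_vector_derivative_at_within)
  qed
  from integral_unique[OF this] show ?thesis by simp
qed

subsection \<open>Compactness of a closed family of classical solutions\<close>

locale hj_family =
  fixes H :: "real \<times> 'a::euclidean_space \<times> 'a \<Rightarrow> real" and A B L :: real
    and Q :: "real \<Rightarrow> ennreal \<Rightarrow> ennreal"
    and F0 :: "('a \<Rightarrow> real) set" and u0 :: "'a \<Rightarrow> real" and F :: "(real \<times> 'a \<Rightarrow> real) set"
  assumes H: "hamiltonian H A" and Q: "classical_solvability H A Q"
    and F0_C2: "\<And>f0. f0 \<in> F0 \<Longrightarrow> Ck_on 2 UNIV f0"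
    and F0_lipschitz: "\<And>f0. f0 \<in> F0 \<Longrightarrow> L-lipschitz_on UNIV f0"
    and F0_bound: "\<And>f0 x. f0 \<in> F0 \<Longrightarrow> norm (fderiv2 f0 x) \<le> B"
    and u0: "\<And>x. ereal (u0 x) = (INF f0\<in>F0. ereal (f0 x))"
    and F: "F = {f. hj_classical H (strip (- lifespan Q B) (lifespan Q B)) f \<and> (\<lambda>x. f (0, x)) \<in> F0}"
    and F_closed: "closed_C1_loc (strip (- lifespan Q B) (lifespan Q B)) F"
begin

abbreviation "l \<equiv> lifespan Q B"
abbreviation "S \<equiv> strip (- l) l :: (real \<times> 'a) set"

text \<open>A real infimum, meaningful only where the values are bounded below.
  \<open>w_bdd_below\<close> ensures this within the lifespan, and \<open>w_eq_INF\<close> then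
  identifies it with the extended-real infimum of the theorem.\<close>

definition w :: "real \<Rightarrow> 'a \<Rightarrow> real" where "w t x = (INF f\<in>F. f (t, x))"

text \<open>An empty infimum of extended reals would be \<open>\<infinity>\<close>, which cannot be
  the real number \<open>u0 x\<close>.\<close>

lemma F0_nonempty: "F0 \<noteq> {}"
proof
  assume "F0 = {}"
  then show False using u0[of undefined] by (simp add: top_ereal_def)
qed

lemma B_nonneg: "0 \<le> B"
  using F0_nonempty F0_bound norm_ge_zero order_trans by blast

lemma l_pos: "0 < l" by (rule lifespan_pos[OF Q B_nonneg])

lemma S_iff: "(t, x) \<in> S \<longleftrightarrow> ereal \<bar>t\<bar> < l"
  using strip_around_iff[OF l_pos, of t x 0] by (simp add: zero_ereal_def[symmetric])

lemma F_classical: "f \<in> F \<Longrightarrow> hj_classical H S f"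
  and F_initial: "f \<in> F \<Longrightarrow> (\<lambda>x. f (0, x)) \<in> F0"
  by (simp_all add: F)

lemma F_cauchy: "f \<in> F \<Longrightarrow> hj_cauchy H Q 0 B (\<lambda>x. f (0, x)) f"
  using F_classical by (simp add: hj_cauchy_def zero_ereal_def[symmetric])

lemma F_surj: "f0 \<in> F0 \<Longrightarrow> \<exists>f\<in>F. \<forall>x. f (0, x) = f0 x"
  using classical_solvabilityD(1)[OF Q B_nonneg F0_C2, of f0 0] F0_bound
  by (auto simp: hj_cauchy_def F zero_ereal_def[symmetric])

lemma F_nonempty: "F \<noteq> {}"
  using F0_nonempty F_surj by blast

lemma F_bounds:
  assumes "0 \<le> T" "ereal T < l"
  shows "\<exists>K\<ge>0. \<forall>f\<in>F. (\<forall>z\<in>{-T..T} \<times> UNIV. norm (fderiv f z) \<le> K) \<and> K-lipschitz_on ({-T..T} \<times> UNIV) (fderiv f)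
     \<and> K-lipschitz_on ({-T..T} \<times> UNIV) f"
proof -
  obtain K where K: "K \<ge> 0" "\<forall>s fs f. Ck_on 2 UNIV fs \<and> (\<forall>x. norm (fderiv2 fs x) \<le> B) \<and> L-lipschitz_on UNIV fs
      \<and> hj_cauchy H Q s B fs f \<longrightarrow>
      (\<forall>t x. \<bar>t - s\<bar> \<le> T \<longrightarrow> norm (fderiv f (t, x)) \<le> K) \<and> K-lipschitz_on ({s - T..s + T} \<times> UNIV) (fderiv f)"
    using classical_C11_bound[OF H Q B_nonneg assms, of L] by (elim exE conjE)
  have "(\<forall>z\<in>{-T..T} \<times> UNIV. norm (fderiv f z) \<le> K) \<and> K-lipschitz_on ({-T..T} \<times> UNIV) (fderiv f)
     \<and> K-lipschitz_on ({-T..T} \<times> UNIV) f" if f: "f \<in> F" for f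
  proof -
    have b: "(\<forall>t x. \<bar>t\<bar> \<le> T \<longrightarrow> norm (fderiv f (t, x)) \<le> K) \<and> K-lipschitz_on ({-T..T} \<times> UNIV) (fderiv f)"
      using K(2)[rule_format, of "\<lambda>x. f (0, x)" 0 f] F0_C2 F0_bound F0_lipschitz F_initial[OF f] F_cauchy[OF f] by simp
    moreover have "K-lipschitz_on ({-T..T} \<times> UNIV) f"
    proof (rule lipschitz_onI[OF _ K(1)])
      have cv: "convex ({-T..T} \<times> (UNIV :: 'a set))" by (intro convex_Times) auto
      have *: "norm (fderiv f z) \<le> K \<and> (f has_derivative blinfun_apply (fderiv f z)) (at z)"
        if "z \<in> {-T..T} \<times> UNIV" for z
      proof -
        obtain t x where z: "z = (t, x)" by fastforce
        then have t: "\<bar>t\<bar> \<le> T" using that by (auto simp: abs_le_iff)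
        then have "z \<in> S" using assms z S_iff by (metis ereal_less_eq(3) le_less_trans)
        then show ?thesis using b t z fderiv_works[OF hj_classicalD(3)[OF F_classical[OF f]]] by blast
      qed
      fix y z assume yz: "y \<in> {-T..T} \<times> (UNIV::'a set)" "z \<in> {-T..T} \<times> (UNIV::'a set)"
      show "dist (f y) (f z) \<le> K * dist y z" unfolding dist_norm
        by (rule differentiable_bound[OF cv _ _ yz, where f'="\<lambda>z. blinfun_apply (fderiv f z)"])
          (use * in \<open>auto simp: norm_blinfun.rep_eq[symmetric] intro: has_derivative_at_withinI\<close>)
    qed
    ultimately show ?thesis by (auto simp: abs_le_iff)
  qed
  then show ?thesis using K(1) by blast
qed

lemma F_le: "f \<in> F \<Longrightarrow> u0 x \<le> f (0, x)"
  using F_initial[of f] u0[of x] by (metis (no_types, lifting) INF_lower ereal_less_eq(3))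

text \<open>The members start above \<open>u0\<close> and are equi-Lipschitz in time as well, so
  none can fall arbitrarily far by time \<open>t\<close>.\<close>

lemma w_bdd_below:
  assumes "ereal \<bar>t\<bar> < l"
  shows "bdd_below ((\<lambda>f. f (t, x)) ` F)"
proof -
  obtain K where K: "K \<ge> 0" "\<And>f. f \<in> F \<Longrightarrow> K-lipschitz_on ({-\<bar>t\<bar>..\<bar>t\<bar>} \<times> UNIV) f"
    using F_bounds[OF _ assms] by auto
  have "u0 x - K * dist (t, x) (0, x) \<le> f (t, x)" if "f \<in> F" for f
  proof -
    have "(t, x) \<in> {-\<bar>t\<bar>..\<bar>t\<bar>} \<times> UNIV" "(0, x) \<in> {-\<bar>t\<bar>..\<bar>t\<bar>} \<times> UNIV" by auto
    from lipschitz_onD[OF K(2)[OF that] this] F_le[OF that, of x] show ?thesis by (simp add: dist_real_def)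
  qed
  then show ?thesis by (intro bdd_belowI2)
qed

lemma w_le: "ereal \<bar>t\<bar> < l \<Longrightarrow> f \<in> F \<Longrightarrow> w t x \<le> f (t, x)"
  unfolding w_def by (intro cINF_lower w_bdd_below)

lemma w_greatest: "(\<And>f. f \<in> F \<Longrightarrow> c \<le> f (t, x)) \<Longrightarrow> c \<le> w t x"
  unfolding w_def by (intro cINF_greatest F_nonempty)

lemma w_0: "w 0 x = u0 x"
proof (rule antisym)
  show "u0 x \<le> w 0 x" by (rule w_greatest) (rule F_le)
  have "w 0 x \<le> f0 x" if f0: "f0 \<in> F0" for f0
    using F_surj[OF f0] w_le[of 0 _ x] l_pos by (metis abs_zero zero_ereal_def)
  then have "ereal (w 0 x) \<le> ereal (u0 x)" unfolding u0 by (intro INF_greatest) simp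
  then show "w 0 x \<le> u0 x" by simp
qed

lemma w_eq_INF:
  assumes "ereal \<bar>t\<bar> < l"
  shows "ereal (w t x) = (INF f\<in>F. ereal (f (t, x)))"
  unfolding w_def using ereal_Inf'[OF w_bdd_below[OF assms, of x]] F_nonempty by (simp add: image_image)

lemma w_lipschitz:
  assumes "0 \<le> T" "ereal T < l"
  shows "\<exists>K\<ge>0. K-lipschitz_on ({-T..T} \<times> UNIV) (\<lambda>(t, x). w t x)"
proof -
  obtain K where K: "K \<ge> 0" "\<And>f. f \<in> F \<Longrightarrow> K-lipschitz_on ({-T..T} \<times> UNIV) f"
    using F_bounds[OF assms] by auto
  have *: "w t x - K * dist (t, x) (s, y) \<le> w s y" if "t \<in> {-T..T}" "s \<in> {-T..T}" for t x s y
  proof (rule w_greatest)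
    fix f assume f: "f \<in> F"
    have "ereal \<bar>t\<bar> < l" using that assms by (auto simp: abs_if intro: le_less_trans[of _ "ereal T"])
    then show "w t x - K * dist (t, x) (s, y) \<le> f (s, y)"
      using w_le[OF _ f, of t x] lipschitz_onD[OF K(2)[OF f], of "(t, x)" "(s, y)"] that by (auto simp: dist_real_def)
  qed
  have "K-lipschitz_on ({-T..T} \<times> UNIV) (\<lambda>(t, x). w t x)"
  proof (rule lipschitz_onI[OF _ K(1)])
    fix y z assume "y \<in> {-T..T} \<times> (UNIV::'a set)" "z \<in> {-T..T} \<times> (UNIV::'a set)"
    then show "dist (case y of (t, x) \<Rightarrow> w t x) (case z of (t, x) \<Rightarrow> w t x) \<le> K * dist y z"
      using *[of "fst y" "fst z" "snd y" "snd z"] *[of "fst z" "fst y" "snd z" "snd y"]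
      by (auto simp: dist_real_def dist_commute abs_if split: prod.splits)
  qed
  with K(1) show ?thesis by blast
qed

lemma w_is_lipschitz:
  assumes "ereal \<bar>t\<bar> < l"
  shows "is_lipschitz (w t)"
proof -
  obtain K where K: "K-lipschitz_on ({-\<bar>t\<bar>..\<bar>t\<bar>} \<times> UNIV) (\<lambda>(t, x). w t x)"
    using w_lipschitz[OF abs_ge_zero assms] by blast
  have "K-lipschitz_on UNIV (w t)"
  proof (rule lipschitz_onI[OF _ lipschitz_on_nonneg[OF K]])
    fix x y
    have "(t, z) \<in> {-\<bar>t\<bar>..\<bar>t\<bar>} \<times> UNIV" for z :: 'a by auto
    from lipschitz_onD[OF K this[of x] this[of y]] show "dist (w t x) (w t y) \<le> K * dist x y"
      by (simp add: dist_Pair_Pair)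
  qed
  then show ?thesis unfolding is_lipschitz_def by blast
qed

section \<open>Precompactness of the family in C^1_loc\<close>

lemma compact_time_bound:
  assumes "compact K" "K \<subseteq> S"
  shows "\<exists>T\<ge>0. ereal T < l \<and> K \<subseteq> {-T..T} \<times> UNIV"
proof (cases "K = {}")
  case True
  then show ?thesis using l_pos by (intro exI[of _ 0]) (auto simp: zero_ereal_def)
next
  case False
  obtain z where z: "z \<in> K" "\<And>y. y \<in> K \<Longrightarrow> \<bar>fst y\<bar> \<le> \<bar>fst z\<bar>"
  proof -
    have "continuous_on K (\<lambda>z. \<bar>fst z\<bar>)" by (intro continuous_intros)
    from continuous_attains_sup[OF assms(1) False this] that show ?thesis by blast
  qed
  have "ereal \<bar>fst z\<bar> < l" using z(1) assms(2) S_iff[of "fst z" "snd z"] by auto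
  then show ?thesis using z(2) by (intro exI[of _ "\<bar>fst z\<bar>"]) (fastforce simp: abs_le_iff)
qed

text \<open>The differentials are bounded and equi-Lipschitz on compact sets, but additive constants
  could still drift along the sequence; the bound at the single point \<open>z0\<close> excludes
  this.\<close>

lemma F_equibounded:
  assumes f: "\<And>n. f n \<in> F" and z0: "z0 \<in> S" and c: "\<And>n. \<bar>f n z0\<bar> \<le> c" and C: "compact C" "C \<subseteq> S"
  shows "\<exists>M\<ge>0. (\<forall>n. \<forall>z\<in>C. norm (f n z, fderiv (f n) z) \<le> M) \<and>
     (\<forall>n. \<forall>y\<in>C. \<forall>z\<in>C. norm ((f n y, fderiv (f n) y) - (f n z, fderiv (f n) z)) \<le> M * norm (y - z))"
proof -
  \<comment> \<open>Including \<open>z0\<close> places it in the same time slab as \<open>C\<close>,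
    so that one Lipschitz constant carries the bound from \<open>z0\<close> to all of
    \<open>C\<close>.\<close>
  have "compact (insert z0 C)" "insert z0 C \<subseteq> S" using C z0 by auto
  then obtain T where T: "T \<ge> 0" "ereal T < l" "insert z0 C \<subseteq> {-T..T} \<times> UNIV" using compact_time_bound by blast
  obtain K where K: "K \<ge> 0" "\<And>f z. f \<in> F \<Longrightarrow> z \<in> {-T..T} \<times> UNIV \<Longrightarrow> norm (fderiv f z) \<le> K"
    "\<And>f. f \<in> F \<Longrightarrow> K-lipschitz_on ({-T..T} \<times> UNIV) (fderiv f)" "\<And>f. f \<in> F \<Longrightarrow> K-lipschitz_on ({-T..T} \<times> UNIV) f"
    using F_bounds[OF T(1,2)] by auto
  obtain D where D: "\<And>z. z \<in> C \<Longrightarrow> dist z0 z \<le> D"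
    using compact_imp_bounded[OF C(1)] unfolding bounded_any_center[of C z0] by blast
  define M where "M = max (c + K * D + K) (K + K)"
  have M1: "c + K * D + K \<le> M" and M2: "K + K \<le> M"
    unfolding M_def by (rule max.cobounded1, rule max.cobounded2)
  have "norm (f n z, fderiv (f n) z) \<le> M" if z: "z \<in> C" for n z
  proof -
    have "\<bar>f n z0 - f n z\<bar> \<le> K * dist z0 z"
      using lipschitz_onD[OF K(4)[OF f], of z0 z] T(3) z by (auto simp: dist_real_def)
    also have "\<dots> \<le> K * D" using D[OF z] K(1) by (rule mult_left_mono)
    finally have "\<bar>f n z\<bar> \<le> c + K * D" using c[of n] by linarith
    moreover have "norm (fderiv (f n) z) \<le> K" using T(3) z by (intro K(2)[OF f]) auto
    ultimately have "norm (f n z, fderiv (f n) z) \<le> (c + K * D) + K"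
      by (intro order_trans[OF norm_Pair_le] add_mono) auto
    then show ?thesis using M1 by (rule order_trans)
  qed
  moreover have "norm ((f n y, fderiv (f n) y) - (f n z, fderiv (f n) z)) \<le> M * norm (y - z)"
    if yz: "y \<in> C" "z \<in> C" for n y z
  proof -
    have "norm (f n y - f n z, fderiv (f n) y - fderiv (f n) z) \<le> K * norm (y - z) + K * norm (y - z)"
      using lipschitz_onD[OF K(4)[OF f], of y z] lipschitz_onD[OF K(3)[OF f], of y z] T(3) yz
      by (intro order_trans[OF norm_Pair_le] add_mono) (auto simp: dist_norm)
    also have "\<dots> = (K + K) * norm (y - z)" by (rule distrib_right[symmetric])
    also have "\<dots> \<le> M * norm (y - z)" using M2 by (rule mult_right_mono) simp
    finally show ?thesis by simp
  qed
  moreover have "0 \<le> M" using K(1) M2 by linarith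
  ultimately show ?thesis by (intro exI[of _ M] conjI allI ballI)
qed

text \<open>Arzela-Ascoli for values and differentials jointly, on an exhaustion of \<open>S\<close>
  by compact sets with a diagonal subsequence. The limit of the differentials is the differential of
  the limit, so closedness applies; it alone makes the limit a C^2 solution, although only C^1
  convergence is known.\<close>

lemma F_precompact:
  assumes f: "\<And>n::nat. f n \<in> F" and z0: "z0 \<in> S" and c: "\<And>n. \<bar>f n z0\<bar> \<le> c"
  shows "\<exists>k h. strict_mono k \<and> h \<in> F \<and>
    (\<forall>z\<in>S. (\<lambda>n. f (k n) z) \<longlonglongrightarrow> h z \<and> (\<lambda>n. fderiv (f (k n)) z) \<longlonglongrightarrow> fderiv h z)"
proof -
  define \<Phi> where "\<Phi> n z = (f n z, fderiv (f n) z)" for n :: nat and z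
  obtain C where C: "\<And>i::nat. compact (C i)" "\<And>i. C i \<subseteq> S" "\<Union>(range C) = S"
      "\<And>K. \<lbrakk>compact K; K \<subseteq> S\<rbrakk> \<Longrightarrow> \<exists>N. \<forall>n\<ge>N. K \<subseteq> C n"
    by (rule open_Union_compact_subsets[OF open_strip[of "- l" l, where 'a='a]]) (rule that; simp)
  obtain k where k: "strict_mono (k :: nat \<Rightarrow> nat)" "\<And>i. \<exists>g. uniform_limit (C i) (\<lambda>n. \<Phi> ((id \<circ> k) n)) g sequentially"
  proof (rule subsequence_diagonalization_lemma[of "\<lambda>i r. \<exists>g. uniform_limit (C i) (\<lambda>n. \<Phi> (r n)) g sequentially" id])
    fix i and r :: "nat \<Rightarrow> nat"
    obtain M where M: "M \<ge> 0" "\<And>n z. z \<in> C i \<Longrightarrow> norm (\<Phi> n z) \<le> M"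
        "\<And>n y z. y \<in> C i \<Longrightarrow> z \<in> C i \<Longrightarrow> norm (\<Phi> n y - \<Phi> n z) \<le> M * norm (y - z)"
    proof -
      have "\<exists>M\<ge>0. (\<forall>n. \<forall>z\<in>C i. norm (\<Phi> n z) \<le> M) \<and>
        (\<forall>n. \<forall>y\<in>C i. \<forall>z\<in>C i. norm (\<Phi> n y - \<Phi> n z) \<le> M * norm (y - z))"
        unfolding \<Phi>_def by (rule F_equibounded[of f z0 c "C i", OF f z0 c C(1,2)])
      then obtain M where M: "0 \<le> M \<and> (\<forall>n. \<forall>z\<in>C i. norm (\<Phi> n z) \<le> M) \<and>
        (\<forall>n. \<forall>y\<in>C i. \<forall>z\<in>C i. norm (\<Phi> n y - \<Phi> n z) \<le> M * norm (y - z))" by (rule exE)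
      show ?thesis by (rule that[of M]) (use M in simp_all)
    qed
    obtain g k where "strict_mono (k :: nat \<Rightarrow> nat)"
        "\<And>e. 0 < e \<Longrightarrow> \<exists>N. \<forall>n x. n \<ge> N \<and> x \<in> C i \<longrightarrow> norm (\<Phi> (r (k n)) x - g x) < e"
    proof (rule Arzela_Ascoli[where S="C i" and \<F>="\<lambda>n. \<Phi> (r n)" and M=M])
      show "compact (C i)" by (rule C(1))
    next
      show "norm (\<Phi> (r n) x) \<le> M" if "x \<in> C i" for n x using M(2) that .
    next
      fix x e assume x: "x \<in> C i" and e: "0 < (e::real)"
      show "\<exists>d>0. \<forall>n y. y \<in> C i \<and> norm (x - y) < d \<longrightarrow> norm (\<Phi> (r n) x - \<Phi> (r n) y) < e"
      proof (intro exI conjI allI impI)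
        show "0 < e / (M + 1)" using e M(1) by simp
        fix n y assume y: "y \<in> C i \<and> norm (x - y) < e / (M + 1)"
        have "norm (\<Phi> (r n) x - \<Phi> (r n) y) \<le> M * norm (x - y)" using M(3) x y by blast
        also have "\<dots> \<le> (M + 1) * norm (x - y)" by (simp add: algebra_simps)
        also have "\<dots> < e" using y M(1) by (simp add: pos_less_divide_eq mult.commute)
        finally show "norm (\<Phi> (r n) x - \<Phi> (r n) y) < e" .
      qed
    qed (rule that)
    then have "uniform_limit (C i) (\<lambda>n. \<Phi> ((r \<circ> k) n)) g sequentially"
      unfolding uniform_limit_sequentially_iff dist_norm o_def by blast
    with \<open>strict_mono k\<close> show "\<exists>k. strict_mono (k :: nat \<Rightarrow> nat) \<and> (\<exists>g. uniform_limit (C i) (\<lambda>n. \<Phi> ((r \<circ> k) n)) g sequentially)"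
      by (intro exI conjI)
  next
    \<comment> \<open>The diagonal sequence is only eventually a subsequence of each earlier one, so
      convergence on \<open>C i\<close> must survive a change of finitely many terms.\<close>
    fix i N and r k1 k2 :: "nat \<Rightarrow> nat"
    assume "\<exists>g. uniform_limit (C i) (\<lambda>n. \<Phi> ((r \<circ> k1) n)) g sequentially"
      and sub: "\<And>j. N \<le> j \<Longrightarrow> \<exists>j'\<ge>j. k2 j = k1 j'"
    then obtain g where g: "uniform_limit (C i) (\<lambda>n. \<Phi> ((r \<circ> k1) n)) g sequentially" by blast
    have "uniform_limit (C i) (\<lambda>n. \<Phi> ((r \<circ> k2) n)) g sequentially"
      unfolding uniform_limit_sequentially_iff
    proof (intro allI impI)
      fix e :: real assume "0 < e"
      then obtain n0 where n0: "\<And>n x. n \<ge> n0 \<Longrightarrow> x \<in> C i \<Longrightarrow> dist (\<Phi> ((r \<circ> k1) n) x) (g x) < e"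
        using g unfolding uniform_limit_sequentially_iff by blast
      show "\<exists>N. \<forall>n\<ge>N. \<forall>x\<in>C i. dist (\<Phi> ((r \<circ> k2) n) x) (g x) < e"
      proof (intro exI[of _ "max N n0"] allI impI ballI)
        fix n x assume "max N n0 \<le> n" and x: "x \<in> C i"
        then obtain j' where "j' \<ge> n" "k2 n = k1 j'" using sub[of n] by auto
        then show "dist (\<Phi> ((r \<circ> k2) n) x) (g x) < e" using n0[of j' x] x \<open>max N n0 \<le> n\<close> by simp
      qed
    qed
    then show "\<exists>g. uniform_limit (C i) (\<lambda>n. \<Phi> ((r \<circ> k2) n)) g sequentially" by blast
  qed blast
  \<comment> \<open>Defining \<open>g\<close> by pointwise limits makes the limits found on the
    various \<open>C i\<close> restrictions of one function.\<close>
  define g where "g z = lim (\<lambda>n. \<Phi> (k n) z)" for z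
  define h where "h z = fst (g z)" for z
  define h' where "h' z = snd (g z)" for z
  have ug: "uniform_limit K (\<lambda>n. \<Phi> (k n)) g sequentially" if K: "compact K" "K \<subseteq> S" for K
  proof -
    obtain i where i: "K \<subseteq> C i" using C(4)[OF K] by blast
    obtain g' where g': "uniform_limit (C i) (\<lambda>n. \<Phi> (k n)) g' sequentially" using k(2)[of i] by auto
    have "g' z = g z" if "z \<in> C i" for z
      unfolding g_def using tendsto_uniform_limitI[OF g' that] by (simp add: limI)
    then have "uniform_limit (C i) (\<lambda>n. \<Phi> (k n)) g sequentially"
      using g' by (simp cong: uniform_limit_cong')
    then show ?thesis using i by (rule uniform_limit_on_subset)
  qed
  have uh: "uniform_limit K (\<lambda>n. f (k n)) h sequentially" "uniform_limit K (\<lambda>n. fderiv (f (k n))) h' sequentially"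
    if K: "compact K" "K \<subseteq> S" for K
    using bounded_linear.uniform_limit[OF bounded_linear_fst ug[OF K]]
      bounded_linear.uniform_limit[OF bounded_linear_snd ug[OF K]]
    unfolding \<Phi>_def h_def h'_def by simp_all
  have ptw: "(\<lambda>n. f (k n) z) \<longlonglongrightarrow> h z" "(\<lambda>n. fderiv (f (k n)) z) \<longlonglongrightarrow> h' z" if "z \<in> S" for z
    using tendsto_uniform_limitI[OF uh(1)[of "{z}"]] tendsto_uniform_limitI[OF uh(2)[of "{z}"]] that by auto
  have df: "(f n has_derivative blinfun_apply (fderiv (f n) z)) (at z)" if "z \<in> S" for n z
    by (rule fderiv_works[OF hj_classicalD(3)[OF F_classical[OF f] that]])
  have local: "(h has_derivative blinfun_apply (h' z)) (at z) \<and> isCont h' z" if z: "z \<in> S" for z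
  proof -
    obtain e where e: "e > 0" "cball z e \<subseteq> S" using open_strip z open_contains_cball by blast
    note u = uh[OF compact_cball e(2)]
    have zint: "z \<in> interior (cball z e)" using e by simp
    \<comment> \<open>On a closed ball, which is convex, uniform convergence of the differentials
      allows the limit to be differentiated.\<close>
    have "\<exists>g. \<forall>x\<in>cball z e. (\<lambda>n. f (k n) x) \<longlonglongrightarrow> g x \<and> (g has_derivative blinfun_apply (h' x)) (at x within cball z e)"
    proof (rule has_derivative_sequence[OF convex_cball])
      show "(f (k n) has_derivative blinfun_apply (fderiv (f (k n)) x)) (at x within cball z e)" if "x \<in> cball z e" for n x
        using df e(2) that by (blast intro: has_derivative_at_withinI)
      fix \<epsilon> :: real assume "\<epsilon> > 0"
      then have "\<forall>\<^sub>F n in sequentially. \<forall>x\<in>cball z e. dist (fderiv (f (k n)) x) (h' x) < \<epsilon>"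
        using u(2) by (simp add: uniform_limit_iff)
      then show "\<forall>\<^sub>F n in sequentially. \<forall>x\<in>cball z e. \<forall>y. norm (blinfun_apply (fderiv (f (k n)) x) y - blinfun_apply (h' x) y) \<le> \<epsilon> * norm y"
      proof (rule eventually_mono, intro ballI allI)
        fix n x y assume *: "\<forall>x\<in>cball z e. dist (fderiv (f (k n)) x) (h' x) < \<epsilon>" "x \<in> cball z e"
        have "norm (blinfun_apply (fderiv (f (k n)) x - h' x) y) \<le> norm (fderiv (f (k n)) x - h' x) * norm y"
          by (rule norm_blinfun)
        also have "\<dots> \<le> \<epsilon> * norm y" using * by (intro mult_right_mono) (auto simp: dist_norm less_imp_le)
        finally show "norm (blinfun_apply (fderiv (f (k n)) x) y - blinfun_apply (h' x) y) \<le> \<epsilon> * norm y"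
          by (simp add: blinfun.diff_left)
      qed
    qed (use z e ptw(1)[OF z] in auto)
    then obtain g2 where g2: "\<And>x. x \<in> cball z e \<Longrightarrow> (\<lambda>n. f (k n) x) \<longlonglongrightarrow> g2 x"
        "\<And>x. x \<in> cball z e \<Longrightarrow> (g2 has_derivative blinfun_apply (h' x)) (at x within cball z e)" by blast
    have eq: "g2 x = h x" if "x \<in> cball z e" for x
      using LIMSEQ_unique[OF g2(1)[OF that] ptw(1)] e that by blast
    have "(g2 has_derivative blinfun_apply (h' z)) (at z)"
      using g2(2)[of z] e(1) at_within_interior[OF zint] by simp
    then have "(h has_derivative blinfun_apply (h' z)) (at z)"
      by (rule has_derivative_transform_within_open[OF _ open_ball[of z e]]) (use e eq in auto)
    moreover have "continuous_on (cball z e) h'"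
    proof (rule uniform_limit_theorem[OF _ u(2)])
      have "continuous_on (cball z e) (fderiv (f n))" for n
      proof (rule continuous_at_imp_continuous_on, rule ballI)
        fix y assume "y \<in> cball z e"
        then show "isCont (fderiv (f n)) y"
          using has_derivative_continuous[OF fderiv2_works[OF open_strip hj_classicalD(1)[OF F_classical[OF f]]]] e(2) by blast
      qed
      then show "\<forall>\<^sub>F n in sequentially. continuous_on (cball z e) (fderiv (f (k n)))" by simp
    qed simp
    ultimately show ?thesis using zint continuous_on_interior by blast
  qed
  have fh: "fderiv h z = h' z" if "z \<in> S" for z using local[OF that] by (intro fderiv_eqI) blast
  have "h \<in> F"
  proof (rule F_closed[unfolded closed_C1_loc_def, rule_format, of "\<lambda>n. f (k n)"], intro conjI allI impI)
    show "f (k n) \<in> F" for n by (rule f)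
    have "Ck_on (Suc 0) S h"
    proof (simp, intro conjI ballI allI)
      show dh: "h differentiable (at z)" if "z \<in> S" for z using local[OF that] differentiableI by blast
      fix v
      have "continuous_on S (\<lambda>x. blinfun_apply (h' x) v)"
        using local by (intro continuous_intros continuous_at_imp_continuous_on) blast
      moreover have "blinfun_apply (h' z) v = frechet_derivative h (at z) v" if "z \<in> S" for z
        using fh[OF that] fderiv_apply[OF dh[OF that]] by simp
      ultimately show "continuous_on S (\<lambda>x. frechet_derivative h (at x) v)"
        by (simp cong: continuous_on_cong)
    qed
    then show "Ck_on 1 S h" by simp
    fix K :: "(real \<times> 'a) set" assume "compact K \<and> K \<subseteq> S"
    then have K: "compact K" "K \<subseteq> S" by auto
    show "uniform_limit K (\<lambda>n. f (k n)) h sequentially" by (rule uh(1)[OF K])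
    have "fderiv h z = h' z" if "z \<in> K" for z using fh K that by blast
    then show "uniform_limit K (\<lambda>n. fderiv (f (k n))) (fderiv h) sequentially"
      using uh(2)[OF K] by (simp cong: uniform_limit_cong')
  qed
  then show ?thesis using k(1) ptw fh by (intro exI[of _ k] exI[of _ h]) auto
qed

end

subsection \<open>Initial data of the family and the variational operator\<close>

text \<open>Passes from a fixed base point \<open>y0\<close> (sequence \<open>b\<close>) to moving
  base points \<open>y n\<close> (sequence \<open>a\<close>): a Lipschitz constant uniform in
  \<open>n\<close> makes the shift vanish.\<close>

lemma tendsto_of_lipschitz_shift:
  fixes a b :: "nat \<Rightarrow> 'b::real_normed_vector"
  assumes "\<And>n. norm (a n - b n) \<le> K * dist (y n) y0" "y \<longlonglongrightarrow> y0" "b \<longlonglongrightarrow> c"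
  shows "a \<longlonglongrightarrow> c"
proof -
  have "(\<lambda>n. K * dist (y n) y0) \<longlonglongrightarrow> 0"
    using tendsto_mult[OF tendsto_const[of K] tendsto_dist[OF assms(2) tendsto_const[of y0]]] by simp
  with always_eventually[OF allI[OF assms(1)]] have "(\<lambda>n. a n - b n) \<longlonglongrightarrow> 0"
    by (rule Lim_null_comparison)
  from tendsto_add[OF this assms(3)] show ?thesis by simp
qed

lemma hj_operators_mono:
  assumes "hj_operators H A G" "s \<le> t" "is_lipschitz u" "is_lipschitz v" "\<And>x. u x \<le> v x"
  shows "G s t u x \<le> G s t v x"
proof -
  note m = assms(1)[unfolded hj_operators_def, THEN conjunct2, THEN conjunct1, THEN spec, THEN spec, THEN spec, THEN spec, THEN mp, of s t u v]
  show ?thesis using m assms(2-) by blast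
qed

lemma hj_operators_classical:
  assumes "hj_operators H A G" "hj_classical H (strip a b) f" "a < ereal s" "s \<le> t" "ereal t < b"
    "is_lipschitz (\<lambda>x. f (s, x))"
  shows "G s t (\<lambda>y. f (s, y)) x = f (t, x)"
proof -
  note m = assms(1)[unfolded hj_operators_def, THEN conjunct2, THEN conjunct2, THEN spec, THEN spec, THEN spec, THEN spec, THEN spec, THEN mp, of a b f s t]
  show ?thesis using m assms(2-) by blast
qed

context hj_family
begin

lemma time_nonneg:
  assumes "0 \<le> t" "ereal t < l"
  shows "ereal \<bar>t\<bar> < l" "- l < ereal t"
proof -
  show "ereal \<bar>t\<bar> < l" using assms by simp
  then have "(t, undefined) \<in> S" by (rule S_iff[THEN iffD2])
  then show "- l < ereal t" by simp
qed

lemma F_slice_lipschitz: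
  assumes "f \<in> F" "ereal \<bar>t\<bar> < l"
  shows "is_lipschitz (\<lambda>x. f (t, x))"
proof -
  obtain K where K: "K-lipschitz_on ({-\<bar>t\<bar>..\<bar>t\<bar>} \<times> UNIV) f"
    using F_bounds[OF abs_ge_zero assms(2)] assms(1) by blast
  have "K-lipschitz_on UNIV (\<lambda>x. f (t, x))"
  proof (rule lipschitz_onI[OF _ lipschitz_on_nonneg[OF K]])
    fix x y
    have "(t, z) \<in> {-\<bar>t\<bar>..\<bar>t\<bar>} \<times> UNIV" for z :: 'a by auto
    from lipschitz_onD[OF K this[of x] this[of y]] show "dist (f (t, x)) (f (t, y)) \<le> K * dist x y"
      by (simp add: dist_Pair_Pair)
  qed
  then show ?thesis unfolding is_lipschitz_def by blast
qed

text \<open>Convergence of the values at the moving points bounds \<open>f n\<close> at the fixed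
  point \<open>(t, x0)\<close>, whence precompactness; values and gradients follow the moving points
  by equi-Lipschitz continuity. Constant points serve for attainment of the infimum, moving ones for
  the Clarke differential.\<close>

lemma F_limit:
  assumes f: "\<And>n::nat. f n \<in> F" and t: "ereal \<bar>t\<bar> < l" and x: "x \<longlonglongrightarrow> x0"
    and c: "(\<lambda>n. f n (t, x n)) \<longlonglongrightarrow> c"
  shows "\<exists>h\<in>F. \<exists>k. strict_mono k \<and> h (t, x0) = c \<and> (\<lambda>n. dx (f (k n)) (t, x (k n))) \<longlonglongrightarrow> dx h (t, x0)"
proof -
  obtain K where K: "K \<ge> 0" "\<And>f. f \<in> F \<Longrightarrow> K-lipschitz_on ({-\<bar>t\<bar>..\<bar>t\<bar>} \<times> UNIV) (fderiv f)"
      "\<And>f. f \<in> F \<Longrightarrow> K-lipschitz_on ({-\<bar>t\<bar>..\<bar>t\<bar>} \<times> UNIV) f"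
    using F_bounds[OF abs_ge_zero t] by blast
  have tI: "(t, y) \<in> {-\<bar>t\<bar>..\<bar>t\<bar>} \<times> UNIV" for y :: 'a by auto
  have shift: "norm (f n (t, y) - f n (t, x0)) \<le> K * dist y x0"
    "norm (fderiv (f n) (t, y) - fderiv (f n) (t, x0)) \<le> K * dist y x0" for n y
    using lipschitz_onD[OF K(3)[OF f] tI[of y] tI[of x0]] lipschitz_onD[OF K(2)[OF f] tI[of y] tI[of x0]]
    by (simp_all add: dist_Pair_Pair dist_norm)
  obtain M1 where M1: "\<And>n. norm (f n (t, x n)) \<le> M1"
    using convergent_imp_Bseq[OF convergentI[OF c]] unfolding Bseq_def by blast
  have dist: "(\<lambda>n. dist (x n) x0) \<longlonglongrightarrow> dist x0 x0" by (intro tendsto_intros x)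
  obtain M2 where M2: "\<And>n. norm (dist (x n) x0) \<le> M2"
    using convergent_imp_Bseq[OF convergentI[OF dist]] unfolding Bseq_def by blast
  have "\<bar>f n (t, x0)\<bar> \<le> M1 + K * M2" for n
  proof -
    have "K * dist (x n) x0 \<le> K * M2" using M2[of n] K(1) by (intro mult_left_mono) auto
    then show ?thesis using shift(1)[of n "x n"] M1[of n] unfolding real_norm_def by linarith
  qed
  moreover have z0: "(t, x0) \<in> S" using t by (rule S_iff[THEN iffD2])
  ultimately obtain k h where kh: "strict_mono (k :: nat \<Rightarrow> nat)" "h \<in> F"
     "\<And>z. z \<in> S \<Longrightarrow> (\<lambda>n. f (k n) z) \<longlonglongrightarrow> h z" "\<And>z. z \<in> S \<Longrightarrow> (\<lambda>n. fderiv (f (k n)) z) \<longlonglongrightarrow> fderiv h z"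
    using F_precompact[of f "(t, x0)", OF f] by blast
  have xk: "(\<lambda>n. x (k n)) \<longlonglongrightarrow> x0" using LIMSEQ_subseq_LIMSEQ[OF x kh(1)] by (simp add: o_def)
  have "(\<lambda>n. f (k n) (t, x (k n))) \<longlonglongrightarrow> h (t, x0)"
    by (rule tendsto_of_lipschitz_shift[OF shift(1) xk kh(3)[OF z0]])
  moreover have "(\<lambda>n. f (k n) (t, x (k n))) \<longlonglongrightarrow> c"
    using LIMSEQ_subseq_LIMSEQ[OF c kh(1)] by (simp add: o_def)
  ultimately have "h (t, x0) = c" by (rule LIMSEQ_unique)
  moreover have "(\<lambda>n. dx (f (k n)) (t, x (k n))) \<longlonglongrightarrow> dx h (t, x0)"
  proof -
    have df: "g differentiable (at (t, y))" if "g \<in> F" for g y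
      using hj_classicalD(3)[OF F_classical[OF that]] S_iff t by blast
    have "(\<lambda>n. fderiv (f (k n)) (t, x (k n))) \<longlonglongrightarrow> fderiv h (t, x0)"
      by (rule tendsto_of_lipschitz_shift[OF shift(2) xk kh(4)[OF z0]])
    then have "(\<lambda>n. \<Sum>b\<in>Basis. blinfun_apply (fderiv (f (k n)) (t, x (k n))) (0, b) *\<^sub>R b)
      \<longlonglongrightarrow> (\<Sum>b\<in>Basis. blinfun_apply (fderiv h (t, x0)) (0, b) *\<^sub>R b)"
      by (intro tendsto_sum tendsto_scaleR tendsto_const blinfun.tendsto)
    then show ?thesis by (simp add: dx_eq_sum df f kh(2))
  qed
  ultimately show ?thesis using kh(1,2) by (intro bexI[of _ h] exI[of _ k] conjI)
qed

section \<open>Active members of the family and the Clarke differential of the infimum\<close>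

lemma w_attained:
  assumes t: "ereal \<bar>t\<bar> < l"
  shows "\<exists>f\<in>F. f (t, x) = w t x"
proof -
  have "\<exists>f\<in>F. f (t, x) < w t x + 1 / (real n + 1)" for n :: nat
    using cInf_lessD[of "(\<lambda>f. f (t, x)) ` F" "w t x + 1 / (real n + 1)"] F_nonempty unfolding w_def by auto
  then obtain f where f: "\<And>n::nat. f n \<in> F" "\<And>n. f n (t, x) < w t x + 1 / (real n + 1)" by metis
  have "(\<lambda>n. f n (t, x)) \<longlonglongrightarrow> w t x"
  proof (rule tendsto_sandwich)
    show "\<forall>\<^sub>F n in sequentially. w t x \<le> f n (t, x)" using w_le[OF t f(1)] by simp
    show "\<forall>\<^sub>F n in sequentially. f n (t, x) \<le> w t x + 1 / (real n + 1)" using f(2) by (simp add: less_imp_le)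
    have "(\<lambda>n. 1 / (real n + 1)) \<longlonglongrightarrow> 0" using LIMSEQ_Suc[OF lim_1_over_n] by (simp add: add.commute)
    from tendsto_add[OF tendsto_const this] show "(\<lambda>n. w t x + 1 / (real n + 1)) \<longlonglongrightarrow> w t x" by simp
  qed simp
  from F_limit[OF f(1) t tendsto_const this] show ?thesis by blast
qed

lemma dx_family_iff:
  assumes t: "ereal \<bar>t\<bar> < l"
  shows "\<xi> \<in> dx_family F t x \<longleftrightarrow> (\<exists>f\<in>F. f (t, x) = w t x \<and> \<xi> = dx f (t, x))"
proof -
  have "(\<forall>h\<in>F. f (t, x) \<le> h (t, x)) \<longleftrightarrow> f (t, x) = w t x" if "f \<in> F" for f
  proof
    assume "\<forall>h\<in>F. f (t, x) \<le> h (t, x)"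
    then have "f (t, x) \<le> w t x" by (intro w_greatest) simp
    then show "f (t, x) = w t x" using w_le[OF t that, of x] by simp
  next
    assume "f (t, x) = w t x"
    then show "\<forall>h\<in>F. f (t, x) \<le> h (t, x)" using w_le[OF t, of _ x] by simp
  qed
  then show ?thesis unfolding dx_family_def by blast
qed

text \<open>The difference between the slice of \<open>f\<close> and \<open>w t\<close> is
  nonnegative and vanishes at \<open>x\<close>, so its derivative is zero at this minimum.\<close>

lemma grad_w_active:
  assumes t: "ereal \<bar>t\<bar> < l" and d: "w t differentiable (at x)" and f: "f \<in> F" "f (t, x) = w t x"
  shows "grad (w t) x = dx f (t, x)"
proof -
  have df: "f differentiable (at (t, x))"
    using hj_classicalD(3)[OF F_classical[OF f(1)]] S_iff t by blast
  note dw = d[unfolded frechet_derivative_works]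
  have "((\<lambda>y. f (t, y) - w t y) has_derivative
      (\<lambda>v. blinfun_apply (fderiv f (t, x)) (0, v) - frechet_derivative (w t) (at x) v)) (at x)"
    by (rule has_derivative_diff[OF partial_x_has_derivative[OF fderiv_works[OF df]] dw])
  moreover have "\<forall>\<^sub>F y in at x. f (t, x) - w t x \<le> f (t, y) - w t y"
    using w_le[OF t f(1)] f(2) by simp
  ultimately have "(\<lambda>v. blinfun_apply (fderiv f (t, x)) (0, v) - frechet_derivative (w t) (at x) v) = (\<lambda>v. 0)"
    by (rule has_derivative_local_min)
  then have "blinfun_apply (fderiv f (t, x)) (0, v) - frechet_derivative (w t) (at x) v = 0" for v by meson
  then have "grad (w t) x \<bullet> v = dx f (t, x) \<bullet> v" for v
    using has_derivative_imp_grad_inner[OF dw] dx_inner[OF df] by simp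
  then show ?thesis using vector_eq_rdot by blast
qed

lemma clarke_w_subset:
  assumes t: "ereal \<bar>t\<bar> < l"
  shows "clarke (w t) x \<subseteq> convex hull dx_family F t x"
  unfolding clarke_def
proof (intro hull_mono subsetI, elim CollectE exE conjE)
  fix \<xi> X assume X: "\<forall>n. w t differentiable (at (X n))" "X \<longlonglongrightarrow> x" "(\<lambda>n. grad (w t) (X n)) \<longlonglongrightarrow> \<xi>"
  have "\<forall>n. \<exists>f. f \<in> F \<and> f (t, X n) = w t (X n)" using w_attained[OF t] by blast
  from choice[OF this] obtain f where f: "\<And>n::nat. f n \<in> F" "\<And>n. f n (t, X n) = w t (X n)" by blast
  obtain K where "K-lipschitz_on UNIV (w t)" using w_is_lipschitz[OF t] unfolding is_lipschitz_def by blast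
  from lipschitz_on_continuous_on[OF this] have "isCont (w t) x"
    by (simp add: continuous_on_eq_continuous_at)
  then have "(\<lambda>n. f n (t, X n)) \<longlonglongrightarrow> w t x" unfolding f(2) using X(2) by (rule isCont_tendsto_compose)
  from F_limit[OF f(1) t X(2) this] obtain h k where h: "h \<in> F" "strict_mono k" "h (t, x) = w t x"
     "(\<lambda>n. dx (f (k n)) (t, X (k n))) \<longlonglongrightarrow> dx h (t, x)" by blast
  have "(\<lambda>n. dx (f (k n)) (t, X (k n))) \<longlonglongrightarrow> \<xi>"
    using LIMSEQ_subseq_LIMSEQ[OF X(3) h(2)] grad_w_active[OF t X(1)[rule_format] f] by (simp add: o_def)
  then have "\<xi> = dx h (t, x)" using h(4) LIMSEQ_unique by blast
  then show "\<xi> \<in> dx_family F t x" unfolding dx_family_iff[OF t] using h(1,3) by blast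
qed

text \<open>Stated for \<open>hj_operators\<close> because it serves twice: for \<open>G\<close> as
  the easy half of the variational formula, and for \<open>V\<close> to keep the continuation of
  \<open>w\<close> below the family.\<close>

lemma operators_le_classical:
  assumes G: "hj_operators H A G" and st: "0 \<le> s" "s \<le> t" "ereal t < l" and f: "f \<in> F"
  shows "G s t (w s) x \<le> f (t, x)"
proof -
  have s: "0 \<le> s" "ereal s < l" using st le_less_trans[OF _ st(3), of "ereal s"] by simp_all
  note s' = time_nonneg[OF s]
  have "G s t (w s) x \<le> G s t (\<lambda>y. f (s, y)) x"
    by (rule hj_operators_mono[OF G st(2) w_is_lipschitz[OF s'(1)] F_slice_lipschitz[OF f s'(1)] w_le[OF s'(1) f]])
  also have "\<dots> = f (t, x)"
    by (rule hj_operators_classical[OF G F_classical[OF f] s'(2) st(2,3) F_slice_lipschitz[OF f s'(1)]])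
  finally show ?thesis .
qed

text \<open>Convexity enters only at the starting time \<open>s\<close>. Time 0 gives part (i); the
  later starting times feed the subsolution test.\<close>

lemma variational_eq_w:
  assumes G: "variational_resolution H A G" and st: "0 \<le> s" "s \<le> t" "ereal t < l"
    and conv: "\<And>x. convex (dx_family F s x)"
  shows "G s t (w s) x = w t x"
proof (rule antisym)
  have op: "hj_operators H A G" using G unfolding variational_resolution_def by blast
  show "G s t (w s) x \<le> w t x" by (rule w_greatest) (rule operators_le_classical[OF op st])
  have s: "0 \<le> s" "ereal s < l" using st le_less_trans[OF _ st(3), of "ereal s"] by simp_all
  note s' = time_nonneg[OF s]
  have "\<forall>s u. is_lipschitz u \<longrightarrow> variational_solution H s u (\<lambda>(t, x). G s t u x)"
    using G unfolding variational_resolution_def by (rule conjunct2)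
  then have vs: "variational_solution H s (w s) (\<lambda>(t, x). G s t (w s) x)" using w_is_lipschitz[OF s'(1)] by blast
  show "w t x \<le> G s t (w s) x"
  \<comment> \<open>The representation by a trajectory is available for \<open>s < t\<close>
    only.\<close>
  proof (cases "s = t")
    case True
    then show ?thesis using vs unfolding variational_solution_def by simp
  next
    case False
    then have "s < t" using st by simp
    with vs obtain q p where qp: "trajectory H q p" "q t = x" "p s \<in> clarke (w s) (q s)"
       "G s t (w s) x = w s (q s) +
         integral {s..t} (\<lambda>\<tau>. p \<tau> \<bullet> vector_derivative q (at \<tau>) - H (\<tau>, q \<tau>, p \<tau>))"
      unfolding variational_solution_def by (simp add: split_beta) blast
    \<comment> \<open>Convexity removes the hull from \<open>clarke_w_subset\<close>: the initial
      momentum is itself an active gradient, so the trajectory starts on the graph of a single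
      member.\<close>
    have "p s \<in> dx_family F s (q s)"
      using qp(3) clarke_w_subset[OF s'(1)] hull_same[of convex, OF conv] by blast
    then obtain f where f: "f \<in> F" "f (s, q s) = w s (q s)" "p s = dx f (s, q s)"
      unfolding dx_family_iff[OF s'(1)] by blast
    have "f (t, q t) = G s t (w s) x"
      using classical_action[OF H F_classical[OF f(1)] qp(1) s'(2) st(2,3) f(3)] qp(4) f(2) by simp
    then show ?thesis using w_le[OF time_nonneg(1)[OF _ st(3)] f(1), of x] qp(2) st by simp
  qed
qed

end

subsection \<open>Local majorants by classical solutions\<close>

text \<open>Square \<open>1 + u / 3\<close> with \<open>u = r\<^sup>2\<close> at most 1. This
  quadratic lower bound will absorb the Taylor remainder near the contact point; its linear
  companion \<open>sqrt_bracket_far\<close> will absorb Lipschitz growth away from it.\<close>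

lemma sqrt_bracket_near:
  fixes r :: real
  assumes "0 \<le> r" "r \<le> 1"
  shows "r\<^sup>2 / 3 \<le> sqrt (1 + r\<^sup>2) - 1"
proof -
  define u where "u = r\<^sup>2"
  have "u * u \<le> u * 1" using assms unfolding u_def by (intro mult_left_mono) (auto simp: power_le_one)
  moreover have "(1 + u / 3)\<^sup>2 = 1 + 2 * u / 3 + u * u / 9" by (simp add: power2_eq_square algebra_simps)
  moreover have "0 \<le> u" by (simp add: u_def)
  ultimately have "(1 + u / 3)\<^sup>2 \<le> 1 + u" by linarith
  from real_le_rsqrt[OF this] show ?thesis unfolding u_def by linarith
qed

lemma sqrt_bracket_far:
  fixes r \<rho> :: real
  assumes "0 < \<rho>" "\<rho> \<le> 1" "\<rho> \<le> r"
  shows "\<rho> / 3 * r \<le> sqrt (1 + r\<^sup>2) - 1"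
proof -
  define a where "a = \<rho> * r"
  have "a \<le> r * r" using assms unfolding a_def by (intro mult_right_mono) auto
  moreover have "a * a \<le> (1 * r) * (1 * r)" using assms unfolding a_def by (intro mult_mono) auto
  moreover have "(1 + \<rho> / 3 * r)\<^sup>2 = 1 + 2 * a / 3 + a * a / 9" by (simp add: a_def power2_eq_square algebra_simps)
  moreover have "0 \<le> r * r" by simp
  ultimately have "(1 + \<rho> / 3 * r)\<^sup>2 \<le> 1 + r\<^sup>2" unfolding power2_eq_square[of r] by linarith
  from real_le_rsqrt[OF this] show ?thesis by linarith
qed

text \<open>An affine function plus \<open>M\<close> times a smoothed norm: a parabola near
  \<open>x0\<close>, a cone at infinity. Its Hessian is bounded and it is Lipschitz, as classical
  solvability and the operators demand of a datum; a paraboloid would not be Lipschitz.\<close>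

definition bowl :: "real \<Rightarrow> 'a::euclidean_space \<Rightarrow> real \<Rightarrow> 'a \<Rightarrow> 'a \<Rightarrow> real" where
  "bowl c b M x0 y = c + b \<bullet> (y - x0) + M * (sqrt (1 + (y - x0) \<bullet> (y - x0)) - 1)"

lemma bowl_center [simp]: "bowl c b M x0 x0 = c"
  by (simp add: bowl_def)

lemma bracket_has_derivative:
  fixes x0 :: "'a::euclidean_space"
  defines "N \<equiv> \<lambda>y. sqrt (1 + (y - x0) \<bullet> (y - x0))"
  shows "(N has_derivative (\<lambda>w. (y - x0) \<bullet> w / N y)) (at y)"
proof -
  have p: "0 < 1 + (y - x0) \<bullet> (y - x0)" using inner_ge_zero[of "y - x0"] by linarith
  have "((\<lambda>y. 1 + (y - x0) \<bullet> (y - x0)) has_derivative (\<lambda>w. 2 * ((y - x0) \<bullet> w))) (at y)"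
    by (auto intro!: derivative_eq_intros simp: inner_commute)
  from has_derivative_compose[OF this has_field_derivative_imp_has_derivative[OF DERIV_real_sqrt[OF p]]]
  show ?thesis unfolding N_def by (rule has_derivative_eq_rhs) (simp add: fun_eq_iff field_simps)
qed

lemma bowl_has_derivative:
  "(bowl c b M x0 has_derivative (\<lambda>v. b \<bullet> v + M * ((y - x0) \<bullet> v / sqrt (1 + (y - x0) \<bullet> (y - x0))))) (at y)"
proof -
  have "((\<lambda>y. c + b \<bullet> (y - x0)) has_derivative (\<lambda>v. b \<bullet> v)) (at y)"
    by (auto intro!: derivative_eq_intros)
  from has_derivative_add[OF this has_derivative_mult_right[OF
      has_derivative_diff[OF bracket_has_derivative[of x0 y] has_derivative_const[of 1]], of M]]
  show ?thesis unfolding bowl_def[abs_def] by simp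
qed

lemma bowl_deriv_has_derivative:
  fixes x0 :: "'a::euclidean_space"
  defines "N \<equiv> \<lambda>y. sqrt (1 + (y - x0) \<bullet> (y - x0))"
  shows "((\<lambda>y. b \<bullet> v + M * ((y - x0) \<bullet> v / N y)) has_derivative
      (\<lambda>w. M * (w \<bullet> v / N y - ((y - x0) \<bullet> v) * ((y - x0) \<bullet> w) / (N y) ^ 3))) (at y)"
proof -
  have N: "N y \<noteq> 0" using inner_ge_zero[of "y - x0"] unfolding N_def by (metis add_nonneg_eq_0_iff real_sqrt_eq_zero_cancel_iff zero_le_one zero_neq_one)
  have "((\<lambda>y. (y - x0) \<bullet> v) has_derivative (\<lambda>w. w \<bullet> v)) (at y)"
    by (auto intro!: derivative_eq_intros)
  moreover have "(N has_derivative (\<lambda>w. (y - x0) \<bullet> w / N y)) (at y)"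
    unfolding N_def by (rule bracket_has_derivative)
  ultimately have "((\<lambda>y. (y - x0) \<bullet> v / N y) has_derivative
      (\<lambda>w. - ((y - x0) \<bullet> v) * (inverse (N y) * ((y - x0) \<bullet> w / N y) * inverse (N y)) + w \<bullet> v / N y)) (at y)"
    using N by (rule has_derivative_divide)
  then
  have "((\<lambda>y. (y - x0) \<bullet> v / N y) has_derivative
      (\<lambda>w. w \<bullet> v / N y - ((y - x0) \<bullet> v) * ((y - x0) \<bullet> w) / (N y) ^ 3)) (at y)"
    by (rule has_derivative_eq_rhs) (use N in \<open>simp add: fun_eq_iff field_simps power3_eq_cube\<close>)
  from has_derivative_add[OF has_derivative_const has_derivative_mult_right[OF this]] show ?thesis by simp
qed

lemma bowl_frechet_derivative:
  "frechet_derivative (bowl c b M x0) (at y) v = b \<bullet> v + M * ((y - x0) \<bullet> v / sqrt (1 + (y - x0) \<bullet> (y - x0)))"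
  by (rule fun_cong[OF frechet_derivative_at[OF bowl_has_derivative, symmetric]])

lemma bowl_C2: "Ck_on 2 UNIV (bowl c b M x0)"
proof -
  have p: "1 + (y - x0) \<bullet> (y - x0) \<noteq> 0" for y using inner_ge_zero[of "y - x0"] by linarith
  have "continuous_on UNIV (\<lambda>y. M * (w \<bullet> v / sqrt (1 + (y - x0) \<bullet> (y - x0)) -
       ((y - x0) \<bullet> v) * ((y - x0) \<bullet> w) / (sqrt (1 + (y - x0) \<bullet> (y - x0))) ^ 3))" for v w
    using p by (intro continuous_intros) auto
  then show ?thesis
    unfolding numeral_2_eq_2 Ck_on.simps bowl_frechet_derivative frechet_derivative_at[OF bowl_deriv_has_derivative, symmetric]
    using differentiableI[OF bowl_has_derivative] differentiableI[OF bowl_deriv_has_derivative] by blast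
qed

text \<open>Each of the two terms of the Hessian is at most \<open>norm w * norm v\<close>, because
  \<open>N\<close> is at least 1 and at least \<open>norm (y - x0)\<close>. The bound does not
  involve \<open>c\<close>, so bowls placed at different times share one lifespan.\<close>

lemma bowl_fderiv2:
  fixes x0 :: "'a::euclidean_space"
  assumes "0 \<le> M"
  shows "norm (fderiv2 (bowl c b M x0) y) \<le> 2 * M"
proof -
  define N where "N = sqrt (1 + (y - x0) \<bullet> (y - x0))"
  have N: "1 \<le> N" "norm (y - x0) \<le> N" unfolding N_def norm_eq_sqrt_inner by simp_all
  have *: "blinfun_apply (blinfun_apply (fderiv2 (bowl c b M x0) y) w) v
     = M * (w \<bullet> v / N - ((y - x0) \<bullet> v) * ((y - x0) \<bullet> w) / N ^ 3)" for v w :: 'a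
    unfolding fderiv2_apply[OF open_UNIV bowl_C2 UNIV_I] bowl_frechet_derivative N_def
    by (rule fun_cong[OF frechet_derivative_at[OF bowl_deriv_has_derivative, symmetric]])
  show ?thesis
  proof (rule norm_blinfun_bound[OF _ norm_blinfun_bound])
    fix w v :: 'a
    have "\<bar>w \<bullet> v / N\<bar> \<le> norm w * norm v"
    proof -
      have "\<bar>w \<bullet> v\<bar> \<le> norm w * norm v * 1" using Cauchy_Schwarz_ineq2[of w v] by simp
      also have "\<dots> \<le> norm w * norm v * N" using N by (intro mult_left_mono) auto
      finally show ?thesis using N by (simp add: pos_divide_le_eq)
    qed
    moreover have "\<bar>((y - x0) \<bullet> v) * ((y - x0) \<bullet> w) / N ^ 3\<bar> \<le> norm w * norm v"
    proof -
      have "\<bar>(y - x0) \<bullet> v\<bar> \<le> N * norm v" "\<bar>(y - x0) \<bullet> w\<bar> \<le> N * norm w"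
        by (rule order_trans[OF Cauchy_Schwarz_ineq2 mult_right_mono[OF N(2) norm_ge_zero]])+
      then have "\<bar>(y - x0) \<bullet> v\<bar> * \<bar>(y - x0) \<bullet> w\<bar> \<le> (N * norm v) * (N * norm w)"
        using N by (intro mult_mono) auto
      also have "\<dots> = N\<^sup>2 * (norm w * norm v)" by (simp add: power2_eq_square)
      also have "\<dots> \<le> N ^ 3 * (norm w * norm v)" using N(1) by (intro mult_right_mono power_increasing) auto
      finally show ?thesis using N(1) by (simp add: abs_mult pos_divide_le_eq mult.commute)
    qed
    ultimately have "\<bar>w \<bullet> v / N - ((y - x0) \<bullet> v) * ((y - x0) \<bullet> w) / N ^ 3\<bar> \<le> 2 * (norm w * norm v)"
      by linarith
    then have "M * \<bar>w \<bullet> v / N - ((y - x0) \<bullet> v) * ((y - x0) \<bullet> w) / N ^ 3\<bar> \<le> M * (2 * (norm w * norm v))"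
      using assms by (rule mult_left_mono)
    then show "norm (blinfun_apply (blinfun_apply (fderiv2 (bowl c b M x0) y) w) v) \<le> 2 * M * norm w * norm v"
      unfolding * real_norm_def abs_mult[of M] abs_of_nonneg[OF assms] by (simp only: mult_ac)
  qed (use assms in auto)
qed

lemma bowl_lipschitz:
  assumes "0 \<le> M"
  shows "(norm b + M)-lipschitz_on UNIV (bowl c b M x0)"
proof (rule lipschitz_onI)
  fix x y
  show "dist (bowl c b M x0 x) (bowl c b M x0 y) \<le> (norm b + M) * dist x y" unfolding dist_norm
  proof (rule differentiable_bound[OF convex_UNIV])
    fix z
    show "(bowl c b M x0 has_derivative (\<lambda>v. b \<bullet> v + M * ((z - x0) \<bullet> v / sqrt (1 + (z - x0) \<bullet> (z - x0))))) (at z within UNIV)"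
      using bowl_has_derivative by simp
    show "onorm (\<lambda>v. b \<bullet> v + M * ((z - x0) \<bullet> v / sqrt (1 + (z - x0) \<bullet> (z - x0)))) \<le> norm b + M"
    proof (rule onorm_le)
      fix v
      define N where "N = sqrt (1 + (z - x0) \<bullet> (z - x0))"
      have N: "1 \<le> N" "norm (z - x0) \<le> N" unfolding N_def norm_eq_sqrt_inner by simp_all
      have "\<bar>(z - x0) \<bullet> v\<bar> \<le> N * norm v"
        by (rule order_trans[OF Cauchy_Schwarz_ineq2 mult_right_mono[OF N(2) norm_ge_zero]])
      then have "\<bar>(z - x0) \<bullet> v / N\<bar> \<le> norm v" using N(1) by (simp add: pos_divide_le_eq mult.commute)
      then have "\<bar>M * ((z - x0) \<bullet> v / N)\<bar> \<le> M * norm v" using assms mult_left_mono[of "\<bar>(z - x0) \<bullet> v / N\<bar>" "norm v" M] by (simp add: abs_mult)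
      then show "norm (b \<bullet> v + M * ((z - x0) \<bullet> v / sqrt (1 + (z - x0) \<bullet> (z - x0)))) \<le> (norm b + M) * norm v"
        using Cauchy_Schwarz_ineq2[of b v] unfolding N_def[symmetric] real_norm_def distrib_right by linarith
    qed
  qed auto
qed (use assms in simp)

text \<open>Taylor's inequality by two mean value estimates; \<open>K\<close> bounds the second
  differential on the unit ball, and the factor 1/2 is given away.\<close>

lemma C2_second_order_bound:
  fixes \<phi> :: "'a::euclidean_space \<Rightarrow> real"
  assumes "Ck_on 2 UNIV \<phi>"
  shows "\<exists>K\<ge>0. \<forall>z\<in>cball z0 1. \<phi> z \<le> \<phi> z0 + blinfun_apply (fderiv \<phi> z0) (z - z0) + K * (norm (z - z0))\<^sup>2"
proof -
  note C2 = open_UNIV assms UNIV_I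
  have "continuous_on (cball z0 1) (fderiv2 \<phi>)"
    using continuous_on_subset[OF continuous_on_fderiv2[OF open_UNIV assms]] by simp
  from compact_imp_bounded[OF compact_continuous_image[OF this compact_cball]]
  obtain K where K: "\<And>z. z \<in> cball z0 1 \<Longrightarrow> norm (fderiv2 \<phi> z) \<le> K" unfolding bounded_iff by blast
  have K0: "0 \<le> K" by (rule order_trans[OF norm_ge_zero K[of z0]]) simp
  have "\<phi> z \<le> \<phi> z0 + blinfun_apply (fderiv \<phi> z0) (z - z0) + K * (norm (z - z0))\<^sup>2" if z: "z \<in> cball z0 1" for z
  proof -
    have "norm (\<phi> z - \<phi> z0 - blinfun_apply (fderiv \<phi> z0) (z - z0)) \<le> norm (z - z0) * (K * norm (z - z0))"
    proof (rule differentiable_bound_linearization[where S="cball z0 (norm (z - z0))" and f'="\<lambda>x. blinfun_apply (fderiv \<phi> x)"])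
      fix t :: real assume "t \<in> {0..1}"
      then show "z0 + t *\<^sub>R (z - z0) \<in> cball z0 (norm (z - z0))"
        by (simp add: dist_norm mult_left_le_one_le)
    next
      fix x assume x: "x \<in> cball z0 (norm (z - z0))"
      show "(\<phi> has_derivative blinfun_apply (fderiv \<phi> x)) (at x within cball z0 (norm (z - z0)))"
        using fderiv_works[OF Ck_on_2D(1)[OF assms UNIV_I]] by (rule has_derivative_at_withinI)
      have "x \<in> cball z0 1" using x z by (auto simp: dist_norm norm_minus_commute)
      then have "norm (fderiv \<phi> x - fderiv \<phi> z0) \<le> K * norm (x - z0)"
      proof (intro differentiable_bound[OF convex_cball[of z0 1], where f'="\<lambda>y. blinfun_apply (fderiv2 \<phi> y)"])
        fix y assume "y \<in> cball z0 1"
        then show "onorm (blinfun_apply (fderiv2 \<phi> y)) \<le> K" using K by (simp add: norm_blinfun.rep_eq)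
        show "(fderiv \<phi> has_derivative blinfun_apply (fderiv2 \<phi> y)) (at y within cball z0 1)"
          using fderiv2_works[OF C2] by (rule has_derivative_at_withinI)
      qed auto
      also have "\<dots> \<le> K * norm (z - z0)"
        using x K0 by (intro mult_left_mono) (auto simp: dist_norm norm_minus_commute)
      finally have "norm (fderiv \<phi> x - fderiv \<phi> z0) \<le> K * norm (z - z0)" .
      then show "onorm (blinfun_apply (fderiv \<phi> x) - blinfun_apply (fderiv \<phi> z0)) \<le> K * norm (z - z0)"
        by (simp add: norm_blinfun.rep_eq minus_blinfun.rep_eq fun_diff_def)
    qed simp
    then show ?thesis by (simp add: power2_eq_square mult_ac)
  qed
  with K0 show ?thesis by blast
qed

section \<open>From local contact to the subsolution inequality\<close>

context hj_family
begin

text \<open>Turns a local contact into a majorant on all of space, with \<open>K\<close>,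
  \<open>M\<close> and \<open>\<rho>\<close> independent of the starting time \<open>s\<close>: near
  \<open>x0\<close> by Taylor's inequality, farther away because the bowl outgrows the Lipschitz
  function \<open>w s\<close>.\<close>

lemma w_locally_below_bowl:
  assumes t0: "0 < t0" "ereal t0 < l"
    and \<phi>: "Ck_on 2 UNIV \<phi>" "\<phi> (t0, x0) = w t0 x0"
    and above: "0 < e" "\<And>s y. 0 \<le> s \<Longrightarrow> s \<le> t0 \<Longrightarrow> dist (s, y) (t0, x0) < e \<Longrightarrow> w s y \<le> \<phi> (s, y)"
  defines "a \<equiv> dt \<phi> (t0, x0)" and "b \<equiv> dx \<phi> (t0, x0)"
  shows "\<exists>K\<ge>0. \<exists>M\<ge>0. \<exists>\<rho>>0. \<forall>s y. 0 \<le> s \<and> s \<le> t0 \<and> t0 - s \<le> \<rho> \<longrightarrow>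
     w s y \<le> bowl (w t0 x0 - a * (t0 - s) + K * (t0 - s)\<^sup>2) b M x0 y"
proof -
  obtain K where K: "K \<ge> 0" "\<And>z. z \<in> cball (t0, x0) 1 \<Longrightarrow> \<phi> z \<le> \<phi> (t0, x0)
      + blinfun_apply (fderiv \<phi> (t0, x0)) (z - (t0, x0)) + K * (norm (z - (t0, x0)))\<^sup>2"
    using C2_second_order_bound[OF \<phi>(1), of "(t0, x0)"] by blast
  obtain \<Lambda> where \<Lambda>: "\<Lambda> \<ge> 0" "\<Lambda>-lipschitz_on ({-t0..t0} \<times> UNIV) (\<lambda>(t, x). w t x)"
    using w_lipschitz[OF less_imp_le[OF t0(1)] t0(2)] by blast
  \<comment> \<open>With \<open>1 / 2\<close>, points within \<open>2 * \<rho>\<close> stay in the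
    unit ball of the Taylor estimate; with \<open>e / 3\<close>, they stay in the contact
    neighbourhood.\<close>
  define \<rho> where "\<rho> = min (1 / 2) (e / 3)"
  have \<rho>: "0 < \<rho>" "\<rho> \<le> 1 / 2" "\<rho> \<le> e / 3" "\<rho> \<le> 1" using above(1) by (auto simp: \<rho>_def)
  \<comment> \<open>\<open>3 * K\<close> compensates the factor 1/3 of
    \<open>sqrt_bracket_near\<close>; the other summand lets \<open>sqrt_bracket_far\<close> beat
    the slope \<open>\<Lambda> + norm b\<close> at distances beyond \<open>\<rho>\<close>.\<close>
  define M where "M = 3 * K + 3 * (\<Lambda> + norm b) / \<rho>"
  have M: "0 \<le> M" using K(1) \<Lambda>(1) \<rho>(1) by (simp add: M_def)
  have near: "w s y \<le> w t0 x0 - a * (t0 - s) + K * (t0 - s)\<^sup>2 + b \<bullet> (y - x0) + K * (norm (y - x0))\<^sup>2"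
    if s: "0 \<le> s" "s \<le> t0" "t0 - s \<le> \<rho>" and y: "norm (y - x0) \<le> \<rho>" for s y
  proof -
    have "dist (s, y) (t0, x0) \<le> \<bar>s - t0\<bar> + norm (y - x0)"
      using norm_Pair_le[of "s - t0" "y - x0"] by (simp add: dist_norm)
    also have "\<dots> \<le> 2 * \<rho>" using s y by linarith
    finally have d: "dist (s, y) (t0, x0) \<le> 2 * \<rho>" .
    have "w s y \<le> \<phi> (s, y)" using d \<rho> above(1) by (intro above(2) s) linarith
    also have "\<dots> \<le> \<phi> (t0, x0) + blinfun_apply (fderiv \<phi> (t0, x0)) ((s, y) - (t0, x0)) + K * (norm ((s, y) - (t0, x0)))\<^sup>2"
    proof (rule K(2))
      have "dist (s, y) (t0, x0) \<le> 1" using d \<rho> by linarith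
      then show "(s, y) \<in> cball (t0, x0) 1" by (simp add: dist_commute)
    qed
    also have "blinfun_apply (fderiv \<phi> (t0, x0)) ((s, y) - (t0, x0)) = - a * (t0 - s) + b \<bullet> (y - x0)"
      unfolding a_def b_def fderiv_split[OF Ck_on_2D(1)[OF \<phi>(1) UNIV_I]] by (simp add: algebra_simps)
    also have "(norm ((s, y) - (t0, x0)))\<^sup>2 = (t0 - s)\<^sup>2 + (norm (y - x0))\<^sup>2"
      by (simp add: norm_Pair power2_commute)
    finally show ?thesis using \<phi>(2) by (simp add: algebra_simps)
  qed
  have "w s y \<le> bowl (w t0 x0 - a * (t0 - s) + K * (t0 - s)\<^sup>2) b M x0 y"
    if s: "0 \<le> s" "s \<le> t0" "t0 - s \<le> \<rho>" for s y
  proof -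
    define r where "r = norm (y - x0)"
    have r: "0 \<le> r" "(y - x0) \<bullet> (y - x0) = r\<^sup>2" by (simp_all add: r_def dot_square_norm)
    have br: "0 \<le> sqrt (1 + r\<^sup>2) - 1" by simp
    show ?thesis
    proof (cases "r \<le> \<rho>")
      case True
      have "K * r\<^sup>2 = 3 * K * (r\<^sup>2 / 3)" by simp
      also have "\<dots> \<le> 3 * K * (sqrt (1 + r\<^sup>2) - 1)"
        using sqrt_bracket_near[of r] r True \<rho> K(1) by (intro mult_left_mono) auto
      also have "\<dots> \<le> M * (sqrt (1 + r\<^sup>2) - 1)"
        using br \<Lambda>(1) \<rho>(1) by (intro mult_right_mono) (auto simp: M_def)
      finally show ?thesis using near[OF s, of y] True unfolding bowl_def r(2) r_def[symmetric] by linarith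
    next
      case False
      have "w s y \<le> w s x0 + \<Lambda> * r"
      proof -
        have "(s, y) \<in> {-t0..t0} \<times> UNIV" "(s, x0) \<in> {-t0..t0} \<times> UNIV" using s by auto
        from lipschitz_onD[OF \<Lambda>(2) this] show ?thesis by (simp add: dist_Pair_Pair dist_real_def r_def dist_norm)
      qed
      also have "w s x0 \<le> w t0 x0 - a * (t0 - s) + K * (t0 - s)\<^sup>2" using near[OF s, of x0] \<rho>(1) by simp
      finally have 1: "w s y \<le> w t0 x0 - a * (t0 - s) + K * (t0 - s)\<^sup>2 + \<Lambda> * r" by simp
      have 2: "- (norm b * r) \<le> b \<bullet> (y - x0)" using Cauchy_Schwarz_ineq2[of b "y - x0"] by (simp add: r_def abs_le_iff)
      have "\<Lambda> * r + norm b * r = 3 * (\<Lambda> + norm b) / \<rho> * (\<rho> / 3 * r)"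
        using \<rho>(1) by (simp add: field_simps)
      also have "\<dots> \<le> 3 * (\<Lambda> + norm b) / \<rho> * (sqrt (1 + r\<^sup>2) - 1)"
        using sqrt_bracket_far[OF \<rho>(1,4), of r] False \<Lambda>(1) \<rho>(1) by (intro mult_left_mono) auto
      also have "\<dots> \<le> M * (sqrt (1 + r\<^sup>2) - 1)"
        using br K(1) by (intro mult_right_mono) (auto simp: M_def)
      finally show ?thesis using 1 2 unfolding bowl_def r(2) by linarith
    qed
  qed
  then show ?thesis using K(1) M \<rho>(1) by blast
qed

text \<open>Comparing \<open>w\<close> at an earlier time with a global classical solution starting from the bowl
  only uses times before the contact point, so the subsolution test survives gluing at \<open>t0\<close>.\<close>

lemma w_subsolution_backward:
  assumes G: "hj_operators H A G" and Gw: "\<And>s. 0 \<le> s \<Longrightarrow> s \<le> t0 \<Longrightarrow> w t0 x0 \<le> G s t0 (w s) x0"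
    and t0: "0 < t0" "ereal t0 < l"
    and \<phi>: "Ck_on 2 UNIV \<phi>" "\<phi> (t0, x0) = w t0 x0"
    and above: "0 < e" "\<And>s y. 0 \<le> s \<Longrightarrow> s \<le> t0 \<Longrightarrow> dist (s, y) (t0, x0) < e \<Longrightarrow> w s y \<le> \<phi> (s, y)"
  shows "hj_lhs H \<phi> (t0, x0) \<le> 0"
proof -
  define a where "a = dt \<phi> (t0, x0)"
  define b where "b = dx \<phi> (t0, x0)"
  obtain K M \<rho> where K: "K \<ge> 0" and M: "M \<ge> 0" and \<rho>: "\<rho> > 0"
    and below: "\<And>s y. 0 \<le> s \<Longrightarrow> s \<le> t0 \<Longrightarrow> t0 - s \<le> \<rho> \<Longrightarrow>
     w s y \<le> bowl (w t0 x0 - a * (t0 - s) + K * (t0 - s)\<^sup>2) b M x0 y"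
    using w_locally_below_bowl[OF t0 \<phi> above] unfolding a_def b_def by blast
  \<comment> \<open>The Hessian bound of every bowl involved, whatever its starting time; hence
    \<open>T\<close> and \<open>K1\<close> are fixed before the step \<open>h\<close> tends to
    0.\<close>
  define r where "r = 2 * M"
  have r: "0 \<le> r" using M by (simp add: r_def)
  obtain T where T: "0 < ereal T" "ereal T < lifespan Q r" using ereal_dense2[OF lifespan_pos[OF Q r]] by blast
  then have T0: "0 < T" by simp
  obtain K1 where K1: "K1 \<ge> 0" "\<forall>s fs f. Ck_on 2 UNIV fs \<and> (\<forall>x. norm (fderiv2 fs x) \<le> r) \<and> (norm b + M)-lipschitz_on UNIV fs
      \<and> hj_cauchy H Q s r fs f \<longrightarrow>
      (\<forall>t x. \<bar>t - s\<bar> \<le> T \<longrightarrow> norm (fderiv f (t, x)) \<le> K1) \<and> K1-lipschitz_on ({s - T..s + T} \<times> UNIV) (fderiv f)"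
    using classical_C11_bound[OF H Q r less_imp_le[OF T0] T(2), of "norm b + M"] by (elim exE conjE)
  \<comment> \<open>The test inequality with an error of order \<open>h\<close>: the mean value
    theorem in time over \<open>[t0 - h, t0]\<close> yields a time \<open>\<xi>\<close> and a
    momentum \<open>p\<close> in place of \<open>t0\<close> and \<open>b\<close>, and
    \<open>p\<close> is close to \<open>b\<close> because the bowl has gradient \<open>b\<close> at
    its centre.\<close>
  have step: "\<exists>\<xi> p. \<bar>\<xi> - t0\<bar> \<le> h \<and> norm (p - b) \<le> K1 * h \<and> a + H (\<xi>, x0, p) \<le> K * h"
    if h: "0 < h" "h \<le> t0" "h \<le> T" "h \<le> \<rho>" for h
  proof -
    define s where "s = t0 - h"
    define fs where "fs = bowl (w t0 x0 - a * (t0 - s) + K * (t0 - s)\<^sup>2) b M x0"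
    have s: "0 \<le> s" "s < t0" "t0 - s = h" using h by (simp_all add: s_def)
    have fs: "Ck_on 2 UNIV fs" "\<forall>x. norm (fderiv2 fs x) \<le> r" "(norm b + M)-lipschitz_on UNIV fs"
      using bowl_C2 bowl_fderiv2[OF M] bowl_lipschitz[OF M] unfolding fs_def r_def by blast+
    obtain f where f: "hj_cauchy H Q s r fs f" using classical_solvabilityD(1)[OF Q r fs(1,2)] by blast
    have cl: "hj_classical H (strip (ereal s - lifespan Q r) (ereal s + lifespan Q r)) f"
      and init: "\<And>x. f (s, x) = fs x" using f unfolding hj_cauchy_def by blast+
    have mem: "(\<tau>, y) \<in> strip (ereal s - lifespan Q r) (ereal s + lifespan Q r)" if "s \<le> \<tau>" "\<tau> \<le> t0" for \<tau> and y :: 'a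
    proof -
      have "ereal \<bar>\<tau> - s\<bar> \<le> ereal T" using that s h by simp
      from le_less_trans[OF this T(2)] show ?thesis by (rule strip_around_iff[OF lifespan_pos[OF Q r], THEN iffD2])
    qed
    have lipfs: "is_lipschitz fs" using fs(3) unfolding is_lipschitz_def by blast
    have sl: "ereal s < l" using le_less_trans[OF _ t0(2), of "ereal s"] s by simp
    have "w t0 x0 \<le> G s t0 (w s) x0" using Gw s by simp
    also have "\<dots> \<le> G s t0 fs x0"
      using below s h unfolding fs_def[symmetric]
      by (intro hj_operators_mono[OF G _ w_is_lipschitz[OF time_nonneg(1)[OF s(1) sl]] lipfs]) (auto simp: fs_def)
    also have "\<dots> = G s t0 (\<lambda>y. f (s, y)) x0" unfolding init ..
    also have "\<dots> = f (t0, x0)"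
      using mem[of s x0] mem[of t0 x0] s lipfs init
      by (intro hj_operators_classical[OF G cl]) auto
    finally have up: "w t0 x0 \<le> f (t0, x0)" .
    have "\<exists>\<xi>. s < \<xi> \<and> \<xi> < t0 \<and> f (t0, x0) - f (s, x0) = (t0 - s) * dt f (\<xi>, x0)"
      using dt_has_derivative(1)[OF hj_classicalD(3)[OF cl mem]] s(2)
      by (intro MVT2[of s t0 "\<lambda>\<tau>. f (\<tau>, x0)"]) auto
    then obtain \<xi> where \<xi>: "s < \<xi>" "\<xi> < t0" "f (t0, x0) - f (s, x0) = h * dt f (\<xi>, x0)" using s(3) by auto
    define p where "p = dx f (\<xi>, x0)"
    have df: "f differentiable (at (\<tau>, x0))" if "s \<le> \<tau>" "\<tau> \<le> t0" for \<tau>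
      using hj_classicalD(3)[OF cl mem[OF that]] .
    have "dx f (s, x0) = b"
    proof -
      have "(fs has_derivative (\<lambda>v. b \<bullet> v)) (at x0)"
        using bowl_has_derivative[where y=x0 and ?x0.0=x0] unfolding fs_def by simp
      from has_derivative_imp_grad_inner[OF this] have "grad fs x0 \<bullet> v = b \<bullet> v" for v .
      then have "grad fs x0 = b" using vector_eq_rdot by blast
      then show ?thesis unfolding dx_def by (simp add: init)
    qed
    then have "norm (p - b) = norm (dx f (\<xi>, x0) - dx f (s, x0))" by (simp add: p_def)
    also have "\<dots> \<le> K1 * h"
    proof (rule norm_le_of_inner)
      fix v
      have "K1-lipschitz_on ({s - T..s + T} \<times> UNIV) (fderiv f)" using K1(2) fs f by blast
      moreover have "(\<xi>, x0) \<in> {s - T..s + T} \<times> UNIV" "(s, x0) \<in> {s - T..s + T} \<times> UNIV" using \<xi> s h T0 by auto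
      ultimately have "dist (fderiv f (\<xi>, x0)) (fderiv f (s, x0)) \<le> K1 * dist (\<xi>, x0) (s, x0)" by (rule lipschitz_onD)
      also have "\<dots> \<le> K1 * h" using \<xi> s K1(1) by (intro mult_left_mono) (auto simp: dist_Pair_Pair dist_real_def)
      finally have n: "norm (fderiv f (\<xi>, x0) - fderiv f (s, x0)) \<le> K1 * h" by (simp add: dist_norm)
      have "(dx f (\<xi>, x0) - dx f (s, x0)) \<bullet> v = blinfun_apply (fderiv f (\<xi>, x0) - fderiv f (s, x0)) (0, v)"
        using dx_inner[OF df] \<xi> by (simp add: inner_diff_left blinfun.diff_left)
      also have "\<dots> \<le> norm (fderiv f (\<xi>, x0) - fderiv f (s, x0)) * norm (0::real, v)"
        using norm_blinfun[of "fderiv f (\<xi>, x0) - fderiv f (s, x0)" "(0, v)"] by simp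
      also have "\<dots> \<le> K1 * h * norm v" using mult_right_mono[OF n norm_ge_zero[of v]] by simp
      finally show "(dx f (\<xi>, x0) - dx f (s, x0)) \<bullet> v \<le> K1 * h * norm v" .
    qed (use K1(1) h in simp)
    finally have pb: "norm (p - b) \<le> K1 * h" .
    have "dt f (\<xi>, x0) = - H (\<xi>, x0, p)" using hj_classicalD(2)[OF cl mem[of \<xi> x0]] \<xi> by (simp add: p_def)
    moreover have "f (s, x0) = w t0 x0 - a * h + K * h\<^sup>2" unfolding init fs_def s(3) by simp
    \<comment> \<open>The bowl starts at height \<open>w t0 x0 - a * h + K * h\<^sup>2\<close>, so
      \<open>w t0 x0\<close> cancels in the comparison and what remains is divisible by
      \<open>h\<close>.\<close>
    ultimately have "h * (a + H (\<xi>, x0, p)) \<le> h * (K * h)"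
      using up \<xi>(3) by (simp add: algebra_simps power2_eq_square)
    then have "a + H (\<xi>, x0, p) \<le> K * h" using h(1) by simp
    then show ?thesis using pb \<xi> s(3) by (intro exI[of _ \<xi>] exI[of _ p]) auto
  qed
  have "a + H (t0, x0, b) \<le> 0"
  proof (rule field_le_epsilon)
    fix \<epsilon> :: real assume \<epsilon>: "0 < \<epsilon>"
    obtain d where d: "d > 0" "\<And>z. dist z (t0, x0, b) < d \<Longrightarrow> dist (H z) (H (t0, x0, b)) < \<epsilon> / 2"
      using hamiltonian_isCont[OF H, of "(t0, x0, b)"] \<epsilon> unfolding continuous_at_eps_delta by (metis half_gt_zero)
    \<comment> \<open>The last two entries keep \<open>(\<xi>, x0, p)\<close> within
      \<open>d / 2\<close> of \<open>(t0, x0, b)\<close> and the error \<open>K * h\<close> at most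
      \<open>\<epsilon> / 2\<close>.\<close>
    define h where "h = Min {t0, T, \<rho>, d / (2 * (1 + K1)), \<epsilon> / (2 * (1 + K))}"
    have h: "0 < h" "h \<le> t0" "h \<le> T" "h \<le> \<rho>" "h \<le> d / (2 * (1 + K1))" "h \<le> \<epsilon> / (2 * (1 + K))"
      using t0 T0 \<rho> d \<epsilon> K K1 by (auto simp: h_def)
    obtain \<xi> p where \<xi>p: "\<bar>\<xi> - t0\<bar> \<le> h" "norm (p - b) \<le> K1 * h" "a + H (\<xi>, x0, p) \<le> K * h"
      using step[OF h(1-4)] by blast
    have "dist (\<xi>, x0, p) (t0, x0, b) \<le> \<bar>\<xi> - t0\<bar> + norm (p - b)"
      using norm_Pair_le[of "\<xi> - t0" "(0::'a, p - b)"] by (simp add: dist_norm)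
    also have "\<dots> \<le> (1 + K1) * h" using \<xi>p by (simp add: algebra_simps)
    also have "\<dots> \<le> d / 2" using h(5) K1(1) by (simp add: field_simps)
    finally have "dist (H (\<xi>, x0, p)) (H (t0, x0, b)) < \<epsilon> / 2" using d by (intro d(2)) linarith
    moreover have "K * h \<le> (1 + K) * h" using h(1) by simp
    moreover have "(1 + K) * h \<le> \<epsilon> / 2" using h(6) K by (simp add: field_simps)
    ultimately show "a + H (t0, x0, b) \<le> 0 + \<epsilon>" using \<xi>p(3) unfolding dist_real_def by linarith
  qed
  then show ?thesis by (simp add: hj_lhs_def a_def b_def)
qed

end

subsection \<open>Gluing and the viscosity operator\<close>

lemma smooth_on_imp_Ck_on: "smooth_on S f \<Longrightarrow> Ck_on k S f"
  by (simp add: smooth_on_def)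

lemma viscosity_operatorsD:
  assumes "viscosity_operators H A V"
  shows "hj_operators H A V"
    and "is_lipschitz u \<Longrightarrow> viscosity_cauchy H s u (\<lambda>(t, x). V s t u x)"
    and "is_lipschitz u \<Longrightarrow> viscosity_cauchy H s u v \<Longrightarrow> s \<le> t \<Longrightarrow> v (t, x) = V s t u x"
proof -
  note * = assms[unfolded viscosity_operators_def]
  show "hj_operators H A V" by (rule *[THEN conjunct2, THEN conjunct1])
  note ** = *[THEN conjunct1, THEN spec, THEN spec, THEN mp, of u s]
  show "viscosity_cauchy H s u (\<lambda>(t, x). V s t u x)" if "is_lipschitz u" by (rule **[OF that, THEN conjunct1])
  show "v (t, x) = V s t u x" if "is_lipschitz u" "viscosity_cauchy H s u v" "s \<le> t"
    using **[OF that(1), THEN conjunct2] that by blast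
qed

text \<open>Points on opposite sides of time \<open>T\<close> are joined through
  \<open>(T, x)\<close>; neither leg is longer than the original distance, so the constants
  add.\<close>

lemma lipschitz_on_time_glue:
  fixes v :: "real \<times> 'a::metric_space \<Rightarrow> real"
  assumes 1: "K-lipschitz_on ({a..T} \<times> UNIV) v" and 2: "L-lipschitz_on ({T..b} \<times> UNIV) v" and T: "a \<le> T" "T \<le> b"
  shows "(K + L)-lipschitz_on ({a..b} \<times> UNIV) v"
proof -
  have K: "0 \<le> K" and L: "0 \<le> L" using lipschitz_on_nonneg 1 2 by blast+
  have across: "dist (v (s, x)) (v (t, y)) \<le> (K + L) * dist (s, x) (t, y)"
    if "a \<le> s" "s \<le> T" "T \<le> t" "t \<le> b" for s t x y
  proof -
    have "(s, x) \<in> {a..T} \<times> UNIV" "(T, x) \<in> {a..T} \<times> UNIV" using that T by auto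
    from lipschitz_onD[OF 1 this] have "dist (v (s, x)) (v (T, x)) \<le> K * dist (s, x) (T, x)" .
    also have "\<dots> \<le> K * dist (s, x) (t, y)"
      using K that by (intro mult_left_mono) (auto simp: dist_Pair_Pair dist_real_def intro!: real_le_rsqrt add_increasing2 power_mono)
    finally have d1: "dist (v (s, x)) (v (T, x)) \<le> K * dist (s, x) (t, y)" .
    have "(T, x) \<in> {T..b} \<times> UNIV" "(t, y) \<in> {T..b} \<times> UNIV" using that T by auto
    from lipschitz_onD[OF 2 this] have "dist (v (T, x)) (v (t, y)) \<le> L * dist (T, x) (t, y)" .
    also have "\<dots> \<le> L * dist (s, x) (t, y)"
      using L that by (intro mult_left_mono)
        (auto simp: dist_Pair_Pair dist_real_def intro!: real_sqrt_le_mono add_right_mono power_mono)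
    finally have d2: "dist (v (T, x)) (v (t, y)) \<le> L * dist (s, x) (t, y)" .
    show ?thesis using d1 d2 dist_triangle[of "v (s, x)" "v (t, y)" "v (T, x)"] by (simp add: algebra_simps)
  qed
  show ?thesis
  proof (rule lipschitz_onI)
    fix y z assume yz: "y \<in> {a..b} \<times> (UNIV::'a set)" "z \<in> {a..b} \<times> (UNIV::'a set)"
    obtain s x t x' where e: "y = (s, x)" "z = (t, x')" by (metis prod.exhaust)
    have "0 \<le> K * dist y z" "0 \<le> L * dist y z" using K L by simp_all
    consider "s \<le> T" "t \<le> T" | "T \<le> s" "T \<le> t" | "s \<le> T" "T \<le> t" | "T \<le> s" "t \<le> T" by linarith
    then show "dist (v y) (v z) \<le> (K + L) * dist y z"
    proof cases
      case 1
      then have "y \<in> {a..T} \<times> UNIV" "z \<in> {a..T} \<times> UNIV" using yz e by auto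
      from lipschitz_onD[OF assms(1) this] \<open>0 \<le> L * dist y z\<close> show ?thesis by (simp add: algebra_simps)
    next
      case 2
      then have "y \<in> {T..b} \<times> UNIV" "z \<in> {T..b} \<times> UNIV" using yz e by auto
      from lipschitz_onD[OF assms(2) this] \<open>0 \<le> K * dist y z\<close> show ?thesis by (simp add: algebra_simps)
    next
      case 3
      then show ?thesis using across[of s t x x'] yz e by simp
    next
      case 4
      then show ?thesis using across[of t s x' x] yz e by (simp add: dist_commute)
    qed
  qed (use K L in simp)
qed

lemma lipschitz_on_slice:
  assumes "K-lipschitz_on (I \<times> UNIV) v" "t \<in> I"
  shows "K-lipschitz_on UNIV (\<lambda>x. v (t, x))"
proof (rule lipschitz_onI[OF _ lipschitz_on_nonneg[OF assms(1)]])
  fix x y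
  have "(t, z) \<in> I \<times> UNIV" for z using assms(2) by auto
  from lipschitz_onD[OF assms(1) this[of x] this[of y]] show "dist (v (t, x)) (v (t, y)) \<le> K * dist x y"
    by (simp add: dist_Pair_Pair)
qed

text \<open>Serves to pass in both directions between \<open>v\<close> and \<open>v - u\<close>, the
  function that \<open>viscosity_cauchy\<close> constrains.\<close>

lemma lipschitz_on_add_snd:
  fixes v :: "real \<times> 'a::metric_space \<Rightarrow> real"
  assumes "K-lipschitz_on X v" "L-lipschitz_on UNIV u"
  shows "(K + L)-lipschitz_on X (\<lambda>z. v z + u (snd z))"
proof -
  have "L-lipschitz_on X (\<lambda>z. u (snd z))"
  proof (rule lipschitz_onI[OF _ lipschitz_on_nonneg[OF assms(2)]])
    fix y z :: "real \<times> 'a"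
    have "dist (u (snd y)) (u (snd z)) \<le> L * dist (snd y) (snd z)" using lipschitz_onD[OF assms(2)] by simp
    also have "\<dots> \<le> L * dist y z" by (intro mult_left_mono dist_snd_le lipschitz_on_nonneg[OF assms(2)])
    finally show "dist (u (snd y)) (u (snd z)) \<le> L * dist y z" .
  qed
  with assms(1) show ?thesis by (rule lipschitz_on_add)
qed

text \<open>The definition gives a Lipschitz bound on the open slab only; continuity of
  \<open>v\<close> carries it to the closure, including the initial time.\<close>

lemma viscosity_cauchy_lipschitz:
  fixes u :: "'a::euclidean_space \<Rightarrow> real"
  assumes "viscosity_cauchy H s u v" "is_lipschitz u" "s < T"
  shows "\<exists>L. L-lipschitz_on ({s..T} \<times> UNIV) v"
proof -
  obtain K where K: "K-lipschitz_on UNIV u" using assms(2) by (auto simp: is_lipschitz_def)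
  obtain L where L: "L-lipschitz_on ({s<..<T} \<times> UNIV) (\<lambda>(t, x). v (t, x) - u x)"
    using assms(1,3) unfolding viscosity_cauchy_def by blast
  from lipschitz_on_add_snd[OF L K] have *: "(L + K)-lipschitz_on ({s<..<T} \<times> UNIV) v" by (simp add: split_beta)
  have cl: "closure ({s<..<T} \<times> (UNIV :: 'a set)) = {s..T} \<times> UNIV"
    using assms(3) by (simp add: closure_Times)
  have "continuous_on ({s..T} \<times> UNIV) v"
    using assms(1) unfolding viscosity_cauchy_def by (auto elim: continuous_on_subset)
  then have "(L + K)-lipschitz_on ({s..T} \<times> UNIV) v"
    using lipschitz_on_closure[OF *] unfolding cl by blast
  then show ?thesis by blast
qed

text \<open>The Lipschitz bound on closed slabs yields both growth conditions: in time it bounds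
  \<open>v - u\<close> by the elapsed time, and on the initial slice it makes \<open>u\<close>
  Lipschitz.\<close>

lemma viscosity_cauchy_of_lipschitz:
  fixes u :: "'a::euclidean_space \<Rightarrow> real"
  assumes lip: "\<And>T. s < T \<Longrightarrow> \<exists>L. L-lipschitz_on ({s..T} \<times> UNIV) v" and init: "\<And>x. v (s, x) = u x"
    and cont: "continuous_on ({s..} \<times> UNIV) v" and visc: "viscosity_solution H ({s<..} \<times> UNIV) v"
  shows "viscosity_cauchy H s u v"
  unfolding viscosity_cauchy_def
proof (intro conjI allI impI)
  fix T assume T: "s < T"
  obtain L where L: "L-lipschitz_on ({s..T} \<times> UNIV) v" using lip[OF T] by blast
  have L0: "0 \<le> L" using lipschitz_on_nonneg[OF L] .
  have "\<bar>v (t, x) - u x\<bar> \<le> L * (T - s)" if "s < t" "t < T" for t x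
  proof -
    have "(t, x) \<in> {s..T} \<times> UNIV" "(s, x) \<in> {s..T} \<times> UNIV" using that by auto
    from lipschitz_onD[OF L this] have "\<bar>v (t, x) - u x\<bar> \<le> L * (t - s)"
      using that by (simp add: init dist_Pair_Pair dist_real_def)
    also have "\<dots> \<le> L * (T - s)" using that L0 by (intro mult_left_mono) auto
    finally show ?thesis .
  qed
  then show "bounded ((\<lambda>(t, x). v (t, x) - u x) ` ({s<..<T} \<times> UNIV))"
    unfolding bounded_iff by (intro exI[of _ "L * (T - s)"]) auto
  have "s \<in> {s..T}" using T by simp
  from lipschitz_on_slice[OF L this] have "L-lipschitz_on UNIV (\<lambda>x. - u x)"
    by (simp add: init)
  from lipschitz_on_add_snd[OF L this] have "(L + L)-lipschitz_on ({s..T} \<times> UNIV) (\<lambda>(t, x). v (t, x) - u x)"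
    by (simp add: split_beta)
  then have "(L + L)-lipschitz_on ({s<..<T} \<times> UNIV) (\<lambda>(t, x). v (t, x) - u x)"
    by (rule lipschitz_on_subset) auto
  then show "\<exists>L. L-lipschitz_on ({s<..<T} \<times> UNIV) (\<lambda>(t, x). v (t, x) - u x)" by blast
qed (use assms in auto)

section \<open>The viscosity tests for the infimum and for its continuation\<close>

context hj_family
begin

text \<open>Contact is assumed with the members rather than with \<open>w\<close>, so that the test
  also applies at the seam of the glued function. There an active member and \<open>\<phi>\<close>
  have equal differentials, whence equality in the equation.\<close>

lemma w_supersolution:
  assumes t: "ereal \<bar>t\<bar> < l" and \<phi>: "Ck_on 2 UNIV \<phi>" "\<phi> (t, x) = w t x"
    and below: "\<And>f. f \<in> F \<Longrightarrow> \<forall>\<^sub>F y in nhds (t, x). \<phi> y \<le> f y"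
  shows "hj_lhs H \<phi> (t, x) = 0"
proof -
  obtain f where f: "f \<in> F" "f (t, x) = w t x" using w_attained[OF t] by blast
  have z: "(t, x) \<in> S" using t by (rule S_iff[THEN iffD2])
  note df = hj_classicalD(3)[OF F_classical[OF f(1)] z] and d\<phi> = Ck_on_2D(1)[OF \<phi>(1) UNIV_I, of "(t, x)"]
  have "((\<lambda>y. f y - \<phi> y) has_derivative (\<lambda>v. blinfun_apply (fderiv f (t, x)) v - blinfun_apply (fderiv \<phi> (t, x)) v)) (at (t, x))"
    by (rule has_derivative_diff[OF fderiv_works[OF df] fderiv_works[OF d\<phi>]])
  moreover have "\<forall>\<^sub>F y in at (t, x). f (t, x) - \<phi> (t, x) \<le> f y - \<phi> y"
    using below[OF f(1)] unfolding eventually_at_filter by eventually_elim (simp add: f(2) \<phi>(2))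
  ultimately have "(\<lambda>v. blinfun_apply (fderiv f (t, x)) v - blinfun_apply (fderiv \<phi> (t, x)) v) = (\<lambda>v. 0)"
    by (rule has_derivative_local_min)
  then have "blinfun_apply (fderiv f (t, x)) v - blinfun_apply (fderiv \<phi> (t, x)) v = 0" for v by (rule fun_cong)
  then have eq: "fderiv f (t, x) = fderiv \<phi> (t, x)" by (intro blinfun_eqI) simp
  have "dt \<phi> (t, x) = dt f (t, x)" using dt_has_derivative(2)[OF df] dt_has_derivative(2)[OF d\<phi>] eq by simp
  moreover have "dx \<phi> (t, x) = dx f (t, x)" using dx_eq_sum[OF df] dx_eq_sum[OF d\<phi>] eq by simp
  ultimately show ?thesis using hj_classicalD(2)[OF F_classical[OF f(1)] z] by (simp add: hj_lhs_def)
qed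

text \<open>The cut \<open>T\<close> is arbitrary within the lifespan, and the identity is read off
  exactly at the cut, where the glued function is still \<open>w\<close>.\<close>

lemma viscosity_eq_w:
  assumes G: "variational_resolution H A G" and V: "viscosity_operators H A V"
    and conv: "\<And>t x. 0 \<le> t \<Longrightarrow> ereal t < l \<Longrightarrow> convex (dx_family F t x)"
    and T: "0 \<le> T" "ereal T < l"
  shows "V 0 T u0 x = w T x"
proof -
  define v where "v = (\<lambda>(t, x). if t \<le> T then w t x else V T t (w T) x)"
  note T' = time_nonneg[OF T]
  note lipT = w_is_lipschitz[OF T'(1)]
  have opG: "hj_operators H A G" using G unfolding variational_resolution_def by blast
  note opV = viscosity_operatorsD(1)[OF V]
  note VT = viscosity_operatorsD(2)[OF V lipT, of T]
  have VTT: "V T T (w T) x = w T x" for x using VT unfolding viscosity_cauchy_def by simp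
  have v_early: "v (t, x) = w t x" if "t \<le> T" for t x using that by (simp add: v_def)
  have v_late: "v (t, x) = V T t (w T) x" if "T \<le> t" for t x using that VTT by (auto simp: v_def)
  obtain K where K: "K-lipschitz_on ({-T..T} \<times> UNIV) (\<lambda>(t, x). w t x)" using w_lipschitz[OF T] by blast
  have early: "K-lipschitz_on ({0..T} \<times> UNIV) v"
  proof -
    have "K-lipschitz_on ({0..T} \<times> UNIV) (\<lambda>(t, x). w t x)" by (rule lipschitz_on_subset[OF K]) (use T in auto)
    then show ?thesis by (rule lipschitz_on_transform) (auto simp: v_early)
  qed
  have lip: "\<exists>L. L-lipschitz_on ({0..b} \<times> UNIV) v" for b
  proof -
    \<comment> \<open>\<open>T + 1\<close> keeps the late slab nondegenerate even when
      \<open>b \<le> T\<close>.\<close>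
    define c where "c = max b (T + 1)"
    have c: "T < c" "b \<le> c" by (auto simp: c_def)
    obtain L where "L-lipschitz_on ({T..c} \<times> UNIV) (\<lambda>(t, x). V T t (w T) x)"
      using viscosity_cauchy_lipschitz[OF VT lipT c(1)] by blast
    then have "L-lipschitz_on ({T..c} \<times> UNIV) v" by (rule lipschitz_on_transform) (auto simp: v_late)
    from lipschitz_on_time_glue[OF early this T(1)] c have "(K + L)-lipschitz_on ({0..c} \<times> UNIV) v" by simp
    then show ?thesis using c(2) by (intro exI[of _ "K + L"]) (erule lipschitz_on_subset, auto)
  qed
  have cont: "continuous_on ({0..} \<times> UNIV) v"
  proof -
    have "continuous_on ({T..} \<times> UNIV) (\<lambda>(t, x). V T t (w T) x)" using VT unfolding viscosity_cauchy_def by (rule conjunct1)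
    then have "continuous_on ({T..} \<times> UNIV) v"
      by (rule continuous_on_eq) (auto simp: v_late)
    with lipschitz_on_continuous_on[OF early] have "continuous_on ({0..T} \<times> UNIV \<union> {T..} \<times> UNIV) v"
      by (intro continuous_on_closed_Un closed_Times) auto
    moreover have "{0..T} \<times> UNIV \<union> {T..} \<times> UNIV = {0..} \<times> (UNIV :: 'a set)" using T by auto
    ultimately show ?thesis by simp
  qed
  \<comment> \<open>Past \<open>T\<close> this is monotonicity and consistency of \<open>V\<close>
    started from \<open>w T\<close>; it carries the supersolution test across the seam.\<close>
  have v_le: "v (t, x) \<le> f (t, x)" if "f \<in> F" "0 \<le> t" "ereal t < l" for f t x
    using w_le[OF time_nonneg(1)[OF that(2,3)] that(1)] operators_le_classical[OF opV T(1) _ that(3,1)]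
    by (cases "t \<le> T") (auto simp: v_early v_late)
  have visc: "viscosity_solution H ({0<..} \<times> UNIV) v"
    unfolding viscosity_solution_def
  proof (intro conjI ballI allI impI)
    show "continuous_on ({0<..} \<times> UNIV) v" by (rule continuous_on_subset[OF cont]) auto
  next
    fix z :: "real \<times> 'a" and \<phi> assume z: "z \<in> {0<..} \<times> UNIV" and \<phi>: "smooth_on UNIV \<phi> \<and> \<phi> z = v z"
    obtain t x where tx: "z = (t, x)" by fastforce
    have t: "0 < t" using z tx by simp
    note C2 = smooth_on_imp_Ck_on[OF \<phi>[THEN conjunct1], of 2]
    \<comment> \<open>Strictly after \<open>T\<close> the glued function agrees near
      \<open>z\<close> with the viscosity solution started at \<open>T\<close> and inherits both
      tests from it.\<close>
    have late: "(\<forall>\<^sub>F y in nhds z. v y = (case y of (t, x) \<Rightarrow> V T t (w T) x)) \<and>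
      ((\<forall>\<^sub>F y in nhds z. (case y of (t, x) \<Rightarrow> V T t (w T) x) \<le> \<phi> y) \<longrightarrow> hj_lhs H \<phi> z \<le> 0) \<and>
      ((\<forall>\<^sub>F y in nhds z. \<phi> y \<le> (case y of (t, x) \<Rightarrow> V T t (w T) x)) \<longrightarrow> 0 \<le> hj_lhs H \<phi> z)" if "T < t"
    proof -
      have "open ({T<..} \<times> (UNIV :: 'a set))" "z \<in> {T<..} \<times> UNIV" using that tx by (auto intro: open_Times)
      from eventually_nhds_in_open[OF this]
      have ev: "\<forall>\<^sub>F y in nhds z. v y = (case y of (t, x) \<Rightarrow> V T t (w T) x)"
        by eventually_elim (auto simp: v_late)
      have "\<phi> z = (case z of (t, x) \<Rightarrow> V T t (w T) x)" using \<phi> tx that by (simp add: v_late)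
      moreover have "viscosity_solution H ({T<..} \<times> UNIV) (\<lambda>(t, x). V T t (w T) x)"
        using VT unfolding viscosity_cauchy_def by (rule conjunct1[OF conjunct2])
      ultimately show ?thesis using ev \<phi> \<open>z \<in> {T<..} \<times> UNIV\<close> unfolding viscosity_solution_def by blast
    qed
    { assume above: "\<forall>\<^sub>F y in nhds z. v y \<le> \<phi> y"
      show "hj_lhs H \<phi> z \<le> 0"
      proof (cases "T < t")
        case True
        note l = late[OF True]
        have "\<forall>\<^sub>F y in nhds z. (case y of (t, x) \<Rightarrow> V T t (w T) x) \<le> \<phi> y"
          using above l[THEN conjunct1] by eventually_elim simp
        then show ?thesis using l by blast
      next
        case False
        obtain e where e: "e > 0" "\<And>y. dist y z < e \<Longrightarrow> v y \<le> \<phi> y" using above unfolding eventually_nhds_metric by blast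
        have tl: "ereal t < l" using le_less_trans[OF _ T(2), of "ereal t"] False by simp
        show ?thesis unfolding tx
        \<comment> \<open>Contact is required only at times \<open>s \<le> t\<close>, where
          \<open>v\<close> is \<open>w\<close>; for \<open>t = T\<close> the continuation is never
          consulted.\<close>
        proof (rule w_subsolution_backward[OF opG _ t tl C2 _ e(1)])
          show "w t x \<le> G s t (w s) x" if "0 \<le> s" "s \<le> t" for s
            using variational_eq_w[OF G that tl conv[OF that(1)]] le_less_trans[OF _ tl, of "ereal s"] that by simp
          show "\<phi> (t, x) = w t x" using \<phi> tx v_early False by simp
          show "w s y \<le> \<phi> (s, y)" if "s \<le> t" "dist (s, y) (t, x) < e" for s y
            using e(2)[of "(s, y)"] that tx v_early[of s y] False by simp
        qed
      qed
    }
    { assume below: "\<forall>\<^sub>F y in nhds z. \<phi> y \<le> v y"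
      show "0 \<le> hj_lhs H \<phi> z"
      proof (cases "T < t")
        case True
        note l = late[OF True]
        have "\<forall>\<^sub>F y in nhds z. \<phi> y \<le> (case y of (t, x) \<Rightarrow> V T t (w T) x)"
          using below l[THEN conjunct1] by eventually_elim simp
        then show ?thesis using l by blast
      next
        case False
        have tl: "ereal t < l" using le_less_trans[OF _ T(2), of "ereal t"] False by simp
        have "\<forall>\<^sub>F y in nhds (t, x). \<phi> y \<le> f y" if f: "f \<in> F" for f
        proof -
          \<comment> \<open>For \<open>t = T\<close> this neighbourhood contains times after
            \<open>T\<close>, where \<open>v\<close> is the continuation; \<open>v_le\<close> covers
            both sides as long as the time stays within the lifespan.\<close>
          have "open (S \<inter> {0<..} \<times> UNIV)" "(t, x) \<in> S \<inter> {0<..} \<times> UNIV"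
            using S_iff[THEN iffD2, OF time_nonneg(1)[OF less_imp_le[OF t] tl]] t
            by (auto intro!: open_Int open_strip open_Times)
          from eventually_nhds_in_open[OF this] below[unfolded tx]
          show ?thesis
          proof eventually_elim
            case (elim y)
            then have "v (fst y, snd y) \<le> f (fst y, snd y)" by (intro v_le[OF f]) (auto simp: strip_def)
            then show ?case using elim by simp
          qed
        qed
        then have "hj_lhs H \<phi> (t, x) = 0"
          using w_supersolution[OF time_nonneg(1)[OF less_imp_le[OF t] tl] C2] \<phi> tx v_early False by simp
        then show ?thesis by (simp add: tx)
      qed
    }
  qed
  have init: "v (0, x) = u0 x" for x using T by (simp add: v_early w_0)
  have "u0 = w 0" by (rule ext) (simp add: w_0)
  then have "is_lipschitz u0" using w_is_lipschitz[of 0] l_pos by (simp add: zero_ereal_def[symmetric])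
  then have "v (T, x) = V 0 T u0 x"
    by (rule viscosity_operatorsD(3)[OF V _ viscosity_cauchy_of_lipschitz[OF lip init cont visc] T(1)])
  then show ?thesis by (simp add: v_early)
qed

end

theorem mainTheorem2:
  fixes H :: "real \<times> (real ^ 'd) \<times> (real ^ 'd) \<Rightarrow> real"
    and A B :: real
    and Q :: "real \<Rightarrow> ennreal \<Rightarrow> ennreal"
    and G V :: "real \<Rightarrow> real \<Rightarrow> (real ^ 'd \<Rightarrow> real) \<Rightarrow> real ^ 'd \<Rightarrow> real"
    and F0 :: "(real ^ 'd \<Rightarrow> real) set"
    and u0 :: "real ^ 'd \<Rightarrow> real"
    and F :: "(real \<times> (real ^ 'd) \<Rightarrow> real) set"
  assumes H: "hamiltonian H A"
    and Q: "classical_solvability H A Q"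
    and G: "variational_resolution H A G"
    and V: "viscosity_operators H A V"
    and F0_C2: "\<forall>f0\<in>F0. Ck_on 2 UNIV f0"
    and F0_equi_lipschitz: "\<exists>L. \<forall>f0\<in>F0. L-lipschitz_on UNIV f0"
    and F0_bound: "\<forall>f0\<in>F0. \<forall>x. norm (fderiv2 f0 x) \<le> B"
    and u0: "\<forall>x. ereal (u0 x) = (INF f0\<in>F0. ereal (f0 x))"
    and F: "F = {f. hj_classical H (strip (- lifespan Q B) (lifespan Q B)) f \<and>
                    (\<lambda>x. f (0, x)) \<in> F0}"
    and F_closed: "closed_C1_loc (strip (- lifespan Q B) (lifespan Q B)) F"
  shows "((\<forall>x. convex (dx_family F 0 x)) \<longrightarrow>
            (\<forall>t x. 0 \<le> t \<and> ereal t < lifespan Q B \<longrightarrow>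
               ereal (G 0 t u0 x) = (INF f\<in>F. ereal (f (t, x)))))
       \<and> ((\<forall>t x. 0 \<le> t \<and> ereal t < lifespan Q B \<longrightarrow> convex (dx_family F t x)) \<longrightarrow>
            (\<forall>t x. 0 \<le> t \<and> ereal t < lifespan Q B \<longrightarrow>
               V 0 t u0 x = G 0 t u0 x \<and>
               ereal (G 0 t u0 x) = (INF f\<in>F. ereal (f (t, x)))))"
proof -
  obtain L where L: "\<forall>f0\<in>F0. L-lipschitz_on UNIV f0" using F0_equi_lipschitz by blast
  interpret hj_family H A B L Q F0 u0 F
    by unfold_locales (use H Q F0_C2 L F0_bound u0 F F_closed in \<open>blast+\<close>)
  have u0_eq: "u0 = w 0" by (rule ext) (simp add: w_0)
  have i: "ereal (G 0 t u0 x) = (INF f\<in>F. ereal (f (t, x)))"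
    if "\<And>x. convex (dx_family F 0 x)" "0 \<le> t" "ereal t < lifespan Q B" for t x
    using variational_eq_w[OF G order.refl that(2,3,1)] w_eq_INF[OF time_nonneg(1)[OF that(2,3)]]
    unfolding u0_eq by simp
  show ?thesis
  proof (intro conjI impI allI)
    fix t x assume c: "\<forall>x. convex (dx_family F 0 x)" and t: "0 \<le> t \<and> ereal t < lifespan Q B"
    show "ereal (G 0 t u0 x) = (INF f\<in>F. ereal (f (t, x)))" by (rule i) (use c t in auto)
  next
    fix t x assume c: "\<forall>t x. 0 \<le> t \<and> ereal t < lifespan Q B \<longrightarrow> convex (dx_family F t x)"
      and t: "0 \<le> t \<and> ereal t < lifespan Q B"
    have c0: "convex (dx_family F 0 x)" for x using c l_pos by (simp add: zero_ereal_def[symmetric])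
    show "ereal (G 0 t u0 x) = (INF f\<in>F. ereal (f (t, x)))" by (rule i) (use c0 t in auto)
    \<comment> \<open>The time under consideration serves as the cut of the gluing.\<close>
    have "V 0 t u0 x = w t x" by (rule viscosity_eq_w[OF G V]) (use c t in auto)
    moreover have "G 0 t u0 x = w t x"
      using variational_eq_w[OF G order.refl _ _ c0, of t x] t unfolding u0_eq by simp
    ultimately show "V 0 t u0 x = G 0 t u0 x" by simp
  qed
qed

end
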